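(* Let $K$ be a dyadic non-Archimedean local field of characteristic zero and $E/K$ a ramified quadratic field extension. Then for every (non-degenerate) hermitian lattice $L$ over $E$, the unitary group $U(L)$ is generated by symmetries and rescaled Eichler isometries, i.e. $U(L)=X(L)$.
   Context: $K$ has valuation ring $\mathfrak{o}$; dyadic means $2\notin\mathfrak{o}^\times$. $E$ has non-trivial $K$-automorphism $x\mapsto\bar x$, trace $\mathrm{Tr}(\alpha)=\alpha+\bar\alpha$; $\mathcal{O}$ is the ring of integers of $E$. A hermitian space is a finitely generated free $E$-module $V$ with a map $\langle\cdot,\cdot\rangle:V\times V\to E$, $E$-linear in the first argument, with $\langle x,y\rangle=\overline{\langle y,x\rangle}$. A hermitian lattice is a finitely generated $\mathcal{O}$-submodule $L$ of such $V$, non-degenerate if no nonzero element of $L$ is orthogonal to all of $L$. $U(V)$ is the group of form-preserving $E$-linear automorphisms, $U(L)=\{f\in U(V): f(L)=L\}$. For $s\in V$, $\sigma\in E^\times$ with $\langle s,s\rangle=\mathrm{Tr}(\sigma)$ the symmetry is $S_{s,\sigma}(x)=x-\langle x,s\rangle\sigma^{-1}s$; $S(L)$ is the subgroup of $U(L)$ generated by symmetries lying in $U(L)$. A hyperbolic pair splitting $L$ is a pair $(u,v)$ of linearly independent elements of $L$ with $\langle u,u\rangle=\langle v,v\rangle=0$ such that, with $P=\mathcal{O}u\oplus\mathcal{O}v$, $L=P\perp P^\perp$, where $P^\perp=\{x\in L:\langle x,P\rangle=0\}$. For such a pair, $y\in P^\perp$ with $\langle L,y\rangle\subseteq\langle u,v\rangle\mathcal{O}$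 and $\mu\in\mathcal{O}$ with $\mathrm{Tr}(\mu\langle u,v\rangle)=-\langle y,y\rangle$, the rescaled Eichler isometry $E^\mu_y\in U(L)$ is $x\mapsto x+\frac{\langle x,u\rangle}{\langle v,u\rangle}y+\Big(\frac{\mu\langle x,u\rangle}{\langle v,u\rangle}-\frac{\langle x,y\rangle}{\langle u,v\rangle}\Big)u$. $X(L)$ is the subgroup of $U(L)$ generated by $S(L)$ and all rescaled Eichler isometries of $L$ (with respect to all hyperbolic pairs splitting $L$).
   Formalization: The ambient hermitian space V is assumed non-degenerate as well as L (automatic when L spans V); if V has a nonzero radical the claim fails, e.g. V = E with zero form and L = 0, where U(L) = E^× but X(L) is trivial. *)

theory Defs
  imports
    "HOL-Computational_Algebra.Polynomial"
    "HOL-Algebra.Bij"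
    "HOL-Algebra.Generated_Groups"
begin

section \<open>Local fields\<close>

text \<open>
  A discrete valuation is given by its values on nonzero elements; the value at \<open>0\<close> is
  irrelevant. The set \<open>val_ge val n\<close> is the fractional ideal of elements of valuation at
  least \<open>n\<close>.
\<close>

definition val_ge :: "('k::field \<Rightarrow> int) \<Rightarrow> int \<Rightarrow> 'k set" where
  "val_ge val n = {x. x = 0 \<or> val x \<ge> n}"

abbreviation val_ring :: "('k::field \<Rightarrow> int) \<Rightarrow> 'k set" where
  "val_ring val \<equiv> val_ge val 0"

abbreviation val_ideal :: "('k::field \<Rightarrow> int) \<Rightarrow> 'k set" where
  "val_ideal val \<equiv> val_ge val 1"

definition discrete_valuation :: "('k::field \<Rightarrow> int) \<Rightarrow> bool" where
  "discrete_valuation val \<longleftrightarrow>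
     (\<forall>x y. x \<noteq> 0 \<longrightarrow> y \<noteq> 0 \<longrightarrow> val (x * y) = val x + val y) \<and>
     (\<forall>x y. x \<noteq> 0 \<longrightarrow> y \<noteq> 0 \<longrightarrow> x + y \<noteq> 0 \<longrightarrow> val (x + y) \<ge> min (val x) (val y)) \<and>
     (\<exists>x. x \<noteq> 0 \<and> val x = 1)"

definition val_complete :: "('k::field \<Rightarrow> int) \<Rightarrow> bool" where
  "val_complete val \<longleftrightarrow>
     (\<forall>X :: nat \<Rightarrow> 'k.
        (\<forall>n. \<exists>N. \<forall>i\<ge>N. \<forall>j\<ge>N. X i - X j \<in> val_ge val n) \<longrightarrow>
        (\<exists>l. \<forall>n. \<exists>N. \<forall>i\<ge>N. X i - l \<in> val_ge val n))"

definition residue_field :: "('k::field \<Rightarrow> int) \<Rightarrow> 'k set set" where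
  "residue_field val =
     val_ring val // {(x, y). x \<in> val_ring val \<and> y \<in> val_ring val \<and> x - y \<in> val_ideal val}"

definition nonarch_local_field :: "('k::field \<Rightarrow> int) \<Rightarrow> bool" where
  "nonarch_local_field val \<longleftrightarrow>
     discrete_valuation val \<and> val_complete val \<and> finite (residue_field val)"

definition unit_in :: "'a::comm_ring_1 set \<Rightarrow> 'a \<Rightarrow> bool" where
  "unit_in R x \<longleftrightarrow> x \<in> R \<and> (\<exists>y\<in>R. x * y = 1)"

definition dyadic :: "('k::field \<Rightarrow> int) \<Rightarrow> bool" where
  "dyadic val \<longleftrightarrow> \<not> unit_in (val_ring val) 2"


section \<open>Ramified quadratic extensions\<close>

definition quadratic_extension :: "('k::field \<Rightarrow> 'e::field) \<Rightarrow> bool" where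
  "quadratic_extension emb \<longleftrightarrow>
     emb 1 = 1 \<and> (\<forall>x y. emb (x + y) = emb x + emb y) \<and> (\<forall>x y. emb (x * y) = emb x * emb y) \<and>
     vector_space.dim (\<lambda>a x. emb a * x) (UNIV :: 'e set) = 2"

definition nontrivial_automorphism :: "('k::field \<Rightarrow> 'e::field) \<Rightarrow> ('e \<Rightarrow> 'e) \<Rightarrow> bool" where
  "nontrivial_automorphism emb bar \<longleftrightarrow>
     bij bar \<and> (\<forall>x y. bar (x + y) = bar x + bar y) \<and> (\<forall>x y. bar (x * y) = bar x * bar y) \<and>
     (\<forall>a. bar (emb a) = emb a) \<and> bar \<noteq> id"

definition trace :: "('e::field \<Rightarrow> 'e) \<Rightarrow> 'e \<Rightarrow> 'e" where
  "trace bar x = x + bar x"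

text \<open>The integral closure in \<open>E\<close> of the valuation ring of \<open>K\<close>.\<close>

definition integers :: "('k::field \<Rightarrow> int) \<Rightarrow> ('k \<Rightarrow> 'e::field) \<Rightarrow> 'e set" where
  "integers val emb =
     {x. \<exists>p. lead_coeff p = 1 \<and> (\<forall>i. coeff p i \<in> val_ring val) \<and> poly (map_poly emb p) x = 0}"

text \<open>The submodule generated by \<open>S\<close> over a subring \<open>R\<close> of the field of scalars.\<close>

definition span_over ::
    "'e::comm_ring_1 set \<Rightarrow> ('e \<Rightarrow> 'v \<Rightarrow> 'v::ab_group_add) \<Rightarrow> 'v set \<Rightarrow> 'v set" where
  "span_over R scale S =
     {(\<Sum>s\<in>F. scale (c s) s) | F c. finite F \<and> F \<subseteq> S \<and> c ` F \<subseteq> R}"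

definition nonunits :: "'a::comm_ring_1 set \<Rightarrow> 'a set" where
  "nonunits R = {x \<in> R. \<not> unit_in R x}"

fun ideal_power :: "'a::comm_ring_1 set \<Rightarrow> 'a set \<Rightarrow> nat \<Rightarrow> 'a set" where
  "ideal_power R I 0 = R"
| "ideal_power R I (Suc n) = span_over R (*) {x * y | x y. x \<in> I \<and> y \<in> ideal_power R I n}"

text \<open>
  The nonunits of the (local) ring of integers of \<open>E\<close> form its maximal ideal. The extension is
  ramified if the maximal ideal of \<open>K\<close> generates the \<open>e\<close>-th power of it with
  ramification index \<open>e > 1\<close>.
\<close>

definition ramified :: "('k::field \<Rightarrow> int) \<Rightarrow> ('k \<Rightarrow> 'e::field) \<Rightarrow> bool" where
  "ramified val emb \<longleftrightarrow>
     (let R = integers val emb in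
      \<exists>e>1. span_over R (*) (emb ` val_ideal val) = ideal_power R (nonunits R) e)"


section \<open>Hermitian spaces and lattices\<close>

text \<open>
  A hermitian space is a subspace \<open>V\<close> of some \<open>E\<close>-vector space \<open>'v\<close> of arbitrary
  dimension; the form \<open>h\<close> is only constrained on \<open>V\<close>. This way the \<open>E\<close>-span of a lattice
  is again a hermitian space in the same type.
\<close>

definition hermitian_space ::
    "('e::field \<Rightarrow> 'e) \<Rightarrow> ('e \<Rightarrow> 'v \<Rightarrow> 'v::ab_group_add) \<Rightarrow> ('v \<Rightarrow> 'v \<Rightarrow> 'e) \<Rightarrow> 'v set \<Rightarrow> bool" where
  "hermitian_space bar scale h V \<longleftrightarrow>
     vector_space scale \<and> (\<exists>B. finite B \<and> V = module.span scale B) \<and>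
     (\<forall>x\<in>V. \<forall>y\<in>V. \<forall>z\<in>V. h (x + y) z = h x z + h y z) \<and>
     (\<forall>c. \<forall>x\<in>V. \<forall>y\<in>V. h (scale c x) y = c * h x y) \<and>
     (\<forall>x\<in>V. \<forall>y\<in>V. h x y = bar (h y x))"

definition hermitian_lattice ::
    "'e::field set \<Rightarrow> ('e \<Rightarrow> 'v \<Rightarrow> 'v::ab_group_add) \<Rightarrow> 'v set \<Rightarrow> 'v set \<Rightarrow> bool" where
  "hermitian_lattice R scale V L \<longleftrightarrow> (\<exists>S. finite S \<and> S \<subseteq> V \<and> L = span_over R scale S)"

definition nondegenerate :: "('v::ab_group_add \<Rightarrow> 'v \<Rightarrow> 'e::field) \<Rightarrow> 'v set \<Rightarrow> bool" where
  "nondegenerate h M \<longleftrightarrow> (\<forall>x\<in>M. (\<forall>y\<in>M. h x y = 0) \<longrightarrow> x = 0)"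

text \<open>
  Automorphisms of \<open>V\<close> are represented by extensional functions, that is, as elements of the group
  \<^const>\<open>BijGroup\<close> of bijections of \<open>V\<close>.
\<close>

definition unitary_group ::
    "('e::field \<Rightarrow> 'v \<Rightarrow> 'v::ab_group_add) \<Rightarrow> ('v \<Rightarrow> 'v \<Rightarrow> 'e) \<Rightarrow> 'v set \<Rightarrow> ('v \<Rightarrow> 'v) set" where
  "unitary_group scale h V =
     {f \<in> carrier (BijGroup V).
        (\<forall>x\<in>V. \<forall>y\<in>V. f (x + y) = f x + f y) \<and>
        (\<forall>c. \<forall>x\<in>V. f (scale c x) = scale c (f x)) \<and>
        (\<forall>x\<in>V. \<forall>y\<in>V. h (f x) (f y) = h x y)}"

definition lattice_unitary_group ::
    "('e::field \<Rightarrow> 'v \<Rightarrow> 'v::ab_group_add) \<Rightarrow> ('v \<Rightarrow> 'v \<Rightarrow> 'e) \<Rightarrow> 'v set \<Rightarrow> 'v set \<Rightarrow> ('v \<Rightarrow> 'v) set" where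
  "lattice_unitary_group scale h V L = {f \<in> unitary_group scale h V. f ` L = L}"

definition hermitian_symmetry ::
    "('e::field \<Rightarrow> 'v \<Rightarrow> 'v::ab_group_add) \<Rightarrow> ('v \<Rightarrow> 'v \<Rightarrow> 'e) \<Rightarrow> 'v set \<Rightarrow> 'v \<Rightarrow> 'e \<Rightarrow> 'v \<Rightarrow> 'v" where
  "hermitian_symmetry scale h V s \<sigma> = (\<lambda>x\<in>V. x - scale (h x s * inverse \<sigma>) s)"

definition symmetries ::
    "('e::field \<Rightarrow> 'e) \<Rightarrow> ('e \<Rightarrow> 'v \<Rightarrow> 'v::ab_group_add) \<Rightarrow> ('v \<Rightarrow> 'v \<Rightarrow> 'e) \<Rightarrow> 'v set \<Rightarrow> ('v \<Rightarrow> 'v) set" where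
  "symmetries bar scale h V =
     {hermitian_symmetry scale h V s \<sigma> | s \<sigma>. s \<in> V \<and> \<sigma> \<noteq> 0 \<and> h s s = trace bar \<sigma>}"

definition symmetry_group ::
    "('e::field \<Rightarrow> 'e) \<Rightarrow> ('e \<Rightarrow> 'v \<Rightarrow> 'v::ab_group_add) \<Rightarrow> ('v \<Rightarrow> 'v \<Rightarrow> 'e) \<Rightarrow>
     'v set \<Rightarrow> 'v set \<Rightarrow> ('v \<Rightarrow> 'v) set" where
  "symmetry_group bar scale h V L =
     generate (BijGroup V) (symmetries bar scale h V \<inter> lattice_unitary_group scale h V L)"

definition plane :: "'e::field set \<Rightarrow> ('e \<Rightarrow> 'v \<Rightarrow> 'v::ab_group_add) \<Rightarrow> 'v \<Rightarrow> 'v \<Rightarrow> 'v set" where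
  "plane R scale u v = {scale a u + scale b v | a b. a \<in> R \<and> b \<in> R}"

definition perp_in :: "('v \<Rightarrow> 'v \<Rightarrow> 'e::field) \<Rightarrow> 'v set \<Rightarrow> 'v set \<Rightarrow> 'v set" where
  "perp_in h L P = {x \<in> L. \<forall>p\<in>P. h x p = 0}"

definition splitting_hyperbolic_pair ::
    "'e::field set \<Rightarrow> ('e \<Rightarrow> 'v \<Rightarrow> 'v::ab_group_add) \<Rightarrow> ('v \<Rightarrow> 'v \<Rightarrow> 'e) \<Rightarrow> 'v set \<Rightarrow> 'v \<Rightarrow> 'v \<Rightarrow> bool" where
  "splitting_hyperbolic_pair R scale h L u v \<longleftrightarrow>
     u \<in> L \<and> v \<in> L \<and> u \<noteq> v \<and> \<not> module.dependent scale {u, v} \<and> h u u = 0 \<and> h v v = 0 \<and>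
     (let P = plane R scale u v; Q = perp_in h L P in
      L = {p + q | p q. p \<in> P \<and> q \<in> Q} \<and> P \<inter> Q = {0})"

definition eichler ::
    "('e::field \<Rightarrow> 'v \<Rightarrow> 'v::ab_group_add) \<Rightarrow> ('v \<Rightarrow> 'v \<Rightarrow> 'e) \<Rightarrow> 'v set \<Rightarrow>
     'v \<Rightarrow> 'v \<Rightarrow> 'v \<Rightarrow> 'e \<Rightarrow> 'v \<Rightarrow> 'v" where
  "eichler scale h V u v y \<mu> =
     (\<lambda>x\<in>V. x + scale (h x u / h v u) y + scale (\<mu> * h x u / h v u - h x y / h u v) u)"

definition eichler_isometries ::
    "'e::field set \<Rightarrow> ('e \<Rightarrow> 'e) \<Rightarrow> ('e \<Rightarrow> 'v \<Rightarrow> 'v::ab_group_add) \<Rightarrow> ('v \<Rightarrow> 'v \<Rightarrow> 'e) \<Rightarrow>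
     'v set \<Rightarrow> 'v set \<Rightarrow> ('v \<Rightarrow> 'v) set" where
  "eichler_isometries R bar scale h V L =
     {eichler scale h V u v y \<mu> | u v y \<mu>.
        splitting_hyperbolic_pair R scale h L u v \<and>
        y \<in> perp_in h L (plane R scale u v) \<and>
        (\<forall>x\<in>L. h x y \<in> {h u v * a | a. a \<in> R}) \<and>
        \<mu> \<in> R \<and> trace bar (\<mu> * h u v) = - h y y}"

definition X_group ::
    "'e::field set \<Rightarrow> ('e \<Rightarrow> 'e) \<Rightarrow> ('e \<Rightarrow> 'v \<Rightarrow> 'v::ab_group_add) \<Rightarrow> ('v \<Rightarrow> 'v \<Rightarrow> 'e) \<Rightarrow>
     'v set \<Rightarrow> 'v set \<Rightarrow> ('v \<Rightarrow> 'v) set" where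
  "X_group R bar scale h V L =
     generate (BijGroup V)
       (symmetry_group bar scale h V L \<union> eichler_isometries R bar scale h V L)"

end

theory Submission
  imports Defs
begin

text \<open>
  Symmetries move \<open>x\<close> to \<open>y\<close> whenever \<open>h x x = h y y\<close> and \<open>h x (x - y)\<close> generates an ideal
  containing \<open>h L (x - y)\<close>. So one tries to move the image of a suitable vector back, and then to
  split off the vector. If the lattice splits a hyperbolic plane, Eichler isometries repair the
  cases in which no such symmetry exists. Otherwise, take a vector \<open>x\<close> generating the scale, or, if
  all norms are smaller than the scale, one generating the norm ideal together with a
  partner \<open>v\<close>. When the direct symmetry from the image to the vector is not integral, an auxiliary
  symmetry \<open>S\<^bsub>r,\<rho>\<^esub>\<close> first makes the relevant product \<open>h x (x - y)\<close> large enough; the vector \<open>r\<close>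
  exists because norms approximate all elements of the fixed field up to the different (the
  residue extension is trivial and the residue field perfect), and the only obstruction would
  produce a hyperbolic plane. On the orthogonal complement of \<open>L\<close>
  the same symmetries enlarge the fixed space of an isometry until it is everything.
\<close>

section \<open>Valued fields with a ramified involution\<close>

text \<open>The dyadic obstacle is numerical. A symmetry along \<open>s\<close> whose
  \<open>\<sigma>\<close> has valuation \<open>k\<close> needs \<open>h s s = Tr \<sigma>\<close>,
  and traces from \<open>P k\<close> lie in \<open>P (k + d - 1)\<close>, where
  \<open>d \<ge> 2\<close> is the exponent of the different. Fixed elements have even valuation and
  trace-zero elements have the parity of \<open>d\<close>; so if \<open>k - d\<close> is odd,
  \<open>h s s\<close> must have valuation exactly \<open>k + d - 1\<close>. The bounds
  \<open>k + d - 1\<close> and \<open>k + d\<close> and the parity splits come from here. An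
  auxiliary symmetry along \<open>r\<close> helps only if the product of \<open>r\<close> with the
  vector to be moved does not become small by cancellation. In the one critical case this is
  excluded by a norm form corrected by a rank-one term, which an isometry cannot annihilate. Once a
  first vector is fixed, the second one must be moved without disturbing it. Hence each element of
  \<open>X\<close> that is constructed comes with a set \<open>W\<close> such that everything
  orthogonal to \<open>W\<close> stays fixed.\<close>

locale valued_field =
  fixes w :: "'a::field \<Rightarrow> int"
  assumes w_mult: "\<And>x y. x \<noteq> 0 \<Longrightarrow> y \<noteq> 0 \<Longrightarrow> w (x * y) = w x + w y"
    and w_add: "\<And>x y. x \<noteq> 0 \<Longrightarrow> y \<noteq> 0 \<Longrightarrow> x + y \<noteq> 0 \<Longrightarrow> min (w x) (w y) \<le> w (x + y)"
begin

abbreviation P :: "int \<Rightarrow> 'a set" where "P n \<equiv> val_ge w n"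

definition exact :: "int \<Rightarrow> 'a \<Rightarrow> bool" where
  "exact n x \<longleftrightarrow> x \<noteq> 0 \<and> w x = n"

lemma P_iff: "x \<in> P n \<longleftrightarrow> x = 0 \<or> n \<le> w x"
  by (simp add: val_ge_def)

lemma w_one [simp]: "w 1 = 0"
  using w_mult[of 1 1] by simp

lemma w_minus [simp]: "w (- x) = w x"
proof (cases "x = 0")
  case False
  have "w (-1) = 0" using w_mult[of "-1" "-1"] by simp
  then show ?thesis using w_mult[of "-1" x] False by simp
qed simp

lemma w_inverse: "x \<noteq> 0 \<Longrightarrow> w (inverse x) = - w x"
  using w_mult[of x "inverse x"] by simp

lemma P_zero [simp]: "0 \<in> P n"
  by (simp add: P_iff)

lemma P_add: "x \<in> P n \<Longrightarrow> y \<in> P n \<Longrightarrow> x + y \<in> P n"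
  using w_add[of x y] by (cases "x = 0"; cases "y = 0"; cases "x + y = 0") (auto simp: P_iff)

lemma P_minus [simp]: "- x \<in> P n \<longleftrightarrow> x \<in> P n"
  by (simp add: P_iff)

lemma P_diff: "x \<in> P n \<Longrightarrow> y \<in> P n \<Longrightarrow> x - y \<in> P n"
  using P_add[of x n "- y"] by simp

lemma P_diff_commute: "x - y \<in> P n \<longleftrightarrow> y - x \<in> P n"
  using P_minus[of "x - y" n] by simp

lemma P_sum: "(\<And>i. i \<in> I \<Longrightarrow> f i \<in> P n) \<Longrightarrow> sum f I \<in> P n"
  by (induction I rule: infinite_finite_induct) (auto intro: P_add)

lemma P_mono: "x \<in> P n \<Longrightarrow> m \<le> n \<Longrightarrow> x \<in> P m"
  by (auto simp: P_iff)

lemma P_mult: "x \<in> P m \<Longrightarrow> y \<in> P n \<Longrightarrow> k \<le> m + n \<Longrightarrow> x * y \<in> P k"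
  by (cases "x = 0 \<or> y = 0") (auto simp: P_iff w_mult)

lemma exact_P: "exact n x \<Longrightarrow> x \<in> P n"
  by (simp add: exact_def P_iff)

lemma exact_iff: "exact n x \<longleftrightarrow> x \<in> P n \<and> x \<notin> P (n + 1)"
  by (auto simp: exact_def P_iff)

lemma exact_nonzero: "exact n x \<Longrightarrow> x \<noteq> 0"
  by (simp add: exact_def)

lemma exact_not_P: "exact n x \<Longrightarrow> x \<in> P m \<Longrightarrow> m \<le> n"
  by (simp add: exact_def P_iff)

lemma exact_minus [simp]: "exact n (- x) \<longleftrightarrow> exact n x"
  by (simp add: exact_def)

lemma exact_mult: "exact m x \<Longrightarrow> exact n y \<Longrightarrow> k = m + n \<Longrightarrow> exact k (x * y)"
  by (simp add: exact_def w_mult)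

lemma exact_inverse: "exact n x \<Longrightarrow> exact (- n) (inverse x)"
  by (simp add: exact_def w_inverse)

lemma exact_divide: "exact m x \<Longrightarrow> exact n y \<Longrightarrow> k = m - n \<Longrightarrow> exact k (x / y)"
  using exact_mult[of m x "- n" "inverse y" k] exact_inverse by (simp add: divide_inverse)

lemma P_divide: "x \<in> P m \<Longrightarrow> exact n y \<Longrightarrow> k \<le> m - n \<Longrightarrow> x / y \<in> P k"
  using P_mult[of x m "inverse y" "- n" k] exact_inverse[of n y] exact_P
  by (simp add: divide_inverse)

lemma exact_add: "exact n x \<Longrightarrow> y \<in> P m \<Longrightarrow> n < m \<Longrightarrow> exact n (x + y)"
  using P_add[of x n y] P_mono[of y m n] P_mono[of y m "n + 1"] P_diff[of "x + y" "n + 1" y]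
  by (auto simp: exact_iff)

lemma exact_add': "y \<in> P m \<Longrightarrow> exact n x \<Longrightarrow> n < m \<Longrightarrow> exact n (y + x)"
  using exact_add by (simp add: add.commute)

lemma exact_diff: "exact n x \<Longrightarrow> y \<in> P m \<Longrightarrow> n < m \<Longrightarrow> exact n (x - y)"
  using exact_add[of n x "- y" m] by simp

lemma exact_diff': "y \<in> P m \<Longrightarrow> exact n x \<Longrightarrow> n < m \<Longrightarrow> exact n (y - x)"
  using exact_add'[of y m n "- x"] by simp

lemma exact_P_mono: "exact n x \<Longrightarrow> m \<le> n \<Longrightarrow> x \<in> P m"
  using exact_P P_mono by blast

lemma exact_one: "exact 0 1"
  by (simp add: exact_def)

lemma exact_power: "exact n x \<Longrightarrow> exact (int m * n) (x ^ m)"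
  by (induction m) (auto simp: exact_one exact_mult distrib_right)

lemma P_power: "x \<in> P 0 \<Longrightarrow> x ^ m \<in> P 0"
  by (induction m) (auto intro: exact_P[OF exact_one] P_mult)

lemma finite_subset_P:
  assumes "finite A"
  shows "\<exists>n. A \<subseteq> P n"
  using assms
proof induction
  case (insert x A)
  then obtain n where "A \<subseteq> P n" by blast
  then have "A \<subseteq> P (min n (w x))" using P_mono[of _ n "min n (w x)"] by auto
  then have "insert x A \<subseteq> P (min n (w x))" by (simp add: P_iff)
  then show ?case by blast
qed simp

text \<open>A lower bound on valuations becomes an attained minimum; scale and norm ideals get their
  generators this way.\<close>

lemma ex_min_valuation:
  assumes "s \<in> S" "s \<noteq> 0" "S \<subseteq> P n"
  obtains k s where "S \<subseteq> P k" "s \<in> S" "exact k s"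
proof -
  have "\<exists>x. (x \<in> S \<and> x \<noteq> 0) \<and> (\<forall>y. y \<in> S \<and> y \<noteq> 0 \<longrightarrow> nat (w x - n) \<le> nat (w y - n))"
    using ex_has_least_nat[of "\<lambda>x. x \<in> S \<and> x \<noteq> 0" s "\<lambda>x. nat (w x - n)"] assms(1,2) by blast
  then obtain x where x: "x \<in> S" "x \<noteq> 0"
    and min: "\<And>y. y \<in> S \<Longrightarrow> y \<noteq> 0 \<Longrightarrow> nat (w x - n) \<le> nat (w y - n)"
    by blast
  have "y \<in> P (w x)" if "y \<in> S" for y
  proof (cases "y = 0")
    case False
    then have "n \<le> w y" using assms(3) that by (auto simp: P_iff)
    then show ?thesis using min[OF that False] by (simp add: P_iff nat_le_eq_zle)
  qed simp
  then show thesis using that[of "w x" x] x by (auto simp: exact_def)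
qed

end

text \<open>The lattice argument sees the field extension only through these properties.
  \<open>fixed_even\<close> is ramification: in the normalization of \<open>E\<close>, the fixed
  field has even valuations. \<open>square_approx\<close> combines a perfect residue field with a
  trivial residue extension and is one step of norm approximation. \<open>hensel\<close> has the
  shape \<open>z = z * z + c\<close> because 2 is not a unit: the derivative at 0 must come from the
  linear term.\<close>

locale ramified_dyadic = valued_field w
  for w :: "'e::field_char_0 \<Rightarrow> int" +
  fixes bar :: "'e \<Rightarrow> 'e" and p :: 'e
  assumes bar_add [simp]: "\<And>x y. bar (x + y) = bar x + bar y"
    and bar_mult [simp]: "\<And>x y. bar (x * y) = bar x * bar y"
    and bar_bar [simp]: "\<And>x. bar (bar x) = x"
    and w_bar [simp]: "\<And>x. w (bar x) = w x"
    and fixed_even: "\<And>x. bar x = x \<Longrightarrow> x \<noteq> 0 \<Longrightarrow> even (w x)"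
    and p_nonzero: "p \<noteq> 0" and w_p: "w p = 1"
    and w_two: "w 2 \<ge> 1"
    and square_approx: "\<And>t. bar t = t \<Longrightarrow> t \<noteq> 0 \<Longrightarrow> \<exists>z. z * bar z - t \<in> val_ge w (w t + 1)"
    and hensel: "\<And>c. bar c = c \<Longrightarrow> c \<in> val_ge w 1 \<Longrightarrow>
                   \<exists>z. bar z = z \<and> z \<in> val_ge w 1 \<and> z = z * z + c"
begin

abbreviation Tr :: "'e \<Rightarrow> 'e" where "Tr \<equiv> trace bar"

lemma bar_zero [simp]: "bar 0 = 0"
  using bar_add[of 0 0] by simp

lemma bar_minus [simp]: "bar (- x) = - bar x"
  using bar_add[of x "- x"] by (simp add: eq_neg_iff_add_eq_0 add.commute)

lemma bar_diff [simp]: "bar (x - y) = bar x - bar y"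
  using bar_add[of x "- y"] by simp

lemma bar_eq_zero [simp]: "bar x = 0 \<longleftrightarrow> x = 0"
  by (metis bar_bar bar_zero)

lemma bar_one [simp]: "bar 1 = 1"
  using bar_mult[of 1 1] by (metis bar_eq_zero mult_cancel_left1 mult.right_neutral zero_neq_one)

lemma bar_inverse [simp]: "bar (inverse x) = inverse (bar x)"
proof (cases "x = 0")
  case False
  then have "bar x * bar (inverse x) = 1" by (metis bar_mult bar_one right_inverse)
  then show ?thesis by (metis inverse_unique)
qed simp

lemma bar_divide [simp]: "bar (x / y) = bar x / bar y"
  by (simp add: divide_inverse)

lemma P_bar [simp]: "bar x \<in> P n \<longleftrightarrow> x \<in> P n"
  by (simp add: P_iff)

lemma exact_bar [simp]: "exact n (bar x) \<longleftrightarrow> exact n x"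
  by (simp add: exact_def)

lemma exact_even: "exact n x \<Longrightarrow> bar x = x \<Longrightarrow> even n"
  using fixed_even by (auto simp: exact_def)

lemma fixed_P_odd: "x \<in> P n \<Longrightarrow> bar x = x \<Longrightarrow> odd n \<Longrightarrow> x \<in> P (n + 1)"
  using exact_even exact_iff by blast

lemma fixed_nonzero_exact: "x \<noteq> 0 \<Longrightarrow> bar x = x \<Longrightarrow> \<exists>i. exact (2 * i) x"
  using fixed_even[of x] by (auto simp: exact_def elim: evenE)

lemma norm_fixed: "bar (x * bar x) = x * bar x"
  by (simp add: mult.commute)

lemma exact_norm: "exact n x \<Longrightarrow> exact (2 * n) (x * bar x)"
  using exact_mult[of n x n "bar x" "2 * n"] by simp

lemma norm_exact_iff: "exact (2 * n) (x * bar x) \<longleftrightarrow> exact n x"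
  by (cases "x = 0") (auto simp: exact_def w_mult)

lemma exact_uniformizer: "exact 1 p"
  by (simp add: exact_def p_nonzero w_p)

text \<open>Powers of \<open>p * bar p\<close> realize every even valuation inside the fixed
  field.\<close>

lemma ex_fixed_exact: "\<exists>a. bar a = a \<and> exact (2 * n) a"
proof -
  have pos: "\<exists>a. bar a = a \<and> exact (2 * int m) a" for m
  proof (induction m)
    case 0
    show ?case by (rule exI[of _ 1]) (simp add: exact_def)
  next
    case (Suc m)
    then obtain a where a: "bar a = a" "exact (2 * int m) a" by auto
    have "exact (2 * int (Suc m)) (a * (p * bar p))"
      by (rule exact_mult[OF a(2) exact_norm[OF exact_uniformizer]]) simp
    moreover have "bar (a * (p * bar p)) = a * (p * bar p)"
      using a(1) norm_fixed[of p] by simp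
    ultimately show ?case by blast
  qed
  show ?thesis
  proof (cases "n \<ge> 0")
    case True
    then show ?thesis using pos[of "nat n"] by simp
  next
    case False
    then obtain a where "bar a = a" "exact (- (2 * n)) a" using pos[of "nat (- n)"] by auto
    then show ?thesis using exact_inverse[of "- (2 * n)" a] by (metis bar_inverse minus_minus)
  qed
qed

lemma ex_exact: "\<exists>a. exact n a"
proof (cases "even n")
  case True
  then show ?thesis using ex_fixed_exact[of "n div 2"] by auto
next
  case False
  then obtain m where m: "n = 2 * m + 1" by (elim oddE)
  obtain a where "exact (2 * m) a" using ex_fixed_exact by blast
  then show ?thesis using m exact_mult[OF _ exact_uniformizer, of "2 * m" a n] by blast
qed

section \<open>The trace and the different\<close>

lemma trace_fixed [simp]: "bar (Tr x) = Tr x"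
  by (simp add: trace_def add.commute)

lemma trace_add: "Tr (x + y) = Tr x + Tr y"
  by (simp add: trace_def)

lemma trace_diff: "Tr (x - y) = Tr x - Tr y"
  by (simp add: trace_def)

lemma trace_minus: "Tr (- x) = - Tr x"
  by (simp add: trace_def)

lemma trace_mult_fixed: "bar t = t \<Longrightarrow> Tr (t * x) = t * Tr x"
  by (simp add: trace_def distrib_left)

text \<open>\<open>d\<close> is the exponent of the different, and \<open>\<omega>\<close> an element of trace one of largest valuation.\<close>
definition d :: int where "d = w (p - bar p)"

definition \<omega> :: 'e where "\<omega> = p / (p - bar p)"

lemma exact_d: "exact d (p - bar p)"
proof -
  have "bar p \<noteq> p" using fixed_even[of p] p_nonzero w_p by force
  then show ?thesis by (simp add: exact_def d_def)
qed

text \<open>One has \<open>p - bar p = 2 * p - Tr p\<close>. Dyadicity puts \<open>2 * p\<close>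
  into \<open>P 2\<close>, and \<open>Tr p\<close>, being fixed and in \<open>P 1\<close>, gains one
  step by parity.\<close>

lemma d_ge_2: "d \<ge> 2"
proof -
  have "exact (w 2) 2" by (simp add: exact_def)
  then have "2 \<in> P 1" using w_two exact_P_mono by blast
  then have a: "2 * p \<in> P 2" using P_mult[of 2 1 p 1] exact_P[OF exact_uniformizer] by simp
  have "Tr p \<in> P 1" unfolding trace_def
    by (rule P_add) (simp_all add: exact_P[OF exact_uniformizer])
  then have b: "Tr p \<in> P 2" using fixed_P_odd[of "Tr p" 1] by simp
  have "2 * p - Tr p = p - bar p" by (simp add: trace_def)
  then have "p - bar p \<in> P 2" using P_diff[OF a b] by metis
  then show ?thesis using exact_not_P[OF exact_d] by blast
qed

lemma trace_omega: "Tr \<omega> = 1"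
proof -
  have ne: "p - bar p \<noteq> 0" using exact_d exact_nonzero by blast
  have "bar \<omega> = bar p / - (p - bar p)"
    by (simp only: \<omega>_def bar_divide bar_diff bar_bar minus_diff_eq)
  then have "bar \<omega> = - (bar p / (p - bar p))" by (simp only: minus_divide_right)
  then have "Tr \<omega> = (p - bar p) / (p - bar p)"
    by (simp only: trace_def \<omega>_def diff_divide_distrib) simp
  with ne show ?thesis by (metis divide_self)
qed

lemma exact_omega: "exact (1 - d) \<omega>"
  unfolding \<omega>_def using exact_divide[OF exact_uniformizer exact_d] by simp

text \<open>A trace-zero element is a fixed multiple of \<open>p - bar p\<close>, which has
  valuation \<open>d\<close>, and fixed elements have even valuation.\<close>

lemma trace_zero_parity:
  assumes "Tr x = 0" "exact n x"
  shows "even (n - d)"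
proof -
  let ?q = "p - bar p"
  have "bar x = - x" using assms(1) by (simp add: trace_def eq_neg_iff_add_eq_0 add.commute)
  moreover have "bar ?q = - ?q" by simp
  ultimately have "bar (x / ?q) = x / ?q" by (metis bar_divide minus_divide_divide)
  moreover have "exact (n - d) (x / ?q)" using exact_divide[OF assms(2) exact_d] by simp
  ultimately show ?thesis using exact_even by blast
qed

text \<open>A trace-one multiple and a trace-zero element have valuations of different parity, so no
  cancellation occurs in \<open>x = Tr x \<omega> + (x - Tr x \<omega>)\<close>.\<close>
lemma trace_P:
  assumes "x \<in> P n" "m \<le> n + d - 1"
  shows "Tr x \<in> P m"
proof (cases "Tr x = 0")
  case False
  obtain i where i: "exact (2 * i) (Tr x)" using fixed_nonzero_exact[OF False] by auto
  define a where "a = Tr x * \<omega>"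
  define b where "b = x - a"
  have a: "exact (2 * i + 1 - d) a" unfolding a_def by (rule exact_mult[OF i exact_omega]) simp
  have "Tr b = 0" unfolding a_def b_def
    by (simp only: trace_diff trace_mult_fixed[OF trace_fixed] trace_omega) simp
  then have b: "b = 0 \<or> (\<exists>l. exact l b \<and> even (l - d))"
    using trace_zero_parity by (auto simp: exact_def)
  have "n \<le> 2 * i + 1 - d"
  proof (rule ccontr)
    assume less: "\<not> ?thesis"
    from b show False
    proof
      assume "b = 0"
      then have "exact (2 * i + 1 - d) x" using a by (simp add: b_def)
      then show False using exact_not_P assms(1) less by blast
    next
      assume "\<exists>l. exact l b \<and> even (l - d)"
      then obtain l where l: "exact l b" "even (l - d)" by blast
      have "l \<noteq> 2 * i + 1 - d" using l(2) by presburger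
      have x: "x = a + b" by (simp add: b_def)
      show False
      proof (cases "l < 2 * i + 1 - d")
        case True
        then have "exact l x" unfolding x using exact_add'[OF exact_P[OF a] l(1)] by simp
        then show False using exact_not_P assms(1) less True by fastforce
      next
        case False
        then have "exact (2 * i + 1 - d) x" unfolding x
          using exact_add[OF a exact_P[OF l(1)]] \<open>l \<noteq> _\<close> by simp
        then show False using exact_not_P assms(1) less by blast
      qed
    qed
  qed
  then show ?thesis using exact_P_mono[OF i] assms(2) by simp
qed simp

text \<open>The product \<open>t * \<omega>\<close> has trace \<open>t\<close>, but its valuation
  may exceed \<open>k\<close>. For \<open>k - d\<close> odd, the exact valuation of \<open>t\<close>
  makes that of the product exact. For \<open>k - d\<close> even, parity improves \<open>t\<close>
  to \<open>P (k + d)\<close>, and a trace-zero element of valuation \<open>k\<close> is added,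
  which then dominates.\<close>

lemma ex_trace_exact:
  assumes "bar t = t" "t \<in> P (k + d - 1)" "odd (k - d) \<Longrightarrow> exact (k + d - 1) t"
  shows "\<exists>\<rho>. exact k \<rho> \<and> t = Tr \<rho>"
proof (cases "even (k - d)")
  case False
  then have "exact k (t * \<omega>)" using exact_mult[OF assms(3)[OF False] exact_omega] by simp
  moreover have "Tr (t * \<omega>) = t" using assms(1) by (simp add: trace_mult_fixed trace_omega)
  ultimately show ?thesis by metis
next
  case True
  then have "odd (k + d - 1)" by presburger
  then have t: "t \<in> P (k + d)" using fixed_P_odd[OF assms(2,1)] by simp
  obtain m where m: "k - d = 2 * m" using True by (elim evenE)
  obtain a where a: "bar a = a" "exact (2 * m) a" using ex_fixed_exact by blast
  define z where "z = (p - bar p) * a"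
  have z: "exact k z" unfolding z_def by (rule exact_mult[OF exact_d a(2)]) (use m in simp)
  have "Tr z = 0" by (simp add: z_def trace_def a(1) algebra_simps)
  then have "Tr (t * \<omega> + z) = t"
    using assms(1) by (simp add: trace_add trace_mult_fixed trace_omega)
  moreover have "exact k (t * \<omega> + z)"
    using exact_add'[OF P_mult[OF t exact_P[OF exact_omega], of "k + 1"] z] by simp
  ultimately show ?thesis by metis
qed

section \<open>Approximation by norms\<close>

lemma norm_add: "(x + y) * bar (x + y) = x * bar x + y * bar y + Tr (x * bar y)"
  by (simp add: trace_def algebra_simps)

text \<open>Successive approximation: an error of valuation \<open>2 * l\<close> is approximated by
  the norm of some \<open>\<delta>\<close>, and passing from \<open>\<theta>\<close> to
  \<open>\<theta> + \<delta>\<close> costs the cross term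
  \<open>Tr (\<theta> * bar \<delta>)\<close> in \<open>P (i + l + d - 1)\<close>. It is negligible
  as long as \<open>l \<le> i + d - 2\<close>, whence the final precision
  \<open>2 * i + 2 * (d - 1)\<close>.\<close>

lemma norm_approx:
  assumes "bar t = t" "exact (2 * i) t"
  shows "\<exists>\<theta>. exact i \<theta> \<and> \<theta> * bar \<theta> - t \<in> P (2 * i + 2 * (d - 1))"
proof -
  have wt: "w t = 2 * i" "t \<noteq> 0" using assms(2) by (auto simp: exact_def)
  have ex: "exact i \<theta>" if "\<theta> * bar \<theta> - t \<in> P (2 * i + 1)" for \<theta>
    using exact_add[OF assms(2) that] by (simp add: norm_exact_iff)
  have "int n \<le> 2 * (d - 1) - 1 \<Longrightarrow> \<exists>\<theta>. \<theta> * bar \<theta> - t \<in> P (2 * i + 1 + int n)" for n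
  proof (induction n)
    case 0
    show ?case using square_approx[OF assms(1) wt(2)] wt(1) by simp
  next
    case (Suc n)
    then obtain \<theta> where \<theta>: "\<theta> * bar \<theta> - t \<in> P (2 * i + 1 + int n)" by auto
    then have \<theta>i: "exact i \<theta>" using ex P_mono by simp
    define s where "s = t - \<theta> * bar \<theta>"
    have sfix: "bar s = s" using assms(1) by (simp add: s_def mult.commute)
    have s: "s \<in> P (2 * i + 1 + int n)" using \<theta> P_diff_commute s_def by blast
    show ?case
    proof (cases "s \<in> P (2 * i + 1 + int (Suc n))")
      case True
      then show ?thesis using P_diff_commute s_def by blast
    next
      case False
      then have se: "exact (2 * i + 1 + int n) s" using s by (simp add: exact_iff add_ac)
      then obtain l where l: "2 * i + 1 + int n = 2 * l" using exact_even[OF se sfix] by (elim evenE)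
      obtain \<delta> where \<delta>: "\<delta> * bar \<delta> - s \<in> P (2 * l + 1)"
        using square_approx[OF sfix] se l by (auto simp: exact_def)
      have "exact (2 * l) (s + (\<delta> * bar \<delta> - s))"
        using se l by (intro exact_add[OF _ \<delta>]) simp_all
      then have "exact l \<delta>" by (simp add: norm_exact_iff)
      then have "Tr (\<theta> * bar \<delta>) \<in> P (2 * l + 1)"
        using Suc.prems l by (intro trace_P[OF P_mult[OF exact_P[OF \<theta>i], of "bar \<delta>" l]]) 
          (auto intro: exact_P)
      moreover have "(\<theta> + \<delta>) * bar (\<theta> + \<delta>) - t = (\<delta> * bar \<delta> - s) + Tr (\<theta> * bar \<delta>)"
        unfolding norm_add s_def by simp
      ultimately have "(\<theta> + \<delta>) * bar (\<theta> + \<delta>) - t \<in> P (2 * l + 1)" using P_add[OF \<delta>] by simp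
      moreover have "2 * l + 1 = 2 * i + 1 + int (Suc n)" using l by simp
      ultimately show ?thesis by metis
    qed
  qed
  from this[of "nat (2 * (d - 1) - 1)"] d_ge_2
  obtain \<theta> where \<theta>: "\<theta> * bar \<theta> - t \<in> P (2 * i + 2 * (d - 1))"
    by (auto simp: algebra_simps)
  then have "exact i \<theta>" using d_ge_2 P_mono[of _ _ "2 * i + 1"] by (intro ex) auto
  then show ?thesis using \<theta> by blast
qed

lemma norm_approx_P:
  assumes "bar t = t" "t \<in> P (2 * i)"
  shows "\<exists>\<theta>\<in>P i. \<theta> * bar \<theta> - t \<in> P (2 * i + 2 * (d - 1))"
proof (cases "t = 0")
  case True
  then show ?thesis by (intro bexI[of _ 0]) auto
next
  case False
  then obtain l where l: "exact (2 * l) t" using fixed_nonzero_exact assms(1) by blast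
  then have "i \<le> l" using exact_not_P assms(2) by fastforce
  obtain \<theta> where "exact l \<theta>" "\<theta> * bar \<theta> - t \<in> P (2 * l + 2 * (d - 1))"
    using norm_approx[OF assms(1) l] by blast
  then show ?thesis using P_mono[of _ _ "2 * i + 2 * (d - 1)"] exact_P_mono \<open>i \<le> l\<close>
    by (intro bexI[of _ \<theta>]) auto
qed

lemma ex_trace_P:
  assumes "bar t = t" "t \<in> P (k + d - 1)" "exact k c"
  shows "\<exists>\<mu>\<in>P 0. Tr (\<mu> * c) = t"
proof
  show "t * \<omega> / c \<in> P 0"
    by (rule P_divide[OF P_mult[OF assms(2) exact_P[OF exact_omega] order.refl] assms(3)]) simp
  show "Tr (t * \<omega> / c * c) = t"
    using exact_nonzero[OF assms(3)] assms(1) by (simp add: trace_mult_fixed trace_omega)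
qed

text \<open>The condition on the unknown \<open>l\<close> says that a vector \<open>m\<^sub>1 + l m\<^sub>2\<close> is isotropic when
  \<open>m\<^sub>1\<close>, \<open>m\<^sub>2\<close> have Gram matrix \<open>(a, c; c\<^sup>*, b)\<close>. The ansatz
  \<open>l\<^sup>* = - t \<omega> / c\<close> with fixed \<open>t\<close> reduces it to a quadratic equation over the fixed field.\<close>
lemma isotropic_solution:
  assumes a: "bar a = a" "a \<in> P (k + d)" and b: "bar b = b" "b \<in> P (k + d - 1)"
    and c: "exact k c"
  shows "\<exists>l\<in>P 1. a + Tr (bar l * c) + l * bar l * b = 0"
proof -
  define o1 where "o1 = \<omega> / c"
  have o1: "exact (1 - d - k) o1" unfolding o1_def by (rule exact_divide[OF exact_omega c]) simp
  define g where "g = b * (o1 * bar o1)"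
  have gfix: "bar g = g" using b(1) norm_fixed[of o1] by (simp add: g_def)
  have g: "g \<in> P (1 - d - k)" unfolding g_def
    by (rule P_mult[OF b(2) exact_P[OF exact_norm[OF o1]]]) simp
  have ga: "g * a \<in> P 1" by (rule P_mult[OF g a(2)]) simp
  \<comment> \<open>Under \<open>z = g * t\<close> the equation \<open>t = a + t * t * g\<close>
    becomes \<open>z = z * z + g * a\<close>, with small constant term.\<close>
  obtain z where z: "bar z = z" "z \<in> P 1" "z = z * z + g * a"
    using hensel[OF _ ga] gfix a(1) by auto
  have z1: "exact 0 (1 - z)" by (rule exact_diff[OF exact_one z(2)]) simp
  then have ne: "1 - z \<noteq> 0" by (rule exact_nonzero)
  define t where "t = a / (1 - z)"
  have tfix: "bar t = t" using a(1) z(1) by (simp add: t_def)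
  have t: "t \<in> P (k + d)" unfolding t_def by (rule P_divide[OF a(2) z1]) simp
  have "g * a = z * (1 - z)" using z(3) by (simp add: algebra_simps)
  then have "g * t * (1 - z) = z * (1 - z)" using ne by (simp add: t_def)
  then have gt: "g * t = z" using ne by simp
  have "t * (1 - z) = a" using ne by (simp add: t_def)
  then have "t = a + t * (g * t)" using gt by (simp add: algebra_simps)
  then have teq: "t = a + t * t * g" by (simp only: mult_ac)
  define l where "l = - (t * bar o1)"
  have "bar l * c = - (t * (o1 * c))" by (simp add: l_def tfix)
  also have "o1 * c = \<omega>" using exact_nonzero[OF c] by (simp add: o1_def)
  finally have "Tr (bar l * c) = - t"
    by (simp add: trace_minus trace_mult_fixed[OF tfix] trace_omega)
  moreover have "l * bar l * b = t * t * g" by (simp add: l_def tfix g_def mult_ac)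
  ultimately have "a + Tr (bar l * c) + l * bar l * b = 0" using teq by (simp add: algebra_simps)
  moreover have "l \<in> P 1" unfolding l_def P_minus
    by (rule P_mult[OF t]) (use exact_P[OF o1] in auto)
  ultimately show ?thesis by blast
qed

end

section \<open>Ramified quadratic extensions of dyadic local fields\<close>

lemma nat_pigeonhole:
  fixes f :: "nat \<Rightarrow> 'a"
  assumes "finite A" "range f \<subseteq> A"
  obtains m n where "m < n" "f m = f n"
proof -
  have "\<not> inj f" using assms finite_subset finite_imageD infinite_UNIV_nat by blast
  then obtain m n where "m \<noteq> n" "f m = f n" by (auto simp: inj_def)
  then show thesis using that by (metis linorder_neqE_nat)
qed

locale dyadic_ramified_extension =
  fixes val :: "'k::field_char_0 \<Rightarrow> int"
    and emb :: "'k \<Rightarrow> 'e::field_char_0"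
    and bar :: "'e \<Rightarrow> 'e"
  assumes local_field: "nonarch_local_field val" and dyadic: "dyadic val"
    and quadratic: "quadratic_extension emb" and ramified: "ramified val emb"
    and automorphism: "nontrivial_automorphism emb bar"
begin

lemma emb_one [simp]: "emb 1 = 1"
  and emb_add [simp]: "emb (x + y) = emb x + emb y"
  and emb_mult [simp]: "emb (x * y) = emb x * emb y"
  using quadratic by (auto simp: quadratic_extension_def)

lemma emb_zero [simp]: "emb 0 = 0"
  using emb_add[of 0 0] by simp

lemma emb_minus [simp]: "emb (- x) = - emb x"
  using emb_add[of x "- x"] by (simp add: eq_neg_iff_add_eq_0 add.commute)

lemma emb_diff [simp]: "emb (x - y) = emb x - emb y"
  using emb_add[of x "- y"] by simp

lemma emb_two [simp]: "emb 2 = 2"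
  using emb_add[of 1 1] by simp

lemma emb_eq_zero [simp]: "emb x = 0 \<longleftrightarrow> x = 0"
proof (cases "x = 0")
  case False
  then have "emb x * emb (inverse x) = 1" by (metis emb_mult emb_one right_inverse)
  then show ?thesis using False by auto
qed simp

lemma emb_eq [simp]: "emb x = emb y \<longleftrightarrow> x = y"
  by (metis emb_diff emb_eq_zero right_minus_eq)

lemma bar_emb [simp]: "bar (emb a) = emb a"
  and bar_add [simp]: "bar (x + y) = bar x + bar y"
  and bar_mult [simp]: "bar (x * y) = bar x * bar y"
  using automorphism by (auto simp: nontrivial_automorphism_def)

text \<open>Otherwise \<open>z\<close>, \<open>x\<close> and 1 would be three independent vectors in
  a space of dimension two.\<close>

lemma generated_by_nonscalar:
  assumes "x \<notin> range emb"
  shows "\<exists>a b. z = emb a + emb b * x"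
proof -
  interpret VS: vector_space "\<lambda>a x. emb a * x"
    by unfold_locales (simp_all add: algebra_simps)
  obtain B where B: "VS.independent B" "UNIV \<subseteq> VS.span B" "card B = VS.dim (UNIV :: 'e set)"
    using VS.basis_exists by blast
  have card2: "card B = 2" using B(3) quadratic by (simp add: quadratic_extension_def)
  then have finB: "finite B" by (metis card.infinite zero_neq_numeral)
  have one: "VS.span {1} = range emb" by (auto simp: VS.span_singleton)
  have z: "z \<in> VS.span {x, 1}"
  proof (rule ccontr)
    assume nz: "z \<notin> VS.span {x, 1}"
    have "VS.independent {x, 1}"
      using assms by (intro VS.independent_insertI) (simp_all add: one VS.independent_empty)
    then have ind: "VS.independent {z, x, 1}" using nz by (rule VS.independent_insertI[rotated])
    have "x \<noteq> 1" using assms emb_one by (metis rangeI)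
    moreover have "z \<noteq> x" "z \<noteq> 1" using nz VS.span_base[of _ "{x, 1}"] by auto
    ultimately have "card {z, x, 1} = 3" by simp
    moreover have "card {z, x, 1} \<le> card B"
      using VS.independent_span_bound[OF finB ind] B(2) by blast
    ultimately show False using card2 by simp
  qed
  then obtain b where "z - emb b * x \<in> range emb" unfolding VS.span_insert[of x "{1}"] one by blast
  then obtain a where "z - emb b * x = emb a" by blast
  then have "z = emb a + emb b * x" by (simp add: algebra_simps)
  then show ?thesis by blast
qed

lemma bar_nontrivial: "\<exists>x. bar x \<noteq> x"
  using automorphism by (auto simp: nontrivial_automorphism_def fun_eq_iff)

lemma fixed_iff: "bar x = x \<longleftrightarrow> x \<in> range emb"
proof
  assume fx: "bar x = x"
  show "x \<in> range emb"
  proof (rule ccontr)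
    assume "x \<notin> range emb"
    then have "bar z = z" for z
      using generated_by_nonscalar[of x z] fx by auto
    then show False using bar_nontrivial by blast
  qed
qed auto

text \<open>Order two is not part of the definition of the automorphism. If \<open>t\<close> is
  moved, \<open>t\<close> and \<open>bar t\<close> are distinct roots of one quadratic polynomial
  over the base field, so \<open>bar t + t = emb b\<close>; applying \<open>bar\<close> gives
  \<open>bar (bar t) + bar t = emb b\<close>.\<close>

lemma bar_bar [simp]: "bar (bar x) = x"
proof -
  obtain t where t: "bar t \<noteq> t" using bar_nontrivial by blast
  then have gen: "\<exists>a b. z = emb a + emb b * t" for z
    using generated_by_nonscalar fixed_iff by blast
  obtain a b where ab: "t * t = emb a + emb b * t" using gen by blast
  then have "bar t * bar t = emb a + emb b * bar t" by (metis bar_add bar_mult bar_emb)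
  then have "(bar t - t) * (bar t + t - emb b) = 0" using ab by (simp add: algebra_simps)
  then have s: "bar t + t = emb b" using t by simp
  then have "bar (bar t) + bar t = emb b" by (metis bar_add bar_emb)
  then have bt: "bar (bar t) = t" using s by (metis add.commute add_left_cancel)
  obtain a b where "x = emb a + emb b * t" using gen by blast
  then show ?thesis using bt by simp
qed

lemma bar_zero [simp]: "bar 0 = 0" and bar_one [simp]: "bar 1 = 1"
  using bar_emb[of 0] bar_emb[of 1] by simp_all

lemma bar_eq_zero [simp]: "bar x = 0 \<longleftrightarrow> x = 0"
  by (metis bar_bar bar_zero)

definition nrm :: "'e \<Rightarrow> 'k" where "nrm x = inv_into UNIV emb (x * bar x)"
definition trc :: "'e \<Rightarrow> 'k" where "trc x = inv_into UNIV emb (x + bar x)"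

lemma emb_nrm: "emb (nrm x) = x * bar x"
  unfolding nrm_def by (rule f_inv_into_f) (simp add: fixed_iff[symmetric] mult.commute)

lemma emb_trc: "emb (trc x) = x + bar x"
  unfolding trc_def by (rule f_inv_into_f) (simp add: fixed_iff[symmetric] add.commute)

lemma nrm_mult: "nrm (x * y) = nrm x * nrm y"
  by (subst emb_eq[symmetric]) (simp add: emb_nrm mult_ac del: emb_eq)

lemma nrm_emb [simp]: "nrm (emb a) = a * a"
  by (subst emb_eq[symmetric]) (simp add: emb_nrm del: emb_eq)

lemma trc_emb [simp]: "trc (emb a) = a + a"
  by (subst emb_eq[symmetric]) (simp add: emb_trc del: emb_eq)

lemma nrm_bar [simp]: "nrm (bar x) = nrm x"
  by (simp add: nrm_def mult.commute)

lemma nrm_one_add: "nrm (1 + x) = 1 + trc x + nrm x"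
  by (subst emb_eq[symmetric]) (simp add: emb_nrm emb_trc algebra_simps del: emb_eq)

lemma nrm_eq_zero [simp]: "nrm x = 0 \<longleftrightarrow> x = 0"
proof -
  have "nrm x = 0 \<longleftrightarrow> emb (nrm x) = 0" by simp
  then show ?thesis by (simp add: emb_nrm del: emb_eq_zero)
qed

lemma quadratic_equation: "x * x = emb (trc x) * x - emb (nrm x)"
  by (simp add: emb_trc emb_nrm algebra_simps)

sublocale K: valued_field val
  using local_field by unfold_locales (auto simp: nonarch_local_field_def discrete_valuation_def)

lemma ex_uniformizer: "\<exists>u. K.exact 1 u"
  using local_field by (auto simp: nonarch_local_field_def discrete_valuation_def K.exact_def)

lemma two_in_ideal: "2 \<in> val_ideal val"
proof -
  have two: "2 \<in> val_ring val"
    using K.P_add[OF K.exact_P[OF K.exact_one] K.exact_P[OF K.exact_one]] by simp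
  have "\<not> K.exact 0 2"
  proof
    assume "K.exact 0 2"
    then have "inverse 2 \<in> val_ring val" using K.exact_inverse K.exact_P by fastforce
    then show False using dyadic two
      by (auto simp: dyadic_def unit_in_def dest!: bspec[of _ _ "inverse 2"])
  qed
  then show ?thesis using two by (simp add: K.exact_iff)
qed

section \<open>Completeness and Hensel's lemma\<close>

lemma complete:
  fixes X :: "nat \<Rightarrow> 'k"
  assumes "\<And>n. \<exists>N. \<forall>i\<ge>N. \<forall>j\<ge>N. X i - X j \<in> val_ge val n"
  obtains l where "\<And>n. \<exists>N. \<forall>i\<ge>N. X i - l \<in> val_ge val n"
proof -
  have "val_complete val" using local_field by (simp add: nonarch_local_field_def)
  then have "(\<forall>n. \<exists>N. \<forall>i\<ge>N. \<forall>j\<ge>N. X i - X j \<in> val_ge val n) \<longrightarrow>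
      (\<exists>l. \<forall>n. \<exists>N. \<forall>i\<ge>N. X i - l \<in> val_ge val n)"
    unfolding val_complete_def by (rule spec)
  then show thesis using assms that by auto
qed

text \<open>Iterating \<open>z \<mapsto> z * z + c\<close> from 0 contracts on the maximal ideal:
  each difference of successive terms is the previous one times a sum of two elements of the
  ideal.\<close>

lemma K_hensel:
  assumes "c \<in> val_ideal val"
  shows "\<exists>z\<in>val_ideal val. z = z * z + c"
proof -
  define Z where "Z = rec_nat 0 (\<lambda>_ z. z * z + c)"
  have Z0: "Z 0 = 0" and ZS: "Z (Suc n) = Z n * Z n + c" for n by (simp_all add: Z_def)
  have Z1: "Z n \<in> val_ideal val" for n
    by (induction n) (auto simp: Z0 ZS intro!: K.P_add assms K.P_mult)
  have step: "Z (Suc n) - Z n \<in> val_ge val (int n + 1)" for n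
  proof (induction n)
    case 0
    then show ?case using assms by (simp add: Z0 ZS)
  next
    case (Suc n)
    have "Z (Suc (Suc n)) - Z (Suc n) = (Z (Suc n) - Z n) * (Z (Suc n) + Z n)"
      by (simp add: ZS algebra_simps)
    also have "\<dots> \<in> val_ge val (int (Suc n) + 1)"
      by (rule K.P_mult[OF Suc K.P_add[OF Z1 Z1]]) simp
    finally show ?case .
  qed
  have diff: "Z (n + m) - Z n \<in> val_ge val (int n + 1)" for n m
  proof (induction m)
    case (Suc m)
    have "Z (n + Suc m) - Z n = (Z (Suc (n + m)) - Z (n + m)) + (Z (n + m) - Z n)" by simp
    also have "\<dots> \<in> val_ge val (int n + 1)"
      by (rule K.P_add[OF K.P_mono[OF step] Suc]) simp
    finally show ?case .
  qed simp
  have cauchy: "Z i - Z j \<in> val_ge val n" if "i \<ge> nat n" "j \<ge> nat n" for i j n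
  proof -
    have "Z i - Z (nat n) \<in> val_ge val n" "Z j - Z (nat n) \<in> val_ge val n"
      using K.P_mono[OF diff[of "nat n" "i - nat n"], of n]
        K.P_mono[OF diff[of "nat n" "j - nat n"], of n] that by auto
    then show ?thesis using K.P_diff by fastforce
  qed
  obtain l where l: "\<And>n. \<exists>N. \<forall>i\<ge>N. Z i - l \<in> val_ge val n"
    using complete[of Z] cauchy by metis
  have lim: "\<exists>N. \<forall>i\<ge>N. l - Z i \<in> val_ge val n" for n
    using l[of n] K.P_diff_commute by blast
  obtain N where "l - Z N \<in> val_ideal val" using lim by blast
  then have l1: "l \<in> val_ideal val" using K.P_add[OF _ Z1[of N]] by fastforce
  have "l - (l * l + c) \<in> val_ge val n" for n
  proof -
    obtain N where N: "\<And>i. i \<ge> N \<Longrightarrow> l - Z i \<in> val_ge val n" using lim by blast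
    have "l - (l * l + c) = (l - Z (Suc N)) - (l - Z N) * (l + Z N)"
      by (simp add: ZS algebra_simps)
    also have "\<dots> \<in> val_ge val n"
      by (rule K.P_diff[OF N K.P_mult[OF N K.P_add[OF l1 Z1]]]) simp_all
    finally show ?thesis .
  qed
  from this[of "val (l - (l * l + c)) + 1"] have "l - (l * l + c) = 0" by (simp add: K.P_iff)
  then show ?thesis using l1 by auto
qed

text \<open>If the trace were not integral, Hensel's lemma would split the minimal polynomial.\<close>
lemma trc_integral:
  assumes "nrm x \<in> val_ring val"
  shows "trc x \<in> val_ring val"
proof (rule ccontr)
  assume neg: "trc x \<notin> val_ring val"
  define T where "T = trc x"
  have T: "T \<noteq> 0" "val T < 0" using neg by (auto simp: T_def K.P_iff)
  have "K.exact (val (T * T)) (T * T)" using T by (simp add: K.exact_def)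
  moreover have "val (T * T) < 0" using T by (simp add: K.w_mult)
  ultimately have "nrm x / (T * T) \<in> val_ideal val" by (intro K.P_divide[OF assms]) auto
  \<comment> \<open>Rescaling the variable by \<open>T\<close> turns the minimal polynomial of
    \<open>x\<close> into this equation with small constant term.\<close>
  then obtain z where z: "z = z * z + nrm x / (T * T)" using K_hensel by blast
  then have "T * T * (z - z * z) = nrm x" using T(1) by (simp add: field_simps)
  then have n: "nrm x = T * z * (T * (1 - z))" by (simp add: algebra_simps)
  have "(x - emb (T * z)) * (x - emb (T * (1 - z))) = x * x - emb T * x + emb (nrm x)"
    unfolding n by (simp add: algebra_simps)
  also have "\<dots> = 0" using quadratic_equation[of x] by (simp add: T_def)
  finally have "x = emb (T * z) \<or> x = emb (T * (1 - z))" by (simp only: mult_eq_0_iff right_minus_eq)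
  then obtain a where a: "x = emb a" by blast
  have "a \<in> val_ring val"
    using assms a by (cases "a = 0") (auto simp: K.P_iff K.w_mult)
  then have "a + a \<in> val_ring val" by (intro K.P_add)
  then show False using neg unfolding a trc_emb by blast
qed

text \<open>Elements of the base field get twice their valuation; that this is the normalized
  valuation of \<open>E\<close> rests on ramification.\<close>

definition w :: "'e \<Rightarrow> int" where "w x = val (nrm x)"

sublocale E: valued_field w
proof
  show mult: "w (x * y) = w x + w y" if "x \<noteq> 0" "y \<noteq> 0" for x y
    using that by (simp add: w_def nrm_mult K.w_mult)
  \<comment> \<open>Dividing by the element of smaller valuation leaves \<open>1 + z\<close> with
    \<open>z\<close> of integral norm; then \<open>1 + trc z + nrm z\<close> is integral as
    well.\<close>
  have le: "w x \<le> w (x + y)" if "x \<noteq> 0" "x + y \<noteq> 0" "y \<noteq> 0" "w x \<le> w y" for x y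
  proof -
    define z where "z = y / x"
    have y: "y = x * z" using that by (simp add: z_def)
    have "x * (1 + z) \<noteq> 0" using that(2) y by (simp add: distrib_left)
    then have z: "z \<noteq> 0" "1 + z \<noteq> 0" using that(3) y by auto
    have "w z \<ge> 0" using that(4) mult[OF that(1) z(1)] y by simp
    then have "nrm z \<in> val_ring val" by (simp add: w_def K.P_iff)
    then have "nrm (1 + z) \<in> val_ring val"
      using trc_integral K.exact_P[OF K.exact_one] by (auto simp: nrm_one_add intro!: K.P_add)
    then have "w (1 + z) \<ge> 0" using z by (simp add: w_def K.P_iff)
    then show ?thesis using mult[OF that(1) z(2)] y by (simp add: distrib_left)
  qed
  show "min (w x) (w y) \<le> w (x + y)" if "x \<noteq> 0" "y \<noteq> 0" "x + y \<noteq> 0" for x y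
    using le[of x y] le[of y x] that by (auto simp: add.commute min_def)
qed

lemma w_emb: "a \<noteq> 0 \<Longrightarrow> w (emb a) = 2 * val a"
  by (simp add: w_def K.w_mult)

lemma emb_P: "a \<in> val_ge val n \<Longrightarrow> m \<le> 2 * n \<Longrightarrow> emb a \<in> val_ge w m"
  by (cases "a = 0") (auto simp: K.P_iff E.P_iff w_emb)

text \<open>At an element of negative valuation, the leading term of a monic integral polynomial
  strictly dominates all others.\<close>

lemma integral_imp_P:
  assumes "x \<in> integers val emb"
  shows "x \<in> val_ring w"
proof (rule ccontr)
  assume "x \<notin> val_ring w"
  then have x: "E.exact (w x) x" "w x < 0" by (auto simp: E.P_iff E.exact_def)
  obtain q where q: "lead_coeff q = 1" "\<And>i. coeff q i \<in> val_ring val"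
    "poly (map_poly emb q) x = 0" using assms by (auto simp: integers_def)
  define n where "n = degree q"
  have "degree (map_poly emb q) = n" by (simp add: n_def degree_map_poly)
  then have "poly (map_poly emb q) x = (\<Sum>i\<le>n. emb (coeff q i) * x ^ i)"
    by (simp add: poly_altdef coeff_map_poly)
  also have "\<dots> = x ^ n + (\<Sum>i<n. emb (coeff q i) * x ^ i)"
    using q(1) by (simp add: lessThan_Suc_atMost[symmetric] n_def)
  finally have eq: "poly (map_poly emb q) x = x ^ n + (\<Sum>i<n. emb (coeff q i) * x ^ i)" .
  have "(\<Sum>i<n. emb (coeff q i) * x ^ i) \<in> val_ge w (int n * w x + 1)"
  proof (rule E.P_sum)
    fix i assume "i \<in> {..<n}"
    then have "int i + 1 \<le> int n" by auto
    then have "int n * w x \<le> (int i + 1) * w x" using x(2) by (intro mult_right_mono_neg) auto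
    then have "int n * w x + 1 \<le> 0 + int i * w x" using x(2) by (simp add: algebra_simps)
    then show "emb (coeff q i) * x ^ i \<in> val_ge w (int n * w x + 1)"
      by (intro E.P_mult[OF emb_P[OF q(2), of 0] E.exact_P[OF E.exact_power[OF x(1)]]]) auto
  qed
  then have "E.exact (int n * w x) (poly (map_poly emb q) x)"
    unfolding eq by (rule E.exact_add[OF E.exact_power[OF x(1)]]) simp
  then show False using q(3) E.exact_nonzero by blast
qed

lemma P_imp_integral:
  assumes "x \<in> val_ring w"
  shows "x \<in> integers val emb"
proof -
  have n: "nrm x \<in> val_ring val" using assms by (auto simp: E.P_iff K.P_iff w_def)
  let ?q = "[:nrm x, - trc x, 1:]"
  have "coeff ?q i \<in> val_ring val" for i
    using n trc_integral[OF n] K.exact_P[OF K.exact_one]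
    by (auto simp: coeff_pCons split: nat.split)
  moreover have "lead_coeff ?q = 1" by simp
  moreover have "poly (map_poly emb ?q) x = 0"
    using quadratic_equation[of x] by (simp add: map_poly_pCons algebra_simps)
  ultimately show ?thesis unfolding integers_def by blast
qed

lemma integers_eq: "integers val emb = val_ring w"
  using integral_imp_P P_imp_integral by blast

lemma nonunits_integers: "x \<in> nonunits (val_ring w) \<Longrightarrow> x \<in> val_ideal w"
proof -
  assume x: "x \<in> nonunits (val_ring w)"
  have "\<not> E.exact 0 x"
  proof
    assume ex: "E.exact 0 x"
    then have "inverse x \<in> val_ring w" using E.exact_inverse E.exact_P by fastforce
    then have "unit_in (val_ring w) x"
      using E.exact_P[OF ex] E.exact_nonzero[OF ex] by (auto simp: unit_in_def intro!: bexI[of _ "inverse x"])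
    then show False using x by (simp add: nonunits_def)
  qed
  then show "x \<in> val_ideal w" using x by (simp add: nonunits_def E.exact_iff)
qed

lemma ideal_power_subset:
  assumes "I \<subseteq> val_ge w m"
  shows "ideal_power (val_ring w) I n \<subseteq> val_ge w (int n * m)"
proof (induction n)
  case (Suc n)
  show ?case
  proof
    fix z assume "z \<in> ideal_power (val_ring w) I (Suc n)"
    then obtain F c where F: "z = (\<Sum>s\<in>F. c s * s)" "c ` F \<subseteq> val_ring w"
      "F \<subseteq> {x * y | x y. x \<in> I \<and> y \<in> ideal_power (val_ring w) I n}"
      by (auto simp: span_over_def)
    have "c s * s \<in> val_ge w (int (Suc n) * m)" if s: "s \<in> F" for s
    proof -
      obtain x y where xy: "s = x * y" "x \<in> val_ge w m" "y \<in> val_ge w (int n * m)"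
        using F(3) s Suc assms by blast
      have "s \<in> val_ge w (int (Suc n) * m)"
        unfolding xy(1) by (rule E.P_mult[OF xy(2,3)]) (simp add: algebra_simps)
      then show ?thesis using F(2) s by (intro E.P_mult[of _ 0]) auto
    qed
    then show "z \<in> val_ge w (int (Suc n) * m)" unfolding F(1) by (rule E.P_sum)
  qed
qed simp

text \<open>If all valuations were even, nonunits would lie in \<open>val_ge w 2\<close> and the
  \<open>e\<close>-th power of their ideal in \<open>val_ge w (2 * e)\<close> with
  \<open>e > 1\<close>. By ramification that power contains a uniformizer of the base field, whose
  valuation is 2.\<close>

lemma ex_odd: "\<exists>x. x \<noteq> 0 \<and> odd (w x)"
proof (rule ccontr)
  assume "\<not> ?thesis"
  then have even: "even (w x)" if "x \<noteq> 0" for x using that by blast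
  have I: "nonunits (val_ring w) \<subseteq> val_ge w 2"
  proof
    fix x assume "x \<in> nonunits (val_ring w)"
    then have "x = 0 \<or> w x \<ge> 1" using nonunits_integers by (simp add: E.P_iff)
    moreover have "w x \<noteq> 1" if "x \<noteq> 0" using even[OF that] by presburger
    ultimately show "x \<in> val_ge w 2" unfolding E.P_iff by fastforce
  qed
  obtain e where e: "e > 1" "span_over (val_ring w) (*) (emb ` val_ideal val)
      = ideal_power (val_ring w) (nonunits (val_ring w)) e"
    using ramified unfolding ramified_def Let_def integers_eq by blast
  obtain u where u: "K.exact 1 u" using ex_uniformizer by blast
  have "emb u \<in> span_over (val_ring w) (*) (emb ` val_ideal val)"
    unfolding span_over_def mem_Collect_eq
    using K.exact_P[OF u] E.exact_P[OF E.exact_one]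
    by (intro exI[of _ "{emb u}"] exI[of _ "\<lambda>_. 1"]) auto
  then have "emb u \<in> val_ge w (int e * 2)" using e(2) ideal_power_subset[OF I] by blast
  then show False using u e(1) by (auto simp: E.P_iff K.exact_def w_emb)
qed

lemma ex_E_uniformizer: "\<exists>p. E.exact 1 p"
proof -
  obtain x m where x: "E.exact (2 * m + 1) x"
    using ex_odd by (auto simp: E.exact_def elim!: oddE)
  obtain u where u: "K.exact 1 u" using ex_uniformizer by blast
  have "E.exact 2 (emb u)" using u by (simp add: K.exact_def E.exact_def w_emb)
  show ?thesis
  proof (cases "m \<ge> 0")
    case True
    have "E.exact 1 (x / emb u ^ nat m)"
      by (rule E.exact_divide[OF x E.exact_power[OF \<open>E.exact 2 (emb u)\<close>]]) (use True in simp)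
    then show ?thesis by blast
  next
    case False
    have "E.exact 1 (x * emb u ^ nat (- m))"
      by (rule E.exact_mult[OF x E.exact_power[OF \<open>E.exact 2 (emb u)\<close>]]) (use False in simp)
    then show ?thesis by blast
  qed
qed

section \<open>Perfectness of the finite residue field\<close>

lemma residue_power_collision:
  assumes "u \<in> val_ring val"
  obtains m n where "m < n" "u ^ 2 ^ m - u ^ 2 ^ n \<in> val_ideal val"
proof -
  define r where "r = {(x, y). x \<in> val_ring val \<and> y \<in> val_ring val \<and> x - y \<in> val_ideal val}"
  have "finite (val_ring val // r)"
    using local_field by (simp add: nonarch_local_field_def residue_field_def r_def)
  moreover have "range (\<lambda>m. r `` {u ^ 2 ^ m}) \<subseteq> val_ring val // r"
    using K.P_power[OF assms] by (auto intro: quotientI)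
  ultimately obtain m n :: nat where mn: "m < n" "r `` {u ^ 2 ^ m} = r `` {u ^ 2 ^ n}"
    using nat_pigeonhole[of "val_ring val // r" "\<lambda>m. r `` {u ^ 2 ^ m}"] by blast
  have "u ^ 2 ^ n \<in> r `` {u ^ 2 ^ n}" using K.P_power[OF assms] by (simp add: r_def)
  then have "u ^ 2 ^ m - u ^ 2 ^ n \<in> val_ideal val" using mn(2) by (auto simp: r_def)
  then show thesis using that mn(1) by blast
qed

text \<open>Modulo the maximal ideal, which contains 2, \<open>u ^ 2 - v ^ 2\<close> equals
  \<open>(u - v) ^ 2\<close>, and the ideal is prime.\<close>

lemma frobenius_injective:
  assumes "u \<in> val_ring val" "v \<in> val_ring val" "u ^ 2 ^ m - v ^ 2 ^ m \<in> val_ideal val"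
  shows "u - v \<in> val_ideal val"
  using assms
proof (induction m arbitrary: u v)
  case (Suc m)
  have uv: "u - v \<in> val_ring val" using Suc.prems by (simp add: K.P_diff)
  have "(u ^ 2) ^ 2 ^ m - (v ^ 2) ^ 2 ^ m \<in> val_ideal val"
    using Suc.prems(3) by (simp add: power_mult)
  then have sq: "u ^ 2 - v ^ 2 \<in> val_ideal val"
    using Suc.IH[of "u ^ 2" "v ^ 2"] Suc.prems K.P_power by blast
  have "2 * (v * (u - v)) \<in> val_ideal val"
    by (rule K.P_mult[OF two_in_ideal K.P_mult[OF Suc.prems(2) uv]]) auto
  then have "(u ^ 2 - v ^ 2) - 2 * (v * (u - v)) \<in> val_ideal val" by (rule K.P_diff[OF sq])
  also have "(u ^ 2 - v ^ 2) - 2 * (v * (u - v)) = (u - v) * (u - v)"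
    by (simp add: power2_eq_square algebra_simps)
  finally have "(u - v) * (u - v) \<in> val_ideal val" .
  then show ?case by (cases "u = v") (auto simp: K.P_iff K.w_mult)
qed simp

text \<open>The iterated squares of \<open>u\<close> repeat in the finite residue field. Cancelling
  \<open>m\<close> squarings by injectivity exhibits \<open>u\<close> as the square of
  \<open>u ^ 2 ^ (n - m - 1)\<close>.\<close>

lemma residue_square:
  assumes "u \<in> val_ring val"
  shows "\<exists>b\<in>val_ring val. b * b - u \<in> val_ideal val"
proof -
  obtain m n where mn: "m < n" "u ^ 2 ^ m - u ^ 2 ^ n \<in> val_ideal val"
    using residue_power_collision[OF assms] by blast
  define b where "b = u ^ 2 ^ (n - m - 1)"
  have "2 ^ n = 2 * 2 ^ (n - m - 1) * (2 ^ m :: nat)"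
    using mn(1) by (simp flip: power_Suc power_add)
  then have "u ^ 2 ^ n = (b * b) ^ 2 ^ m"
    by (simp add: b_def power_mult[symmetric] power_add[symmetric] mult_2)
  then have "u - b * b \<in> val_ideal val"
    using frobenius_injective[OF assms, of "b * b" m] mn(2)
      K.P_mult[OF K.P_power[OF assms] K.P_power[OF assms], of 0]
    by (simp add: b_def)
  then show ?thesis using K.P_power[OF assms] K.P_diff_commute b_def by blast
qed

text \<open>Ramification supplies \<open>y\<close> whose norm has the same valuation as
  \<open>a\<close>. The integral quotient \<open>a / nrm y\<close> is close to a square
  \<open>b * b\<close>, which is the norm of \<open>emb b\<close>.\<close>

lemma norm_residue:
  assumes "bar t = t" "t \<noteq> 0"
  shows "\<exists>z. z * bar z - t \<in> val_ge w (w t + 1)"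
proof -
  obtain a where a: "t = emb a" "a \<noteq> 0" using assms fixed_iff by auto
  define n where "n = val a"
  obtain p where p: "E.exact 1 p" using ex_E_uniformizer by blast
  define y where "y = (if n \<ge> 0 then p ^ nat n else inverse (p ^ nat (- n)))"
  have y: "E.exact n y"
    using E.exact_power[OF p, of "nat n"] E.exact_inverse[OF E.exact_power[OF p, of "nat (- n)"]]
    by (cases "n \<ge> 0") (simp_all add: y_def)
  then have ny: "K.exact n (nrm y)" by (simp add: E.exact_def K.exact_def w_def)
  have "K.exact n a" using a by (simp add: K.exact_def n_def)
  then have "a / nrm y \<in> val_ring val" using ny by (intro K.P_divide[of a n]) (auto intro: K.exact_P)
  then obtain b where b: "b * b - a / nrm y \<in> val_ideal val" using residue_square by blast
  have "nrm y * (b * b - a / nrm y) \<in> val_ge val (n + 1)"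
    by (rule K.P_mult[OF K.exact_P[OF ny] b]) simp
  then have "emb (nrm y * (b * b - a / nrm y)) \<in> val_ge w (w t + 1)"
    by (rule emb_P) (simp add: a w_emb n_def)
  also have "nrm y * (b * b - a / nrm y) = nrm (y * emb b) - a"
    using K.exact_nonzero[OF ny] by (simp add: nrm_mult right_diff_distrib)
  also have "emb \<dots> = y * emb b * bar (y * emb b) - t" by (simp only: emb_diff emb_nrm a)
  finally show ?thesis by blast
qed

lemma E_hensel:
  assumes "bar c = c" "c \<in> val_ideal w"
  shows "\<exists>z. bar z = z \<and> z \<in> val_ideal w \<and> z = z * z + c"
proof -
  obtain a where a: "c = emb a" using assms fixed_iff by auto
  then have "a \<in> val_ideal val"
    using assms(2) by (cases "a = 0") (auto simp: K.P_iff E.P_iff w_emb)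
  then obtain z where z: "z \<in> val_ideal val" "z = z * z + a" using K_hensel by blast
  then have "emb z = emb z * emb z + c" by (metis a emb_add emb_mult)
  then show ?thesis using emb_P[OF z(1), of 1] by (intro exI[of _ "emb z"]) auto
qed

lemma ex_ramified_dyadic: "\<exists>p. ramified_dyadic w bar p"
proof -
  obtain p where p: "E.exact 1 p" using ex_E_uniformizer by blast
  have "ramified_dyadic w bar p"
  proof
    show "even (w x)" if "bar x = x" "x \<noteq> 0" for x
      using that fixed_iff[of x] by (auto simp: w_emb)
    have "val 2 \<ge> 1" using two_in_ideal by (simp add: K.P_iff)
    then show "w 2 \<ge> 1" using w_emb[of 2] emb_add[of 1 1] by simp
    show "w (bar x) = w x" for x by (simp add: w_def)
  qed (use p norm_residue E_hensel in \<open>simp_all add: E.exact_def\<close>)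
  then show ?thesis by blast
qed

end

section \<open>Hermitian lattices\<close>

text \<open>The form is sesquilinear on the whole type, which keeps its rewrite rules unconditional;
  the theorem arrives here by composing with a projection onto \<open>V\<close>. Finite generation
  of \<open>L\<close> enters as boundedness of \<open>h\<close> on \<open>L\<close>. Both
  \<open>V\<close> and \<open>L\<close> are assumed nondegenerate, since \<open>L\<close> may span a
  proper subspace.\<close>

locale hermitian = ramified_dyadic w bar p + vector_space scale
  for w :: "'e::field_char_0 \<Rightarrow> int" and bar p
    and scale :: "'e \<Rightarrow> 'v::ab_group_add \<Rightarrow> 'v" +
  fixes h :: "'v \<Rightarrow> 'v \<Rightarrow> 'e" and V L :: "'v set"
  assumes V_finite: "\<exists>B. finite B \<and> V = span B"
    and h_add [simp]: "\<And>x y z. h (x + y) z = h x z + h y z"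
    and h_scale [simp]: "\<And>c x y. h (scale c x) y = c * h x y"
    and h_hermitian: "\<And>x y. h x y = bar (h y x)"
    and V_nondegenerate: "\<And>x. x \<in> V \<Longrightarrow> (\<And>y. y \<in> V \<Longrightarrow> h x y = 0) \<Longrightarrow> x = 0"
    and L_subset: "L \<subseteq> V"
    and L_zero: "0 \<in> L"
    and L_add: "\<And>x y. x \<in> L \<Longrightarrow> y \<in> L \<Longrightarrow> x + y \<in> L"
    and L_scale: "\<And>c x. c \<in> val_ring w \<Longrightarrow> x \<in> L \<Longrightarrow> scale c x \<in> L"
    and L_nondegenerate: "\<And>x. x \<in> L \<Longrightarrow> (\<And>y. y \<in> L \<Longrightarrow> h x y = 0) \<Longrightarrow> x = 0"
    and L_bounded: "\<exists>n. \<forall>x\<in>L. \<forall>y\<in>L. h x y \<in> val_ge w n"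
begin

lemma h_zero [simp]: "h 0 y = 0"
  using h_add[of 0 0 y] by simp

lemma h_minus [simp]: "h (- x) y = - h x y"
  using h_add[of x "- x" y] by (simp add: eq_neg_iff_add_eq_0 add.commute)

lemma h_diff [simp]: "h (x - y) z = h x z - h y z"
  using h_add[of x "- y" z] by simp

lemma h_add_right [simp]: "h z (x + y) = h z x + h z y"
  by (metis h_hermitian h_add bar_add)

lemma h_scale_right [simp]: "h x (scale c y) = bar c * h x y"
  by (metis h_hermitian h_scale bar_mult)

lemma h_zero_right [simp]: "h x 0 = 0"
  by (metis h_hermitian h_zero bar_zero)

lemma h_minus_right [simp]: "h x (- y) = - h x y"
  by (metis h_hermitian h_minus bar_minus)

lemma h_diff_right [simp]: "h z (x - y) = h z x - h z y"
  by (metis h_hermitian h_diff bar_diff)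

lemma bar_h [simp]: "bar (h x y) = h y x"
  by (metis h_hermitian)

lemma h_zero_sym: "h x y = 0 \<longleftrightarrow> h y x = 0"
  by (metis bar_h bar_zero)

lemma exact_h_sym: "exact n (h x y) \<longleftrightarrow> exact n (h y x)"
  by (metis bar_h exact_bar)

lemma subspace_V: "subspace V"
  using V_finite subspace_span by auto

lemma V_zero [simp]: "0 \<in> V"
  and V_add [simp]: "x \<in> V \<Longrightarrow> y \<in> V \<Longrightarrow> x + y \<in> V"
  and V_diff [simp]: "x \<in> V \<Longrightarrow> y \<in> V \<Longrightarrow> x - y \<in> V"
  and V_minus [simp]: "x \<in> V \<Longrightarrow> - x \<in> V"
  and V_scale [simp]: "x \<in> V \<Longrightarrow> scale c x \<in> V"
  using subspace_V
  by (simp_all add: subspace_0 subspace_add subspace_diff subspace_neg subspace_scale)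

lemma L_V: "x \<in> L \<Longrightarrow> x \<in> V"
  using L_subset by blast

lemma one_P: "1 \<in> P 0"
  by (rule exact_P[OF exact_one])

lemma L_minus: "x \<in> L \<Longrightarrow> - x \<in> L"
  using L_scale[of "-1" x] one_P by simp

lemma L_diff: "x \<in> L \<Longrightarrow> y \<in> L \<Longrightarrow> x - y \<in> L"
  using L_add[of x "- y"] L_minus by simp

subsection \<open>The group of isometries\<close>

definition U :: "('v \<Rightarrow> 'v) set" where
  "U = lattice_unitary_group scale h V L"

definition X :: "('v \<Rightarrow> 'v) set" where
  "X = X_group (val_ring w) bar scale h V L"

sublocale G: group "BijGroup V"
  by (rule group_BijGroup)

lemma carrier_BijGroup: "f \<in> carrier (BijGroup V) \<longleftrightarrow> f \<in> extensional V \<and> bij_betw f V V"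
  by (simp add: BijGroup_def Bij_def)

lemma mult_BijGroup: "f \<in> carrier (BijGroup V) \<Longrightarrow> g \<in> carrier (BijGroup V) \<Longrightarrow>
    f \<otimes>\<^bsub>BijGroup V\<^esub> g = compose V f g"
  by (simp add: BijGroup_def)

lemma one_BijGroup: "\<one>\<^bsub>BijGroup V\<^esub> = (\<lambda>x\<in>V. x)"
  by (simp add: BijGroup_def)

lemma U_iff: "f \<in> U \<longleftrightarrow> f \<in> carrier (BijGroup V) \<and>
    (\<forall>x\<in>V. \<forall>y\<in>V. f (x + y) = f x + f y) \<and> (\<forall>c. \<forall>x\<in>V. f (scale c x) = scale c (f x)) \<and>
    (\<forall>x\<in>V. \<forall>y\<in>V. h (f x) (f y) = h x y) \<and> f ` L = L"
  by (auto simp: U_def lattice_unitary_group_def unitary_group_def)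

lemma U_carrier: "f \<in> U \<Longrightarrow> f \<in> carrier (BijGroup V)"
  by (simp add: U_iff)

lemma U_V: "f \<in> U \<Longrightarrow> x \<in> V \<Longrightarrow> f x \<in> V"
  unfolding U_iff carrier_BijGroup bij_betw_def by blast

lemma U_L: "f \<in> U \<Longrightarrow> x \<in> L \<Longrightarrow> f x \<in> L"
  by (auto simp: U_iff)

lemma U_add: "f \<in> U \<Longrightarrow> x \<in> V \<Longrightarrow> y \<in> V \<Longrightarrow> f (x + y) = f x + f y"
  and U_scale: "f \<in> U \<Longrightarrow> x \<in> V \<Longrightarrow> f (scale c x) = scale c (f x)"
  and U_h: "f \<in> U \<Longrightarrow> x \<in> V \<Longrightarrow> y \<in> V \<Longrightarrow> h (f x) (f y) = h x y"
  by (simp_all add: U_iff)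

text \<open>Group elements are extensional, so isometries are given as restrictions of global
  formulas; an explicit inverse that preserves \<open>L\<close> replaces a proof of
  surjectivity.\<close>

lemma U_restrictI:
  assumes V: "\<And>x. x \<in> V \<Longrightarrow> F x \<in> V" "\<And>x. x \<in> V \<Longrightarrow> F' x \<in> V"
    and L: "\<And>x. x \<in> L \<Longrightarrow> F x \<in> L" "\<And>x. x \<in> L \<Longrightarrow> F' x \<in> L"
    and inv: "\<And>x. x \<in> V \<Longrightarrow> F (F' x) = x" "\<And>x. x \<in> V \<Longrightarrow> F' (F x) = x"
    and lin: "\<And>x y. F (x + y) = F x + F y" "\<And>c x. F (scale c x) = scale c (F x)"
    and iso: "\<And>x y. h (F x) (F y) = h x y"
  shows "restrict F V \<in> U"
proof -
  have "bij_betw F V V" by (rule bij_betw_byWitness[of _ F']) (use V inv in auto)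
  then have "bij_betw (restrict F V) V V" by (subst bij_betw_cong[of V _ F]) auto
  moreover have "restrict F V ` L = L"
  proof
    show "restrict F V ` L \<subseteq> L" using L L_V by auto
    show "L \<subseteq> restrict F V ` L"
    proof
      fix x assume "x \<in> L"
      then have "x = restrict F V (F' x)" "F' x \<in> L" using inv L L_V by auto
      then show "x \<in> restrict F V ` L" by blast
    qed
  qed
  ultimately show ?thesis using lin iso by (auto simp: U_iff carrier_BijGroup)
qed

lemma subgroup_U: "subgroup U (BijGroup V)"
proof (rule G.subgroupI)
  show "U \<subseteq> carrier (BijGroup V)" using U_carrier by blast
  have "restrict (\<lambda>x. x) V \<in> U" by (rule U_restrictI[where F' = "\<lambda>x. x"]) auto
  then show "U \<noteq> {}" by blast
next
  fix f g assume f: "f \<in> U" and g: "g \<in> U"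
  have car: "f \<otimes>\<^bsub>BijGroup V\<^esub> g \<in> carrier (BijGroup V)" using f g U_carrier by simp
  have eq: "f \<otimes>\<^bsub>BijGroup V\<^esub> g = compose V f g" by (rule mult_BijGroup) (simp_all add: f g U_carrier)
  have "compose V f g ` L = f ` g ` L" using L_V by (auto simp: compose_def)
  also have "\<dots> = L" using f g by (simp add: U_iff)
  finally show "f \<otimes>\<^bsub>BijGroup V\<^esub> g \<in> U"
    using car f g U_V[OF g] unfolding eq by (subst U_iff) (simp add: compose_def U_add U_scale U_h)
next
  fix f assume f: "f \<in> U"
  let ?g = "inv\<^bsub>BijGroup V\<^esub> f"
  have fc: "f \<in> carrier (BijGroup V)" using f U_carrier by blast
  have car: "?g \<in> carrier (BijGroup V)" using fc by simp
  have gV: "?g x \<in> V" if "x \<in> V" for x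
    using car that unfolding carrier_BijGroup bij_betw_def by blast
  have fg: "f (?g x) = x" if "x \<in> V" for x
  proof -
    have "compose V f ?g = (\<lambda>x\<in>V. x)"
      using G.r_inv[OF fc] mult_BijGroup[OF fc car] one_BijGroup by simp
    then show ?thesis using that by (metis compose_eq restrict_apply')
  qed
  have inj: "x = y" if "f x = f y" "x \<in> V" "y \<in> V" for x y
    using fc that by (auto simp: carrier_BijGroup bij_betw_def inj_on_def)
  have "?g (x + y) = ?g x + ?g y" if "x \<in> V" "y \<in> V" for x y
    by (rule inj) (use that gV fg U_add[OF f] in simp_all)
  moreover have "?g (scale c x) = scale c (?g x)" if "x \<in> V" for c x
    by (rule inj) (use that gV fg U_scale[OF f] in simp_all)
  moreover have "h (?g x) (?g y) = h x y" if "x \<in> V" "y \<in> V" for x y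
    using U_h[OF f gV gV, of x y] that fg by simp
  moreover have "?g ` L = L"
  proof -
    have gf: "?g (f x) = x" if "x \<in> V" for x
      by (rule inj) (use that gV fg U_V[OF f] in simp_all)
    have "?g ` L = ?g ` f ` L" using f by (simp add: U_iff)
    also have "\<dots> = L" using gf L_V by (auto simp: image_image)
    finally show ?thesis .
  qed
  ultimately show "?g \<in> U" using car by (simp add: U_iff)
qed

lemma symmetry_group_subset: "symmetry_group bar scale h V L \<subseteq> U"
  unfolding symmetry_group_def U_def[symmetric]
  by (rule G.generate_subgroup_incl[OF _ subgroup_U]) simp

subsection \<open>Symmetries\<close>

text \<open>The inverse is the symmetry along \<open>s\<close> with parameter
  \<open>bar \<sigma>\<close>, of the same trace; hence integrality is asked for both
  parameters.\<close>

lemma symmetry_in_U: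
  assumes s: "s \<in> V" and \<sigma>: "\<sigma> \<noteq> 0" and hs: "h s s = Tr \<sigma>"
    and L: "\<And>x. x \<in> L \<Longrightarrow> scale (h x s / \<sigma>) s \<in> L" "\<And>x. x \<in> L \<Longrightarrow> scale (h x s / bar \<sigma>) s \<in> L"
  shows "hermitian_symmetry scale h V s \<sigma> \<in> U"
  unfolding hermitian_symmetry_def
proof (rule U_restrictI)
  let ?S = "\<lambda>\<sigma> x. x - scale (h x s * inverse \<sigma>) s"
  show "?S \<sigma> x \<in> V" "?S (bar \<sigma>) x \<in> V" if "x \<in> V" for x using s that by simp_all
  show "?S \<sigma> x \<in> L" "?S (bar \<sigma>) x \<in> L" if "x \<in> L" for x
    using L that by (auto simp: divide_inverse intro!: L_diff)
  have inv: "?S (bar \<tau>) (?S \<tau> x) = x" if "\<tau> \<noteq> 0" "h s s = Tr \<tau>" for \<tau> x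
  proof -
    have eq: "h (?S \<tau> x) s * inverse (bar \<tau>) = - (h x s * inverse \<tau>)"
      using that by (simp add: trace_def field_simps)
    show ?thesis unfolding eq by simp
  qed
  show "?S (bar \<sigma>) (?S \<sigma> x) = x" "?S \<sigma> (?S (bar \<sigma>) x) = x" for x
    using inv[of \<sigma> x] inv[of "bar \<sigma>" x] \<sigma> hs by (simp_all add: trace_def add.commute)
  show "?S \<sigma> (x + y) = ?S \<sigma> x + ?S \<sigma> y" for x y
    by (simp add: scale_left_distrib distrib_right)
  show "?S \<sigma> (scale c x) = scale c (?S \<sigma> x)" for c x
    by (simp add: scale_right_diff_distrib mult.assoc)
  show "h (?S \<sigma> x) (?S \<sigma> y) = h x y" for x y
  proof -
    define a where "a = h x s"
    define b where "b = h s y"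
    have b: "h y s = bar b" by (simp add: b_def)
    have "h (?S \<sigma> x) (?S \<sigma> y) = h x y - b * inverse (bar \<sigma>) * a - a * inverse \<sigma> * b
        + a * inverse \<sigma> * (b * inverse (bar \<sigma>)) * Tr \<sigma>"
      by (simp add: a_def[symmetric] b_def[symmetric] b hs algebra_simps)
    also have "\<dots> = h x y" using \<sigma> by (simp add: trace_def field_simps)
    finally show ?thesis .
  qed
qed

lemma symmetry_in_X:
  assumes "s \<in> V" "\<sigma> \<noteq> 0" "h s s = Tr \<sigma>"
    and "\<And>x. x \<in> L \<Longrightarrow> scale (h x s / \<sigma>) s \<in> L" "\<And>x. x \<in> L \<Longrightarrow> scale (h x s / bar \<sigma>) s \<in> L"
  shows "hermitian_symmetry scale h V s \<sigma> \<in> X"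
proof -
  have "hermitian_symmetry scale h V s \<sigma> \<in> symmetries bar scale h V"
    using assms(1-3) unfolding symmetries_def by blast
  moreover have "hermitian_symmetry scale h V s \<sigma> \<in> U" by (rule symmetry_in_U[OF assms])
  ultimately have "hermitian_symmetry scale h V s \<sigma> \<in> symmetry_group bar scale h V L"
    unfolding symmetry_group_def U_def[symmetric] by (intro generate.incl) blast
  then show ?thesis unfolding X_def X_group_def by (intro generate.incl) blast
qed

subsection \<open>Hyperbolic pairs and Eichler isometries\<close>

text \<open>Hyperbolic pairs that split \<open>L\<close>, in terms of valuations: products of
  \<open>L\<close> with \<open>u\<close> and \<open>v\<close> lie in the ideal generated by
  \<open>h u v\<close>, so that coordinates along the plane are integral.\<close>

definition hyperbolic :: "'v \<Rightarrow> 'v \<Rightarrow> int \<Rightarrow> bool" where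
  "hyperbolic u v k \<longleftrightarrow> u \<in> L \<and> v \<in> L \<and> h u u = 0 \<and> h v v = 0 \<and> exact k (h u v) \<and>
     (\<forall>z\<in>L. h z u \<in> P k \<and> h z v \<in> P k)"

lemma plane_orthogonal_iff:
  "(\<forall>q\<in>plane (val_ring w) scale u v. h x q = 0) \<longleftrightarrow> h x u = 0 \<and> h x v = 0"
proof
  assume "\<forall>q\<in>plane (val_ring w) scale u v. h x q = 0"
  moreover have "u \<in> plane (val_ring w) scale u v"
    unfolding plane_def mem_Collect_eq by (rule exI[of _ 1], rule exI[of _ 0]) (simp add: one_P)
  moreover have "v \<in> plane (val_ring w) scale u v"
    unfolding plane_def mem_Collect_eq by (rule exI[of _ 0], rule exI[of _ 1]) (simp add: one_P)
  ultimately show "h x u = 0 \<and> h x v = 0" by blast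
qed (auto simp: plane_def)

lemma hyperbolic_imp_splitting:
  assumes "hyperbolic u v k"
  shows "splitting_hyperbolic_pair (val_ring w) scale h L u v"
proof -
  have uv: "u \<in> L" "v \<in> L" "h u u = 0" "h v v = 0" "exact k (h u v)"
    "\<And>z. z \<in> L \<Longrightarrow> h z u \<in> P k" "\<And>z. z \<in> L \<Longrightarrow> h z v \<in> P k"
    using assms by (auto simp: hyperbolic_def)
  have ne: "h u v \<noteq> 0" "h v u \<noteq> 0" using uv(5) exact_nonzero h_zero_sym by blast+
  have coords: "a = 0 \<and> b = 0" if "h (scale a u + scale b v) u = 0" "h (scale a u + scale b v) v = 0" for a b
    using that uv(3,4) ne by simp
  have "u \<noteq> v" using uv(3) ne by auto
  moreover have "independent {u, v}"
  proof
    assume "dependent {u, v}"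
    then obtain g where g: "g u \<noteq> 0 \<or> g v \<noteq> 0" "(\<Sum>x\<in>{u, v}. scale (g x) x) = 0"
      using dependent_finite[of "{u, v}"] by auto
    then have "scale (g u) u + scale (g v) v = 0" using \<open>u \<noteq> v\<close> by simp
    then show False using coords[of "g u" "g v"] g(1) by simp
  qed
  moreover have "L = {q + r | q r. q \<in> plane (val_ring w) scale u v \<and>
      r \<in> perp_in h L (plane (val_ring w) scale u v)}"
  proof
    show "{q + r | q r. q \<in> plane (val_ring w) scale u v \<and>
      r \<in> perp_in h L (plane (val_ring w) scale u v)} \<subseteq> L"
      using uv(1,2) by (auto simp: plane_def perp_in_def intro!: L_add L_scale)
    show "L \<subseteq> {q + r | q r. q \<in> plane (val_ring w) scale u v \<and>
      r \<in> perp_in h L (plane (val_ring w) scale u v)}"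
    proof
      fix x assume x: "x \<in> L"
      define a where "a = h x v / h u v"
      define b where "b = h x u / h v u"
      have a: "a \<in> P 0" unfolding a_def by (rule P_divide[OF uv(7)[OF x] uv(5)]) simp
      have b: "b \<in> P 0" unfolding b_def by (rule P_divide[OF uv(6)[OF x]]) (use uv(5) exact_h_sym in auto)
      let ?q = "scale a u + scale b v"
      have "?q \<in> plane (val_ring w) scale u v" using a b by (auto simp: plane_def)
      moreover have "x - ?q \<in> perp_in h L (plane (val_ring w) scale u v)"
        unfolding perp_in_def mem_Collect_eq plane_orthogonal_iff
        using x uv a b ne by (auto simp: a_def b_def intro!: L_diff L_add L_scale)
      ultimately show "x \<in> {q + r | q r. q \<in> plane (val_ring w) scale u v \<and>
        r \<in> perp_in h L (plane (val_ring w) scale u v)}"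
        unfolding mem_Collect_eq by (intro exI[of _ ?q] exI[of _ "x - ?q"]) simp
    qed
  qed
  moreover have "plane (val_ring w) scale u v \<inter> perp_in h L (plane (val_ring w) scale u v) = {0}"
  proof
    show "plane (val_ring w) scale u v \<inter> perp_in h L (plane (val_ring w) scale u v) \<subseteq> {0}"
    proof
      fix x assume "x \<in> plane (val_ring w) scale u v \<inter> perp_in h L (plane (val_ring w) scale u v)"
      then obtain a b where x: "x = scale a u + scale b v" "h x u = 0" "h x v = 0"
        unfolding perp_in_def Int_iff mem_Collect_eq plane_orthogonal_iff by (auto simp: plane_def)
      then show "x \<in> {0}" using coords[of a b] by simp
    qed
    show "{0} \<subseteq> plane (val_ring w) scale u v \<inter> perp_in h L (plane (val_ring w) scale u v)"
      unfolding perp_in_def by (auto simp: plane_def L_zero intro!: exI[of _ 0])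
  qed
  ultimately show ?thesis unfolding splitting_hyperbolic_pair_def Let_def using uv by blast
qed

lemma splitting_imp_hyperbolic:
  assumes "splitting_hyperbolic_pair (val_ring w) scale h L u v"
  shows "hyperbolic u v (w (h u v))"
proof -
  let ?P = "plane (val_ring w) scale u v"
  have uv: "u \<in> L" "v \<in> L" "h u u = 0" "h v v = 0" "independent {u, v}"
    and L: "L = {q + r | q r. q \<in> ?P \<and> r \<in> perp_in h L ?P}"
    using assms by (auto simp: splitting_hyperbolic_pair_def Let_def)
  have dec: "\<exists>a\<in>P 0. \<exists>b\<in>P 0. h z u = b * h v u \<and> h z v = a * h u v" if "z \<in> L" for z
  proof -
    have "z \<in> {q + r | q r. q \<in> ?P \<and> r \<in> perp_in h L ?P}" using that L by blast
    then obtain q r where qr: "z = q + r" "q \<in> ?P" "r \<in> perp_in h L ?P" by blast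
    then obtain a b where ab: "q = scale a u + scale b v" "a \<in> P 0" "b \<in> P 0"
      by (auto simp: plane_def)
    have "h r u = 0" "h r v = 0"
      using qr(3) unfolding perp_in_def mem_Collect_eq plane_orthogonal_iff by auto
    then show ?thesis using ab qr(1) uv by auto
  qed
  \<comment> \<open>Otherwise \<open>u\<close> would be orthogonal to all of \<open>L\<close> and
    vanish by nondegeneracy.\<close>
  have ne: "h u v \<noteq> 0"
  proof
    assume "h u v = 0"
    then have "h v u = 0" by (simp add: h_zero_sym)
    then have "h u z = 0" if "z \<in> L" for z using dec[OF that] by (metis h_zero_sym mult_zero_right)
    then have "u = 0" using L_nondegenerate uv(1) by blast
    then show False using uv(5) dependent_zero by blast
  qed
  then have c: "exact (w (h u v)) (h u v)" by (simp add: exact_def)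
  then have c': "exact (w (h u v)) (h v u)" using exact_h_sym by blast
  have "h z u \<in> P (w (h u v)) \<and> h z v \<in> P (w (h u v))" if z: "z \<in> L" for z
  proof -
    obtain a b where "a \<in> P 0" "b \<in> P 0" "h z u = b * h v u" "h z v = a * h u v"
      using dec[OF z] by blast
    then show ?thesis using P_mult[OF _ exact_P[OF c], of a 0] P_mult[OF _ exact_P[OF c'], of b 0] by simp
  qed
  then show ?thesis using uv c by (simp add: hyperbolic_def)
qed

lemma eichler_in_U:
  assumes uv: "hyperbolic u v k"
    and y: "y \<in> L" "h y u = 0" "h y v = 0" "\<And>z. z \<in> L \<Longrightarrow> h z y \<in> P k"
    and \<mu>: "\<mu> \<in> P 0" "Tr (\<mu> * h u v) = - h y y"
  shows "eichler scale h V u v y \<mu> \<in> U"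
  unfolding eichler_def
proof (rule U_restrictI)
  let ?E = "\<lambda>y \<mu> x. x + scale (h x u / h v u) y + scale (\<mu> * h x u / h v u - h x y / h u v) u"
  \<comment> \<open>The parameter of the inverse; by the trace condition it equals
    \<open>bar (\<mu> * h u v) / h u v\<close>.\<close>
  let ?n = "- \<mu> - h y y / h u v"
  have u: "u \<in> L" "h u u = 0" "h v v = 0" and c: "exact k (h u v)" "exact k (h v u)"
    and hu: "\<And>z. z \<in> L \<Longrightarrow> h z u \<in> P k"
    using uv exact_h_sym by (auto simp: hyperbolic_def)
  have ne: "h u v \<noteq> 0" "h v u \<noteq> 0" using c exact_nonzero by blast+
  have uy: "h u y = 0" using y(2) h_zero_sym by blast
  have \<mu>': "\<mu> * h u v + bar \<mu> * h v u = - h y y" using \<mu>(2) by (simp add: trace_def)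
  show "?E y \<mu> x \<in> V" "?E (- y) ?n x \<in> V" if "x \<in> V" for x
    using that L_V[OF u(1)] L_V[OF y(1)] by simp_all
  have EL: "?E z \<nu> x \<in> L" if "x \<in> L" "z \<in> L" "\<And>x. x \<in> L \<Longrightarrow> h x z \<in> P k" "\<nu> \<in> P 0" for x z \<nu>
  proof -
    have a: "h x u / h v u \<in> P 0" by (rule P_divide[OF hu[OF that(1)] c(2)]) simp
    have b: "h x z / h u v \<in> P 0" by (rule P_divide[OF that(3)[OF that(1)] c(1)]) simp
    have "\<nu> * (h x u / h v u) \<in> P 0" by (rule P_mult[OF that(4) a]) simp
    then have "\<nu> * h x u / h v u - h x z / h u v \<in> P 0" using b by (simp add: P_diff)
    then show ?thesis using a that(1,2) u(1) by (intro L_add L_scale)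
  qed
  have "h y y / h u v \<in> P 0" by (rule P_divide[OF y(4)[OF y(1)] c(1)]) simp
  then have n: "?n \<in> P 0" using \<mu>(1) by (intro P_diff) simp_all
  show "?E y \<mu> x \<in> L" if "x \<in> L" for x using EL that y \<mu> by blast
  show "?E (- y) ?n x \<in> L" if "x \<in> L" for x
    by (rule EL[OF that L_minus[OF y(1)] _ n]) (use y(4) in simp)
  have comp: "?E y2 \<mu>2 (?E y1 \<mu>1 x) = x"
    if "y2 = - y1" "\<mu>2 = - \<mu>1 - h y1 y1 / h u v" "h y1 u = 0" "h u y1 = 0" for y1 y2 \<mu>1 \<mu>2 x
  proof -
    define a where "a = h x u / h v u"
    define b where "b = h x y1 / h u v"
    have E1: "?E y1 \<mu>1 x = x + scale a y1 + scale (\<mu>1 * a - b) u" by (simp add: a_def b_def)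
    have 1: "h (?E y1 \<mu>1 x) u = h x u" using that u by simp
    have 2: "h (?E y1 \<mu>1 x) y2 = - (h x y1 + a * h y1 y1)" using that by (simp add: a_def)
    have "(h x y1 + a * h y1 y1) / h u v = b + h y1 y1 / h u v * a"
      by (simp add: b_def add_divide_distrib mult.commute)
    moreover have "\<mu>2 * h x u / h v u = - \<mu>1 * a - h y1 y1 / h u v * a"
      unfolding that(2) a_def by (simp add: left_diff_distrib diff_divide_distrib)
    ultimately have "\<mu>2 * h x u / h v u - - (h x y1 + a * h y1 y1) / h u v = - (\<mu>1 * a - b)"
      unfolding minus_divide_left[symmetric] by simp
    then have "?E y2 \<mu>2 (?E y1 \<mu>1 x) = ?E y1 \<mu>1 x + scale a y2 + scale (- (\<mu>1 * a - b)) u"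
      unfolding 1 2 by (simp only: a_def)
    also have "\<dots> = x" unfolding E1 that(1) by (simp del: minus_diff_eq)
    finally show ?thesis .
  qed
  have n': "\<mu> = - ?n - h (- y) (- y) / h u v" by simp
  show "?E (- y) ?n (?E y \<mu> x) = x" for x by (rule comp) (use y uy in simp_all)
  show "?E y \<mu> (?E (- y) ?n x) = x" for x
    by (rule comp[OF _ n']) (use y uy in simp_all)
  show "?E y \<mu> (x + z) = ?E y \<mu> x + ?E y \<mu> z" for x z
  proof -
    have 1: "h (x + z) u / h v u = h x u / h v u + h z u / h v u" by (simp add: add_divide_distrib)
    have 2: "\<mu> * h (x + z) u / h v u - h (x + z) y / h u v
        = (\<mu> * h x u / h v u - h x y / h u v) + (\<mu> * h z u / h v u - h z y / h u v)"
      by (simp add: add_divide_distrib distrib_left)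
    show ?thesis unfolding 1 2 by (simp only: scale_left_distrib ac_simps)
  qed
  show "?E y \<mu> (scale r x) = scale r (?E y \<mu> x)" for r x
  proof -
    have 1: "h (scale r x) u / h v u = r * (h x u / h v u)" by simp
    have 2: "\<mu> * h (scale r x) u / h v u - h (scale r x) y / h u v
        = r * (\<mu> * h x u / h v u - h x y / h u v)"
      by (simp add: right_diff_distrib)
    show ?thesis unfolding 1 2 by (simp only: scale_right_distrib scale_scale)
  qed
  show "h (?E y \<mu> x) (?E y \<mu> z) = h x z" for x z
  proof -
    define a where "a = h x u / h v u"
    define b where "b = h x y / h u v"
    define a' where "a' = h u z / h u v"
    define b' where "b' = h y z / h v u"
    have hx: "h x u = a * h v u" "h x y = b * h u v" "h u z = a' * h u v" "h y z = b' * h v u"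
      using ne by (simp_all add: a_def b_def a'_def b'_def)
    have Ex: "?E y \<mu> x = x + scale a y + scale (\<mu> * a - b) u" by (simp add: a_def b_def)
    have "h z u = bar (h u z)" "h z y = bar (h y z)" by simp_all
    then have Ez: "?E y \<mu> z = z + scale (bar a') y + scale (\<mu> * bar a' - bar b') u"
      by (simp add: a'_def b'_def)
    have "h (?E y \<mu> x) (?E y \<mu> z) = h x z + a' * (b * h u v) + (bar \<mu> * a' - b') * (a * h v u)
        + a * (b' * h v u) + a * a' * h y y + (\<mu> * a - b) * (a' * h u v)"
      unfolding Ex Ez using u uy y(2) by (simp add: hx(1,2) hx(3)[symmetric] hx(4)[symmetric] distrib_left)
    also have "\<dots> = h x z + a * a' * ((\<mu> * h u v + bar \<mu> * h v u) + h y y)"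
      by (simp add: algebra_simps)
    finally have "h (?E y \<mu> x) (?E y \<mu> z) = h x z + a * a' * ((\<mu> * h u v + bar \<mu> * h v u) + h y y)" .
    then show ?thesis using \<mu>' by simp
  qed
qed

lemma eichler_in_X:
  assumes uv: "hyperbolic u v k"
    and y: "y \<in> L" "h y u = 0" "h y v = 0" "\<And>z. z \<in> L \<Longrightarrow> h z y \<in> P k"
    and \<mu>: "\<mu> \<in> P 0" "Tr (\<mu> * h u v) = - h y y"
  shows "eichler scale h V u v y \<mu> \<in> X"
proof -
  have c: "exact k (h u v)" using uv by (simp add: hyperbolic_def)
  have "h x y \<in> {h u v * a | a. a \<in> val_ring w}" if "x \<in> L" for x
  proof -
    have "h x y / h u v \<in> P 0" by (rule P_divide[OF y(4)[OF that] c]) simp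
    moreover have "h x y = h u v * (h x y / h u v)" using exact_nonzero[OF c] by simp
    ultimately show ?thesis by blast
  qed
  moreover have "y \<in> perp_in h L (plane (val_ring w) scale u v)"
    unfolding perp_in_def mem_Collect_eq plane_orthogonal_iff using y by blast
  ultimately have "eichler scale h V u v y \<mu> \<in> eichler_isometries (val_ring w) bar scale h V L"
    unfolding eichler_isometries_def mem_Collect_eq
    using hyperbolic_imp_splitting[OF uv] \<mu> by (intro exI[of _ u] exI[of _ v] exI[of _ y] exI[of _ \<mu>]) simp
  then show ?thesis unfolding X_def X_group_def by (intro generate.incl) blast
qed

lemma eichler_isometries_subset: "eichler_isometries (val_ring w) bar scale h V L \<subseteq> U"
proof
  fix f assume "f \<in> eichler_isometries (val_ring w) bar scale h V L"
  then obtain u v y \<mu> where f: "f = eichler scale h V u v y \<mu>"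
    "splitting_hyperbolic_pair (val_ring w) scale h L u v"
    "y \<in> perp_in h L (plane (val_ring w) scale u v)"
    "\<forall>x\<in>L. h x y \<in> {h u v * a | a. a \<in> val_ring w}"
    "\<mu> \<in> val_ring w" "trace bar (\<mu> * h u v) = - h y y"
    unfolding eichler_isometries_def by blast
  have hyp: "hyperbolic u v (w (h u v))" by (rule splitting_imp_hyperbolic[OF f(2)])
  then have c: "exact (w (h u v)) (h u v)" by (simp add: hyperbolic_def)
  have "h z y \<in> P (w (h u v))" if z: "z \<in> L" for z
  proof -
    obtain a where "h z y = h u v * a" "a \<in> P 0" using f(4) z by blast
    then show ?thesis using P_mult[OF exact_P[OF c], of a 0] by simp
  qed
  moreover have "y \<in> L" "h y u = 0" "h y v = 0"
    using f(3) unfolding perp_in_def mem_Collect_eq plane_orthogonal_iff by auto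
  ultimately show "f \<in> U" unfolding f(1) using eichler_in_U[OF hyp] f(5,6) by blast
qed

lemma X_subset_U: "X \<subseteq> U"
  unfolding X_def X_group_def
  by (rule G.generate_subgroup_incl[OF _ subgroup_U])
    (use symmetry_group_subset eichler_isometries_subset in blast)

lemma X_U: "f \<in> X \<Longrightarrow> f \<in> U"
  using X_subset_U by blast

lemma subgroup_X: "subgroup X (BijGroup V)"
proof -
  have "symmetry_group bar scale h V L \<union> eichler_isometries (val_ring w) bar scale h V L
      \<subseteq> carrier (BijGroup V)"
    using symmetry_group_subset eichler_isometries_subset U_carrier by blast
  then show ?thesis unfolding X_def X_group_def by (rule G.generate_is_subgroup)
qed

lemma U_compose:
  assumes "f \<in> U" "g \<in> U"
  shows "compose V f g \<in> U"
  using subgroup.m_closed[OF subgroup_U assms] mult_BijGroup[OF assms[THEN U_carrier]] by simp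

lemma X_compose:
  assumes "f \<in> X" "g \<in> X"
  shows "compose V f g \<in> X"
  using subgroup.m_closed[OF subgroup_X assms] mult_BijGroup[OF assms[THEN X_U, THEN U_carrier]]
  by simp

lemma X_identity: "(\<lambda>x\<in>V. x) \<in> X"
  using subgroup.one_closed[OF subgroup_X] one_BijGroup by simp

lemma inverse_apply:
  assumes f: "f \<in> U" and g: "g = inv\<^bsub>BijGroup V\<^esub> f" and x: "x \<in> V"
  shows "g (f x) = x" "f (g x) = x"
proof -
  have fc: "f \<in> carrier (BijGroup V)" using f by (rule U_carrier)
  then have gc: "g \<in> carrier (BijGroup V)" unfolding g by (rule G.inv_closed)
  have "compose V g f = g \<otimes>\<^bsub>BijGroup V\<^esub> f" by (simp only: mult_BijGroup[OF gc fc])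
  also have "\<dots> = \<one>\<^bsub>BijGroup V\<^esub>" unfolding g by (rule G.l_inv[OF fc])
  finally have gf: "compose V g f = (\<lambda>x\<in>V. x)" unfolding one_BijGroup .
  have "compose V f g = f \<otimes>\<^bsub>BijGroup V\<^esub> g" by (simp only: mult_BijGroup[OF fc gc])
  also have "\<dots> = \<one>\<^bsub>BijGroup V\<^esub>" unfolding g by (rule G.r_inv[OF fc])
  finally have fg: "compose V f g = (\<lambda>x\<in>V. x)" unfolding one_BijGroup .
  show "g (f x) = x" using fun_cong[OF gf, of x] x by (simp add: compose_eq)
  show "f (g x) = x" using fun_cong[OF fg, of x] x by (simp add: compose_eq)
qed

lemma U_inverse:
  assumes "f \<in> U"
  obtains g where "g \<in> U" "\<And>x. x \<in> V \<Longrightarrow> g (f x) = x" "\<And>x. x \<in> V \<Longrightarrow> f (g x) = x"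
proof (rule that)
  show "inv\<^bsub>BijGroup V\<^esub> f \<in> U" by (rule subgroup.m_inv_closed[OF subgroup_U assms])
qed (simp_all add: inverse_apply[OF assms refl])

lemma X_inverse:
  assumes "f \<in> X"
  obtains g where "g \<in> X" "\<And>x. x \<in> V \<Longrightarrow> g (f x) = x" "\<And>x. x \<in> V \<Longrightarrow> f (g x) = x"
proof (rule that)
  show "inv\<^bsub>BijGroup V\<^esub> f \<in> X" by (rule subgroup.m_inv_closed[OF subgroup_X assms])
qed (simp_all add: inverse_apply[OF X_U[OF assms] refl])

lemma X_cancel:
  assumes f: "f \<in> U" and \<psi>: "\<psi> \<in> X" and "compose V \<psi> f \<in> X"
  shows "f \<in> X"
proof -
  obtain g where g: "g \<in> X" "\<And>x. x \<in> V \<Longrightarrow> g (\<psi> x) = x" using X_inverse[OF \<psi>] by blast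
  have "compose V g (compose V \<psi> f) = f"
  proof
    fix x show "compose V g (compose V \<psi> f) x = f x"
    proof (cases "x \<in> V")
      case True
      then show ?thesis using g(2) U_V[OF f] by (simp add: compose_def)
    next
      case False
      then show ?thesis using U_carrier[OF f] extensional_arb[of f V x]
        by (simp add: compose_def carrier_BijGroup)
    qed
  qed
  then show ?thesis using X_compose[OF g(1) assms(3)] by simp
qed

subsection \<open>Elements of \<open>X(L)\<close> supported on a subset\<close>

text \<open>These elements can be applied as later corrections: vectors that are already fixed and
  orthogonal to \<open>W\<close> are not disturbed.\<close>

definition fixing :: "'v set \<Rightarrow> ('v \<Rightarrow> 'v) set" where
  "fixing W = {\<psi> \<in> X. \<forall>z\<in>V. (\<forall>s\<in>W. h z s = 0) \<longrightarrow> \<psi> z = z}"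

lemma fixing_X: "\<psi> \<in> fixing W \<Longrightarrow> \<psi> \<in> X"
  by (simp add: fixing_def)

lemma fixing_U: "\<psi> \<in> fixing W \<Longrightarrow> \<psi> \<in> U"
  using fixing_X X_U by blast

lemma fixing_fixed: "\<psi> \<in> fixing W \<Longrightarrow> z \<in> V \<Longrightarrow> (\<And>s. s \<in> W \<Longrightarrow> h z s = 0) \<Longrightarrow> \<psi> z = z"
  by (simp add: fixing_def)

lemma fixing_mono: "\<psi> \<in> fixing W \<Longrightarrow> W \<subseteq> W' \<Longrightarrow> \<psi> \<in> fixing W'"
  unfolding fixing_def by blast

lemma fixing_compose:
  assumes "\<phi> \<in> fixing W" "\<psi> \<in> fixing W"
  shows "compose V \<phi> \<psi> \<in> fixing W"
  unfolding fixing_def mem_Collect_eq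
  using assms X_compose[OF assms[THEN fixing_X]] by (simp add: compose_eq fixing_def)

lemma fixing_inverse:
  assumes "\<psi> \<in> fixing W"
  obtains \<phi> where "\<phi> \<in> fixing W" "\<And>x. x \<in> V \<Longrightarrow> \<phi> (\<psi> x) = x"
proof -
  obtain \<phi> where \<phi>: "\<phi> \<in> X" "\<And>x. x \<in> V \<Longrightarrow> \<phi> (\<psi> x) = x"
    using X_inverse[OF fixing_X[OF assms]] by metis
  have "\<phi> z = z" if "z \<in> V" "\<And>s. s \<in> W \<Longrightarrow> h z s = 0" for z
    using \<phi>(2)[OF that(1)] fixing_fixed[OF assms that] by simp
  then have "\<phi> \<in> fixing W" using \<phi>(1) by (simp add: fixing_def)
  then show thesis using \<phi>(2) that by blast
qed

lemma symmetry_fixing: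
  assumes s: "s \<in> L" "s \<in> W" and \<sigma>: "exact n \<sigma>" "h s s = Tr \<sigma>"
    and n: "\<And>x. x \<in> L \<Longrightarrow> h x s \<in> P n"
  obtains \<psi> where "\<psi> \<in> fixing W" "\<And>x. x \<in> V \<Longrightarrow> \<psi> x = x - scale (h x s / \<sigma>) s"
proof -
  let ?S = "hermitian_symmetry scale h V s \<sigma>"
  have ev: "?S x = x - scale (h x s / \<sigma>) s" if "x \<in> V" for x
    using that by (simp add: hermitian_symmetry_def divide_inverse)
  have "?S \<in> X"
  proof (rule symmetry_in_X[OF L_V[OF s(1)] exact_nonzero[OF \<sigma>(1)] \<sigma>(2)])
    fix x assume "x \<in> L"
    then have x: "h x s \<in> P n" by (rule n)
    have "h x s / \<sigma> \<in> P 0" by (rule P_divide[OF x \<sigma>(1)]) simp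
    then show "scale (h x s / \<sigma>) s \<in> L" by (rule L_scale[OF _ s(1)])
    have "h x s / bar \<sigma> \<in> P 0" by (rule P_divide[OF x]) (use \<sigma>(1) in auto)
    then show "scale (h x s / bar \<sigma>) s \<in> L" by (rule L_scale[OF _ s(1)])
  qed
  then have "?S \<in> fixing W" using ev s(2) by (simp add: fixing_def)
  then show thesis using ev that by blast
qed

text \<open>For \<open>\<sigma> = bar (h x (x - y))\<close>, equality of the norms gives both
  \<open>h (x - y) (x - y) = Tr \<sigma>\<close> and \<open>h y (x - y) = - \<sigma>\<close>, so the
  symmetry along \<open>x - y\<close> adds \<open>x - y\<close> to \<open>y\<close>.\<close>

lemma move:
  assumes xy: "x \<in> L" "y \<in> L" "x - y \<in> W" and hxy: "h x x = h y y"
    and n: "exact n (h x (x - y))" "\<And>z. z \<in> L \<Longrightarrow> h z (x - y) \<in> P n"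
  obtains \<psi> where "\<psi> \<in> fixing W" "\<psi> y = x"
proof -
  define \<sigma> where "\<sigma> = bar (h x (x - y))"
  have \<sigma>: "exact n \<sigma>" using n(1) by (simp only: \<sigma>_def exact_bar)
  have tr: "h (x - y) (x - y) = Tr \<sigma>" using hxy by (simp add: \<sigma>_def trace_def)
  obtain \<psi> where \<psi>: "\<psi> \<in> fixing W" "\<And>z. z \<in> V \<Longrightarrow> \<psi> z = z - scale (h z (x - y) / \<sigma>) (x - y)"
    using symmetry_fixing[OF L_diff[OF xy(1,2)] xy(3) \<sigma> tr n(2)] by metis
  have "h y (x - y) = - \<sigma>" using hxy by (simp add: \<sigma>_def)
  then have "h y (x - y) / \<sigma> = - 1" using exact_nonzero[OF \<sigma>] by simp
  then have "\<psi> y = x" using \<psi>(2)[OF L_V[OF xy(2)]] by simp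
  then show thesis using \<psi>(1) that by blast
qed

lemma eichler_fixing:
  assumes uv: "hyperbolic u v k" and W: "u \<in> W" "y \<in> W"
    and y: "y \<in> L" "h y u = 0" "h y v = 0" "\<And>z. z \<in> L \<Longrightarrow> h z y \<in> P k"
    and \<mu>: "\<mu> \<in> P 0" "Tr (\<mu> * h u v) = - h y y"
  obtains \<psi> where "\<psi> \<in> fixing W"
    "\<And>x. x \<in> V \<Longrightarrow> \<psi> x = x + scale (h x u / h v u) y + scale (\<mu> * h x u / h v u - h x y / h u v) u"
proof -
  let ?E = "eichler scale h V u v y \<mu>"
  have ev: "?E x = x + scale (h x u / h v u) y + scale (\<mu> * h x u / h v u - h x y / h u v) u"
    if "x \<in> V" for x using that by (simp add: eichler_def)
  have "?E \<in> X" by (rule eichler_in_X[OF uv y \<mu>])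
  then have "?E \<in> fixing W" using ev W by (simp add: fixing_def)
  then show thesis using ev that by blast
qed

subsection \<open>Orthogonal splittings\<close>

definition submodule :: "'v set \<Rightarrow> bool" where
  "submodule N \<longleftrightarrow> N \<subseteq> L \<and> 0 \<in> N \<and> (\<forall>x\<in>N. \<forall>y\<in>N. x + y \<in> N) \<and> (\<forall>c\<in>P 0. \<forall>x\<in>N. scale c x \<in> N)"

text \<open>Every \<open>z\<close> in \<open>L\<close> is the sum of some \<open>n\<close> in \<open>N\<close> and a vector \<open>z - n\<close> orthogonal to \<open>N\<close>.\<close>
definition splits :: "'v set \<Rightarrow> bool" where
  "splits N \<longleftrightarrow> submodule N \<and> (\<forall>z\<in>L. \<exists>n\<in>N. \<forall>y\<in>N. h z y = h n y)"

definition adapted :: "('v \<Rightarrow> 'v) \<Rightarrow> 'v set \<Rightarrow> bool" where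
  "adapted f N \<longleftrightarrow> f \<in> U \<and> (\<forall>z\<in>L. (\<forall>y\<in>N. h z y = 0) \<longrightarrow> f z = z)"

lemma submodule_L: "submodule N \<Longrightarrow> x \<in> N \<Longrightarrow> x \<in> L"
  and submodule_add: "submodule N \<Longrightarrow> x \<in> N \<Longrightarrow> y \<in> N \<Longrightarrow> x + y \<in> N"
  and submodule_scale: "submodule N \<Longrightarrow> c \<in> P 0 \<Longrightarrow> x \<in> N \<Longrightarrow> scale c x \<in> N"
  by (auto simp: submodule_def)

lemma submodule_minus: "submodule N \<Longrightarrow> x \<in> N \<Longrightarrow> - x \<in> N"
  using submodule_scale[of N "- 1" x] one_P by simp

lemma submodule_diff: "submodule N \<Longrightarrow> x \<in> N \<Longrightarrow> y \<in> N \<Longrightarrow> x - y \<in> N"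
  using submodule_add[of N x "- y"] submodule_minus by simp

lemma submodule_V: "submodule N \<Longrightarrow> x \<in> N \<Longrightarrow> x \<in> V"
  using submodule_L L_V by blast

lemma splits_submodule: "splits N \<Longrightarrow> submodule N"
  by (simp add: splits_def)

lemma splits_L: "splits L"
  using L_zero L_add L_scale by (auto simp: splits_def submodule_def)

lemma splits_nondegenerate:
  assumes "splits N" "x \<in> N" "\<And>y. y \<in> N \<Longrightarrow> h x y = 0"
  shows "x = 0"
proof (rule L_nondegenerate)
  show "x \<in> L" using assms submodule_L splits_submodule by blast
  fix z assume "z \<in> L"
  then obtain n where "n \<in> N" "h z x = h n x" using assms(1,2) by (auto simp: splits_def)
  then show "h x z = 0" using assms(3) by (metis h_zero_sym)
qed

lemma splits_P:
  assumes "splits N" "x \<in> N" "\<And>y. y \<in> N \<Longrightarrow> h y x \<in> P n" "z \<in> L"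
  shows "h z x \<in> P n"
  using assms by (metis splits_def)

lemma adapted_U: "adapted f N \<Longrightarrow> f \<in> U"
  by (simp add: adapted_def)

text \<open>The component of \<open>f x\<close> outside \<open>N\<close> is orthogonal to
  \<open>N\<close> by choice. It is orthogonal to the complement too, since \<open>f\<close> fixes
  the complement and \<open>x\<close> is orthogonal to it. Nondegeneracy of \<open>L\<close> kills
  it.\<close>

lemma adapted_in:
  assumes N: "splits N" and f: "adapted f N" and x: "x \<in> N"
  shows "f x \<in> N"
proof -
  have fU: "f \<in> U" using f adapted_U by blast
  have xL: "x \<in> L" using N x splits_submodule submodule_L by blast
  obtain n where n: "n \<in> N" "\<And>y. y \<in> N \<Longrightarrow> h (f x) y = h n y"
    using N U_L[OF fU xL] unfolding splits_def by blast
  then have nL: "n \<in> L" using N splits_submodule submodule_L by blast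
  define m where "m = f x - n"
  have mL: "m \<in> L" unfolding m_def by (rule L_diff[OF U_L[OF fU xL] nL])
  have mN: "h m y = 0" if "y \<in> N" for y using n(2)[OF that] by (simp add: m_def)
  have "m = 0"
  proof (rule L_nondegenerate[OF mL])
    fix z assume z: "z \<in> L"
    obtain n' where n': "n' \<in> N" "\<And>y. y \<in> N \<Longrightarrow> h z y = h n' y" using N z unfolding splits_def by blast
    define m' where "m' = z - n'"
    have m'N: "h m' y = 0" if "y \<in> N" for y using n'(2)[OF that] by (simp add: m'_def)
    have m'L: "m' \<in> L" unfolding m'_def
      using n'(1) z N splits_submodule submodule_L by (blast intro: L_diff)
    then have "f m' = m'" using f m'N unfolding adapted_def by blast
    then have "h (f x) m' = h x m'" using U_h[OF fU L_V[OF xL] L_V[OF m'L]] by simp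
    moreover have "h x m' = 0" "h n m' = 0" using m'N x n(1) h_zero_sym by blast+
    ultimately have "h m m' = 0" by (simp add: m_def)
    moreover have "h m z = h m m' + h m n'" by (simp add: m'_def)
    ultimately show "h m z = 0" using mN[OF n'(1)] by simp
  qed
  then show ?thesis using n(1) by (simp add: m_def)
qed

lemma adapted_compose:
  assumes "\<psi> \<in> fixing N" "adapted f N"
  shows "adapted (compose V \<psi> f) N"
  unfolding adapted_def
proof (intro conjI ballI impI)
  show "compose V \<psi> f \<in> U"
    using U_compose fixing_U adapted_U assms by blast
  fix z assume z: "z \<in> L" "\<forall>y\<in>N. h z y = 0"
  then have "f z = z" using assms(2) by (simp add: adapted_def)
  then show "compose V \<psi> f z = z"
    using fixing_fixed[OF assms(1) L_V[OF z(1)]] z L_V by (simp add: compose_eq)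
qed

lemma U_image_P:
  assumes "f \<in> U" "x \<in> V" "\<And>z. z \<in> L \<Longrightarrow> h z x \<in> P n" "z \<in> L"
  shows "h z (f x) \<in> P n"
proof -
  obtain g where g: "g \<in> U" "\<And>x. x \<in> V \<Longrightarrow> f (g x) = x" using U_inverse[OF assms(1)] by metis
  have "h z (f x) = h (g z) x"
    using U_h[OF assms(1) U_V[OF g(1) L_V[OF assms(4)]] assms(2)] g(2) L_V[OF assms(4)] by simp
  then show ?thesis using assms(3) U_L[OF g(1) assms(4)] by simp
qed

text \<open>The descent of the induction: fixed vectors with integral projections are split off from
  \<open>N\<close>. The case \<open>x = v\<close> covers a line.\<close>

lemma splits_reduce:
  assumes N: "splits N" and xv: "x \<in> N" "v \<in> N"
    and dec: "\<And>z. z \<in> L \<Longrightarrow> \<exists>a\<in>P 0. \<exists>b\<in>P 0.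
      h (z - (scale a x + scale b v)) x = 0 \<and> h (z - (scale a x + scale b v)) v = 0"
    and g: "adapted g N" "g x = x" "g v = v"
  shows "splits {z \<in> N. h z x = 0 \<and> h z v = 0}" "adapted g {z \<in> N. h z x = 0 \<and> h z v = 0}"
proof -
  let ?N = "{z \<in> N. h z x = 0 \<and> h z v = 0}"
  have sub: "submodule N" using N splits_submodule by blast
  have dec': "\<exists>a\<in>P 0. \<exists>b\<in>P 0. z - (scale a x + scale b v) \<in> ?N" if z: "z \<in> N" for z
  proof -
    obtain a b where ab: "a \<in> P 0" "b \<in> P 0" "h (z - (scale a x + scale b v)) x = 0"
      "h (z - (scale a x + scale b v)) v = 0" using dec submodule_L[OF sub z] by blast
    have "z - (scale a x + scale b v) \<in> N"
      using sub z xv ab by (intro submodule_diff submodule_add submodule_scale)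
    then show ?thesis using ab by blast
  qed
  have perp: "h x y = 0" "h v y = 0" if "y \<in> ?N" for y using that h_zero_sym by auto
  show "splits ?N" unfolding splits_def
  proof (intro conjI ballI)
    show "submodule ?N" using sub by (auto simp: submodule_def)
    fix z assume "z \<in> L"
    then obtain n where n: "n \<in> N" "\<And>y. y \<in> N \<Longrightarrow> h z y = h n y" using N unfolding splits_def by blast
    obtain a b where ab: "n - (scale a x + scale b v) \<in> ?N" using dec'[OF n(1)] by blast
    show "\<exists>n\<in>?N. \<forall>y\<in>?N. h z y = h n y"
      by (rule bexI[OF _ ab]) (use n perp in auto)
  qed
  show "adapted g ?N" unfolding adapted_def
  proof (intro conjI ballI impI)
    show gU: "g \<in> U" using g(1) adapted_U by blast
    fix z assume z: "z \<in> L" "\<forall>y\<in>?N. h z y = 0"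
    obtain a b where ab: "a \<in> P 0" "b \<in> P 0" "h (z - (scale a x + scale b v)) x = 0"
      "h (z - (scale a x + scale b v)) v = 0" using dec z(1) by blast
    \<comment> \<open>Without its components along \<open>x\<close> and \<open>v\<close> the vector
      is orthogonal to all of \<open>N\<close>, where \<open>g\<close> is known to be
      trivial.\<close>
    define z' where "z' = z - (scale a x + scale b v)"
    have z'x: "h z' x = 0" "h z' v = 0" using ab z'_def by auto
    have xvL: "x \<in> L" "v \<in> L" using xv sub submodule_L by blast+
    have z'L: "z' \<in> L" unfolding z'_def using xvL z(1) ab by (intro L_diff L_add L_scale)
    have "h z' y = 0" if y: "y \<in> N" for y
    proof -
      obtain a' b' where y1: "y - (scale a' x + scale b' v) \<in> ?N" using dec'[OF y] by blast
      define y1 where "y1 = y - (scale a' x + scale b' v)"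
      have y1N: "y1 \<in> ?N" using y1 unfolding y1_def .
      then have "h z y1 = 0" using z(2) by blast
      then have "h z' y1 = 0" using perp[OF y1N] by (simp add: z'_def)
      moreover have "y = y1 + (scale a' x + scale b' v)" by (simp add: y1_def)
      ultimately show ?thesis using z'x by simp
    qed
    then have "g z' = z'" using g(1) z'L unfolding adapted_def by blast
    moreover have "z = z' + (scale a x + scale b v)" by (simp add: z'_def)
    ultimately show "g z = z"
      using g(2,3) L_V z'L xvL by (simp add: U_add[OF gU] U_scale[OF gU])
  qed
qed

subsection \<open>Existence of hyperbolic pairs\<close>

text \<open>Adding \<open>l\<close> times \<open>m2\<close> with \<open>l\<close> in
  \<open>P 1\<close> makes \<open>m1\<close> isotropic and keeps the product with \<open>m2\<close>
  at valuation \<open>k\<close>. This solves a quadratic equation, hence the stronger bound on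
  \<open>m1\<close>. Making \<open>m2\<close> isotropic with a multiple of \<open>u\<close> is then
  only a trace condition.\<close>

lemma ex_hyperbolic:
  assumes N: "submodule N" and m: "m1 \<in> N" "m2 \<in> N" and c: "exact k (h m1 m2)"
    and P1: "\<And>z. z \<in> L \<Longrightarrow> h z m1 \<in> P k" and P2: "\<And>z. z \<in> L \<Longrightarrow> h z m2 \<in> P k"
    and n1: "h m1 m1 \<in> P (k + d)" and n2: "h m2 m2 \<in> P (k + d - 1)"
  shows "\<exists>u\<in>N. \<exists>v\<in>N. hyperbolic u v k"
proof -
  obtain l where l: "l \<in> P 1" "h m1 m1 + Tr (bar l * h m1 m2) + l * bar l * h m2 m2 = 0"
    using isotropic_solution[OF _ n1 _ n2 c] by auto
  then have l0: "l \<in> P 0" using P_mono by fastforce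
  define u where "u = m1 + scale l m2"
  have uN: "u \<in> N" unfolding u_def using N m l0 by (intro submodule_add submodule_scale)
  have huu: "h u u = 0"
    using l(2) by (simp add: u_def trace_def algebra_simps)
  have "l * h m2 m2 \<in> P (k + 1)" by (rule P_mult[OF l(1) n2]) (use d_ge_2 in simp)
  then have um: "exact k (h u m2)" using exact_add[OF c] by (simp add: u_def)
  have t: "- h m2 m2 \<in> P (k + d - 1)" using n2 by simp
  obtain \<kappa> where \<kappa>: "\<kappa> \<in> P 0" "Tr (\<kappa> * h u m2) = - h m2 m2"
    using ex_trace_P[OF _ t um] by auto
  define v where "v = m2 + scale \<kappa> u"
  have vN: "v \<in> N" unfolding v_def using N m uN \<kappa> by (intro submodule_add submodule_scale)
  have hvv: "h v v = 0"
    using \<kappa>(2) huu by (simp add: v_def trace_def algebra_simps)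
  have huv: "exact k (h u v)" using um huu by (simp add: v_def)
  have Pu: "h z u \<in> P k" if "z \<in> L" for z
  proof -
    have "bar l * h z m2 \<in> P k" using P_mult[of "bar l" 0 "h z m2" k k] l0 P2[OF that] by simp
    then show ?thesis using P1[OF that] by (simp add: u_def P_add)
  qed
  have Pv: "h z v \<in> P k" if "z \<in> L" for z
  proof -
    have "bar \<kappa> * h z u \<in> P k" using P_mult[of "bar \<kappa>" 0 "h z u" k k] \<kappa>(1) Pu[OF that] by simp
    then show ?thesis using P2[OF that] by (simp add: v_def P_add)
  qed
  have "hyperbolic u v k" unfolding hyperbolic_def
    using submodule_L[OF N uN] submodule_L[OF N vN] huu hvv huv Pu Pv by blast
  then show ?thesis using uN vN by blast
qed

text \<open>An orthogonal vector \<open>t\<close> absorbs the norms: if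
  \<open>\<theta> * bar \<theta>\<close> is close to \<open>- h m m / h t t\<close>, adding
  \<open>\<theta>\<close> times \<open>t\<close> to \<open>m\<close> brings its norm into
  \<open>P (l + d)\<close>. The assumed bounds put \<open>\<theta>\<close> into
  \<open>P (l - k + 1)\<close>, so products at level \<open>l\<close> survive.\<close>

lemma ex_hyperbolic_with:
  assumes N: "submodule N" and m: "m1 \<in> N" "m2 \<in> N" "t \<in> N" and mt: "h m1 t = 0" "h m2 t = 0"
    and e: "exact (2 * i) (h t t)" and Pt: "\<And>z. z \<in> L \<Longrightarrow> h z t \<in> P k"
    and le: "k \<le> 2 * i" "k \<le> l" and c: "exact l (h m1 m2)"
    and P1: "\<And>z. z \<in> L \<Longrightarrow> h z m1 \<in> P l" and P2: "\<And>z. z \<in> L \<Longrightarrow> h z m2 \<in> P l"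
    and n1: "h m1 m1 \<in> P (2 * i + 2 * (l - k) + 1)" and n2: "h m2 m2 \<in> P (2 * i + 2 * (l - k) + 1)"
  shows "\<exists>u\<in>N. \<exists>v\<in>N. hyperbolic u v l"
proof -
  have adjust: "\<exists>\<theta>\<in>P (l - k + 1). h (m + scale \<theta> t) (m + scale \<theta> t) \<in> P (l + d)"
    if mt: "h m t = 0" and n: "h m m \<in> P (2 * i + 2 * (l - k) + 1)" for m
  proof -
    \<comment> \<open>Norms are fixed, so the odd exponent improves by one; this gives the extra 1
      in \<open>P (l - k + 1)\<close>.\<close>
    have n': "h m m \<in> P (2 * i + 2 * (l - k) + 2)" using fixed_P_odd[OF n] by (simp add: add.assoc)
    have q: "- h m m / h t t \<in> P (2 * (l - k + 1))"
      by (rule P_divide[OF _ e, of _ "2 * i + 2 * (l - k) + 2"]) (use n' in simp_all)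
    have "bar (- h m m / h t t) = - h m m / h t t" by simp
    from norm_approx_P[OF this q] obtain \<theta> where \<theta>: "\<theta> \<in> P (l - k + 1)"
      "\<theta> * bar \<theta> - (- h m m / h t t) \<in> P (2 * (l - k + 1) + 2 * (d - 1))"
      by blast
    have tm: "h t m = 0" using mt h_zero_sym by blast
    have "h (m + scale \<theta> t) (m + scale \<theta> t) = (\<theta> * bar \<theta> - (- h m m / h t t)) * h t t"
      using exact_nonzero[OF e] mt tm by (simp add: algebra_simps)
    also have "\<dots> \<in> P (l + d)"
      by (rule P_mult[OF \<theta>(2) exact_P[OF e]]) (use le d_ge_2 in presburger)
    finally show ?thesis using \<theta>(1) by blast
  qed
  obtain \<theta>1 where \<theta>1: "\<theta>1 \<in> P (l - k + 1)" "h (m1 + scale \<theta>1 t) (m1 + scale \<theta>1 t) \<in> P (l + d)"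
    using adjust[OF mt(1) n1] by blast
  obtain \<theta>2 where \<theta>2: "\<theta>2 \<in> P (l - k + 1)" "h (m2 + scale \<theta>2 t) (m2 + scale \<theta>2 t) \<in> P (l + d)"
    using adjust[OF mt(2) n2] by blast
  have in_N: "m + scale \<theta> t \<in> N" if "m \<in> N" "\<theta> \<in> P (l - k + 1)" for m \<theta>
    using N m(3) that P_mono[OF that(2), of 0] le by (auto intro!: submodule_add submodule_scale)
  have in_P: "h z (m + scale \<theta> t) \<in> P l"
    if "\<And>z. z \<in> L \<Longrightarrow> h z m \<in> P l" "\<theta> \<in> P (l - k + 1)" "z \<in> L" for m \<theta> z
  proof -
    have "bar \<theta> * h z t \<in> P l" by (rule P_mult[OF _ Pt[OF that(3)]]) (use that(2) in auto)
    then show ?thesis using that(1,3) by (simp add: P_add)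
  qed
  have tm: "h t m2 = 0" using mt h_zero_sym by blast
  have "\<theta>1 * bar \<theta>2 * h t t \<in> P (l + 1)"
    by (rule P_mult[OF P_mult[OF \<theta>1(1), of "bar \<theta>2" "l - k + 1"] exact_P[OF e]])
      (use \<theta>2(1) le in auto)
  then have c': "exact l (h (m1 + scale \<theta>1 t) (m2 + scale \<theta>2 t))"
    using exact_add[OF c] mt tm by (simp add: mult_ac)
  show ?thesis
    by (rule ex_hyperbolic[OF N in_N[OF m(1) \<theta>1(1)] in_N[OF m(2) \<theta>2(1)] c'])
      (use in_P P1 P2 \<theta>1 \<theta>2 P_mono[OF \<theta>2(2), of "l + d - 1"] in auto)
qed

subsection \<open>Fixing a hyperbolic pair\<close>

text \<open>Isotropic vectors whose product has valuation \<open>k\<close> are carried to each other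
  by symmetries, and \<open>u\<close> is reachable from \<open>v\<close>; so a product of valuation
  \<open>k\<close> of \<open>f u\<close> with \<open>u\<close> or \<open>v\<close> suffices.
  Otherwise the component \<open>r\<close> of \<open>f v\<close> orthogonal to \<open>u\<close> and
  \<open>v\<close> has such a product with \<open>f u\<close>, and the Eichler isometry along
  \<open>r\<close> transfers it to the product with \<open>v\<close>.\<close>

lemma hyperbolic_fix_first:
  assumes N: "splits N" and f: "adapted f N" and uv: "hyperbolic u v k" "u \<in> N" "v \<in> N"
  shows "\<exists>\<psi>\<in>fixing N. \<psi> (f u) = u"
proof -
  have sub: "submodule N" using N splits_submodule by blast
  have u: "u \<in> L" "v \<in> L" "h u u = 0" "h v v = 0" and c: "exact k (h u v)" "exact k (h v u)"
    and Pu: "\<And>z. z \<in> L \<Longrightarrow> h z u \<in> P k" and Pv: "\<And>z. z \<in> L \<Longrightarrow> h z v \<in> P k"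
    using uv exact_h_sym by (auto simp: hyperbolic_def)
  have ne: "h u v \<noteq> 0" "h v u \<noteq> 0" using c exact_nonzero by blast+
  have uV: "u \<in> V" "v \<in> V" using u L_V by blast+
  have step: "\<exists>\<psi>\<in>fixing N. \<psi> y = x"
    if "x \<in> N" "y \<in> N" "h x x = 0" "h y y = 0" "exact k (h x y)"
      "\<And>z. z \<in> L \<Longrightarrow> h z x \<in> P k" "\<And>z. z \<in> L \<Longrightarrow> h z y \<in> P k" for x y
  proof -
    have "exact k (h x (x - y))" using that(3,5) by simp
    then show ?thesis
      using move[of x y N k] that submodule_L[OF sub] submodule_diff[OF sub]
      by (metis P_diff h_diff_right)
  qed
  have via_v: "\<exists>\<psi>\<in>fixing N. \<psi> (g u) = u" if g: "adapted g N" and ex: "exact k (h (g u) v)" for g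
  proof -
    have gU: "g \<in> U" using g adapted_U by blast
    have gu: "g u \<in> N" "h (g u) (g u) = 0" using adapted_in[OF N g uv(2)] U_h[OF gU uV(1) uV(1)] u by auto
    have Pgu: "\<And>z. z \<in> L \<Longrightarrow> h z (g u) \<in> P k" using U_image_P[OF gU uV(1) Pu] by blast
    obtain \<psi>1 where 1: "\<psi>1 \<in> fixing N" "\<psi>1 (g u) = v"
      using step[OF uv(3) gu(1) u(4) gu(2) _ Pv Pgu] ex exact_h_sym by blast
    obtain \<psi>2 where 2: "\<psi>2 \<in> fixing N" "\<psi>2 v = u"
      using step[OF uv(2,3) u(3,4) c(1) Pu Pv] by blast
    show ?thesis
      by (rule bexI[OF _ fixing_compose[OF 2(1) 1(1)]])
        (use 1 2 submodule_V[OF sub gu(1)] in \<open>simp add: compose_eq\<close>)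
  qed
  have fU: "f \<in> U" using f adapted_U by blast
  have fu: "f u \<in> N" "h (f u) (f u) = 0" using adapted_in[OF N f uv(2)] U_h[OF fU uV(1) uV(1)] u by auto
  have Pfu: "\<And>z. z \<in> L \<Longrightarrow> h z (f u) \<in> P k" using U_image_P[OF fU uV(1) Pu] by blast
  have fuV: "f u \<in> V" using submodule_V[OF sub fu(1)] .
  show ?thesis
  proof (cases "exact k (h (f u) u) \<or> exact k (h (f u) v)")
    case True
    then show ?thesis
      using via_v[OF f] step[OF uv(2) fu(1) u(3) fu(2) _ Pu Pfu] exact_h_sym by blast
  next
    case False
    have fuL: "f u \<in> L" using submodule_L[OF sub fu(1)] .
    have b: "h (f u) u \<in> P (k + 1)" "h (f u) v \<in> P (k + 1)"
      using False Pu[OF fuL] Pv[OF fuL] by (auto simp: exact_iff)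
    define v' where "v' = f v"
    have v': "v' \<in> N" "h v' v' = 0" "h (f u) v' = h u v"
      using adapted_in[OF N f uv(3)] U_h[OF fU uV(2) uV(2)] U_h[OF fU uV] u by (auto simp: v'_def)
    have Pv': "\<And>z. z \<in> L \<Longrightarrow> h z v' \<in> P k" unfolding v'_def using U_image_P[OF fU uV(2) Pv] by blast
    define \<gamma> where "\<gamma> = h v' v / h u v"
    define \<delta> where "\<delta> = h v' u / h v u"
    have v'L: "v' \<in> L" using submodule_L[OF sub v'(1)] .
    have \<gamma>: "\<gamma> \<in> P 0" unfolding \<gamma>_def by (rule P_divide[OF Pv[OF v'L] c(1)]) simp
    have \<delta>: "\<delta> \<in> P 0" unfolding \<delta>_def by (rule P_divide[OF Pu[OF v'L] c(2)]) simp
    define r where "r = v' - (scale \<gamma> u + scale \<delta> v)"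
    have rN: "r \<in> N" unfolding r_def
      using sub uv v' \<gamma> \<delta> by (intro submodule_diff submodule_add submodule_scale)
    have ru: "h r u = 0" "h r v = 0" using ne u by (simp_all add: r_def \<gamma>_def \<delta>_def)
    then have ur: "h u r = 0" "h v r = 0" using h_zero_sym by blast+
    have v'eq: "v' = r + (scale \<gamma> u + scale \<delta> v)" by (simp add: r_def)
    have "h v' v' = h r r + Tr (\<gamma> * bar \<delta> * h u v)"
      unfolding v'eq using ru ur u by (simp add: trace_def algebra_simps)
    \<comment> \<open>Isotropy of \<open>f v\<close> is exactly the trace condition for the Eichler
      parameter \<open>\<gamma> * bar \<delta>\<close>.\<close>
    then have tr: "Tr (\<gamma> * bar \<delta> * h u v) = - h r r"
      using v'(2) by (simp add: eq_neg_iff_add_eq_0 add.commute)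
    have \<mu>: "\<gamma> * bar \<delta> \<in> P 0" by (rule P_mult[OF \<gamma>]) (use \<delta> in auto)
    have Pr: "h z r \<in> P k" if z: "z \<in> L" for z
    proof -
      have "bar \<gamma> * h z u \<in> P k" by (rule P_mult[OF _ Pu[OF z]]) (use \<gamma> in auto)
      moreover have "bar \<delta> * h z v \<in> P k" by (rule P_mult[OF _ Pv[OF z]]) (use \<delta> in auto)
      ultimately show ?thesis using Pv'[OF z] by (simp add: r_def P_add P_diff)
    qed
    obtain \<psi> where \<psi>: "\<psi> \<in> fixing N" "\<And>x. x \<in> V \<Longrightarrow> \<psi> x = x + scale (h x u / h v u) r
        + scale (\<gamma> * bar \<delta> * h x u / h v u - h x r / h u v) u"
      using eichler_fixing[OF uv(1,2) rN submodule_L[OF sub rN] ru Pr \<mu> tr] by blast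
    have "bar \<gamma> * h (f u) u \<in> P (k + 1)" by (rule P_mult[OF _ b(1)]) (use \<gamma> in auto)
    moreover have "bar \<delta> * h (f u) v \<in> P (k + 1)" by (rule P_mult[OF _ b(2)]) (use \<delta> in auto)
    ultimately have "bar \<gamma> * h (f u) u + bar \<delta> * h (f u) v \<in> P (k + 1)" by (rule P_add)
    from exact_diff[OF c(1) this]
    have fr: "exact k (h (f u) r)" using v'(3) by (simp add: r_def)
    have a: "\<gamma> * bar \<delta> * h (f u) u / h v u \<in> P 1"
      by (rule P_divide[OF P_mult[OF \<mu> b(1), of "k + 1"] c(2)]) simp_all
    have "exact 0 (h (f u) r / h u v)" by (rule exact_divide[OF fr c(1)]) simp
    \<comment> \<open>Thus the Eichler isometry adds to \<open>f u\<close> a unit multiple of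
      \<open>u\<close>, which dominates the product with \<open>v\<close>.\<close>
    then have "exact 0 (\<gamma> * bar \<delta> * h (f u) u / h v u - h (f u) r / h u v)"
      by (rule exact_diff'[OF a]) simp
    from exact_mult[OF this c(1), of k]
    have "exact k ((\<gamma> * bar \<delta> * h (f u) u / h v u - h (f u) r / h u v) * h u v)" by simp
    then have "exact k (h (f u) v + (\<gamma> * bar \<delta> * h (f u) u / h v u - h (f u) r / h u v) * h u v)"
      by (rule exact_add'[OF b(2)]) simp
    then have "exact k (h (compose V \<psi> f u) v)"
      using ru by (simp add: compose_eq uV \<psi>(2)[OF fuV])
    then obtain \<phi> where "\<phi> \<in> fixing N" "\<phi> (compose V \<psi> f u) = u"
      using via_v[OF adapted_compose[OF \<psi>(1) f]] by blast
    then show ?thesis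
      using fixing_compose[OF _ \<psi>(1)] fuV uV
      by (intro bexI[of _ "compose V \<phi> \<psi>"]) (auto simp: compose_eq)
  qed
qed

text \<open>As \<open>f\<close> fixes \<open>u\<close>, the vector \<open>f v\<close> is the sum of
  \<open>v\<close>, \<open>r\<close> and \<open>\<tau>\<close> times \<open>u\<close>. This is the
  image of \<open>v\<close> under the Eichler isometry with data \<open>r\<close> and
  \<open>\<tau>\<close>, whose inverse is taken.\<close>

lemma hyperbolic_fix_second:
  assumes N: "splits N" and f: "adapted f N" and uv: "hyperbolic u v k" "u \<in> N" "v \<in> N"
    and fix_u: "f u = u"
  shows "\<exists>\<psi>\<in>fixing N. \<psi> u = u \<and> \<psi> (f v) = v"
proof -
  have sub: "submodule N" using N splits_submodule by blast
  have u: "u \<in> L" "v \<in> L" "h u u = 0" "h v v = 0" and c: "exact k (h u v)" "exact k (h v u)"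
    and Pu: "\<And>z. z \<in> L \<Longrightarrow> h z u \<in> P k" and Pv: "\<And>z. z \<in> L \<Longrightarrow> h z v \<in> P k"
    using uv exact_h_sym by (auto simp: hyperbolic_def)
  have ne: "h u v \<noteq> 0" "h v u \<noteq> 0" using c exact_nonzero by blast+
  have uV: "u \<in> V" "v \<in> V" using u L_V by blast+
  have fU: "f \<in> U" using f adapted_U by blast
  define v' where "v' = f v"
  have v': "v' \<in> N" "h v' v' = 0" "h u v' = h u v"
    using adapted_in[OF N f uv(3)] U_h[OF fU uV(2) uV(2)] U_h[OF fU uV] u fix_u by (auto simp: v'_def)
  then have v'u: "h v' u = h v u" by (metis bar_h)
  have v'L: "v' \<in> L" using submodule_L[OF sub v'(1)] .
  have Pv': "\<And>z. z \<in> L \<Longrightarrow> h z v' \<in> P k" unfolding v'_def using U_image_P[OF fU uV(2) Pv] by blast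
  define \<tau> where "\<tau> = h v' v / h u v"
  have \<tau>: "\<tau> \<in> P 0" unfolding \<tau>_def by (rule P_divide[OF Pv[OF v'L] c(1)]) simp
  define r where "r = v' - (v + scale \<tau> u)"
  have rN: "r \<in> N" unfolding r_def
    using sub uv v' \<tau> by (intro submodule_diff submodule_add submodule_scale)
  have ru: "h r u = 0" "h r v = 0" using ne u v'u by (simp_all add: r_def \<tau>_def)
  then have ur: "h u r = 0" "h v r = 0" using h_zero_sym by blast+
  have v'eq: "v' = r + (v + scale \<tau> u)" by (simp add: r_def)
  have "h v' v' = h r r + Tr (\<tau> * h u v)"
    unfolding v'eq using ru ur u by (simp add: trace_def algebra_simps)
  then have tr: "Tr (\<tau> * h u v) = - h r r"
    using v'(2) by (simp add: eq_neg_iff_add_eq_0 add.commute)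
  have Pr: "h z r \<in> P k" if z: "z \<in> L" for z
  proof -
    have "bar \<tau> * h z u \<in> P k" by (rule P_mult[OF _ Pu[OF z]]) (use \<tau> in auto)
    then show ?thesis using Pv'[OF z] Pv[OF z] by (simp add: r_def P_add P_diff)
  qed
  obtain \<psi> where \<psi>: "\<psi> \<in> fixing N" "\<And>x. x \<in> V \<Longrightarrow> \<psi> x = x + scale (h x u / h v u) r
      + scale (\<tau> * h x u / h v u - h x r / h u v) u"
    using eichler_fixing[OF uv(1,2) rN submodule_L[OF sub rN] ru Pr \<tau> tr] by blast
  have "\<psi> v = v'" unfolding \<psi>(2)[OF uV(2)] v'eq using ne ur by simp
  moreover have "\<psi> u = u" unfolding \<psi>(2)[OF uV(1)] using u ur by simp
  moreover obtain \<phi> where "\<phi> \<in> fixing N" "\<And>x. x \<in> V \<Longrightarrow> \<phi> (\<psi> x) = x"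
    using fixing_inverse[OF \<psi>(1)] by metis
  ultimately show ?thesis using uV v'_def by metis
qed

lemma ex_scale:
  assumes "submodule N" "x \<in> N" "y \<in> N" "h x y \<noteq> 0"
  obtains k a b where "\<And>x y. x \<in> N \<Longrightarrow> y \<in> N \<Longrightarrow> h x y \<in> P k" "a \<in> N" "b \<in> N" "exact k (h a b)"
proof -
  obtain n where n: "\<forall>x\<in>L. \<forall>y\<in>L. h x y \<in> P n" using L_bounded by blast
  let ?S = "{h x y | x y. x \<in> N \<and> y \<in> N}"
  have "?S \<subseteq> P n" using n submodule_L[OF assms(1)] by blast
  moreover have "h x y \<in> ?S" using assms by blast
  ultimately obtain k s where k: "?S \<subseteq> P k" "s \<in> ?S" "exact k s"
    using ex_min_valuation[of "h x y" ?S n] assms(4) by blast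
  then show thesis using that by blast
qed

end

section \<open>Moving a vector in the absence of hyperbolic pairs\<close>

text \<open>
  The case \<open>W = N\<close>, \<open>t = v\<close> moves the image of an anisotropic vector. When \<open>W\<close> is the orthogonal
  complement in \<open>N\<close> of an already fixed vector \<open>x\<close>, it moves the image of the second basis vector
  \<open>v\<close> of a plane containing \<open>x\<close> and \<open>t\<close>.
\<close>
locale transitive_step = hermitian w bar p scale h V L
  for w :: "'e::field_char_0 \<Rightarrow> int" and bar p
    and scale :: "'e \<Rightarrow> 'v::ab_group_add \<Rightarrow> 'v" and h V L +
  fixes N W :: "'v set" and t v :: 'v and k i :: int
  assumes N: "splits N" and W: "submodule W" and W_N: "W \<subseteq> N"
    and t: "t \<in> W" and v: "v \<in> N"
    and exact_tv: "exact k (h t v)" and exact_tt: "exact (2 * i) (h t t)"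
    and le_i: "k \<le> 2 * i"
    and N_P: "\<And>x y. x \<in> N \<Longrightarrow> y \<in> N \<Longrightarrow> h x y \<in> P k"
    and N_norm: "\<And>x. x \<in> N \<Longrightarrow> h x x \<in> P (2 * i)"
    and perp_t: "\<And>z. z \<in> W \<Longrightarrow> h z v = 0 \<Longrightarrow> h z t = 0"
    and proj: "\<And>z. z \<in> N \<Longrightarrow> \<exists>z'\<in>W. h z' v = 0 \<and> (\<forall>n\<in>W. h n v = 0 \<longrightarrow> h z n = h z' n)"
    and no_hyperbolic: "\<And>u v l. u \<in> N \<Longrightarrow> v \<in> N \<Longrightarrow> \<not> hyperbolic u v l"
begin

definition N0 :: "'v set" where "N0 = {z \<in> W. h z v = 0}"

definition coeff :: "'v \<Rightarrow> 'e" where "coeff z = h z v / h t v"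

lemma sub_N: "submodule N"
  using N splits_submodule by blast

lemma tv_nonzero: "h t v \<noteq> 0" "h v t \<noteq> 0"
  using exact_nonzero[OF exact_tv] h_zero_sym by blast+

lemma sub_N0: "submodule N0"
  using W by (auto simp: N0_def submodule_def)

lemma N0_W: "n \<in> N0 \<Longrightarrow> n \<in> W"
  by (simp add: N0_def)

lemma N0_N: "n \<in> N0 \<Longrightarrow> n \<in> N"
  using N0_W W_N by blast

lemma N0_perp: "n \<in> N0 \<Longrightarrow> h n v = 0" "n \<in> N0 \<Longrightarrow> h n t = 0"
    "n \<in> N0 \<Longrightarrow> h v n = 0" "n \<in> N0 \<Longrightarrow> h t n = 0"
  using perp_t h_zero_sym by (auto simp: N0_def)

lemma t_N: "t \<in> N"
  using t W_N by blast

lemma P_t: "z \<in> L \<Longrightarrow> h z t \<in> P k"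
  using splits_P[OF N t_N] N_P t_N by blast

text \<open>By \<open>proj\<close>, a vector of \<open>N\<close> pairs with \<open>N0\<close> like
  some vector of \<open>N0\<close>; the splitting of \<open>N\<close> carries the bound on to
  \<open>L\<close>.\<close>

lemma N0_lift:
  assumes n: "n \<in> N0" and "\<And>y. y \<in> N0 \<Longrightarrow> h y n \<in> P m" and z: "z \<in> L"
  shows "h z n \<in> P m"
proof (rule splits_P[OF N N0_N[OF n] _ z])
  fix y assume "y \<in> N"
  then obtain z' where "z' \<in> W" "h z' v = 0" "h y n = h z' n"
    using proj n unfolding N0_def by blast
  then show "h y n \<in> P m" using assms(2) by (simp add: N0_def)
qed

lemma coeff_P: "z \<in> N \<Longrightarrow> coeff z \<in> P 0"
  unfolding coeff_def by (rule P_divide[OF N_P[OF _ v] exact_tv]) simp_all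

lemma coeff_decompose:
  assumes z: "z \<in> W"
  shows "z - scale (coeff z) t \<in> N0"
proof -
  have "z - scale (coeff z) t \<in> W"
    using z t W coeff_P W_N by (intro submodule_diff submodule_scale) auto
  moreover have "h (z - scale (coeff z) t) v = 0" using tv_nonzero by (simp add: coeff_def)
  ultimately show ?thesis by (simp add: N0_def)
qed

text \<open>The twisted norm \<open>h n n - \<kappa> N(h n l)\<close> is what remains on \<open>N0\<close> of
  \<open>z \<mapsto> h z z - \<kappa> N(h z v)\<close> after replacing \<open>v\<close> by its image \<open>v + \<tau> t + l\<close>;
  an isometry cannot annihilate it modulo \<open>P (2 i + 2 i1 + 1)\<close>.\<close>
lemma ex_twisted_norm:
  assumes f: "f \<in> U" "\<And>z. z \<in> W \<Longrightarrow> f z \<in> W"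
    and fv: "f v = v + scale \<tau> t + l" "l \<in> N0"
    and \<tau>: "\<tau> \<in> P (i1 + 1)" and i1: "0 \<le> i1" "i1 < k + d - 1 - 2 * i"
    and l: "\<And>y. y \<in> N0 \<Longrightarrow> h y l \<in> P (i1 + k)"
    and sc: "\<And>x y. x \<in> N0 \<Longrightarrow> y \<in> N0 \<Longrightarrow> h x y \<in> P (i1 + k)"
    and nrm: "\<And>x. x \<in> N0 \<Longrightarrow> h x x \<in> P (2 * i + 2 * i1)"
    and n0: "n0 \<in> N0" "exact (2 * i + 2 * i1) (h n0 n0)"
    and \<kappa>: "\<kappa> = h t t / (h t v * h v t)"
  shows "h t t - \<kappa> * ((h t v + bar \<tau> * h t t) * bar (h t v + bar \<tau> * h t t)) \<in> P (2 * i + 2 * i1 + 1)"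
    and "\<exists>n\<in>N0. exact (2 * i + 2 * i1) (h n n) \<and>
      h n n - \<kappa> * (h n l * bar (h n l)) \<notin> P (2 * i + 2 * i1 + 1)"
proof -
  let ?e = "h t t" and ?q = "2 * i + 2 * i1"
  \<comment> \<open>This is \<open>h t (f v)\<close>, the counterpart of \<open>h t v\<close> for
    the image of \<open>v\<close>.\<close>
  define A where "A = h t v + bar \<tau> * ?e"
  have \<kappa>P: "\<kappa> \<in> P (2 * i - 2 * k)"
    unfolding \<kappa> using exact_tv exact_h_sym
    by (intro P_divide[OF exact_P[OF exact_tt] exact_mult[of k _ k]]) auto
  have \<tau>e: "bar \<tau> * ?e \<in> P (i1 + 1 + 2 * i)"
    by (rule P_mult[OF _ exact_P[OF exact_tt]]) (use \<tau> in auto)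
  have A: "A \<in> P k" unfolding A_def
    by (rule P_add[OF exact_P[OF exact_tv] P_mono[OF \<tau>e]]) (use i1 le_i in simp)
  have norm_A: "A * bar A = h t v * h v t + (bar \<tau> * ?e * bar (bar \<tau> * ?e) + Tr (h t v * bar (bar \<tau> * ?e)))"
    unfolding A_def norm_add by (simp add: add.assoc)
  have "\<kappa> * (h t v * h v t) = ?e" using tv_nonzero by (simp add: \<kappa>)
  then have eA: "?e - \<kappa> * (A * bar A) = - (\<kappa> * (bar \<tau> * ?e * bar (bar \<tau> * ?e)))
      - \<kappa> * Tr (h t v * bar (bar \<tau> * ?e))"
    unfolding norm_A distrib_left by simp
  have "\<kappa> * (bar \<tau> * ?e * bar (bar \<tau> * ?e)) \<in> P (?q + 1)"
    by (rule P_mult[OF \<kappa>P P_mult[OF \<tau>e, of _ "i1 + 1 + 2 * i" "2 * (i1 + 1 + 2 * i)"]])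
      (use \<tau>e le_i in \<open>simp_all only: P_bar\<close>, auto)
  moreover have "\<kappa> * Tr (h t v * bar (bar \<tau> * ?e)) \<in> P (?q + 1)"
  proof -
    have "bar (bar \<tau> * ?e) \<in> P (i1 + 1 + 2 * i)" using \<tau>e by (simp only: P_bar)
    then have "h t v * bar (bar \<tau> * ?e) \<in> P (k + (i1 + 1 + 2 * i))"
      by (rule P_mult[OF exact_P[OF exact_tv]]) simp
    then have "Tr (h t v * bar (bar \<tau> * ?e)) \<in> P (k + (i1 + 1 + 2 * i) + d - 1)"
      by (rule trace_P) simp
    then show ?thesis by (rule P_mult[OF \<kappa>P]) (use i1 le_i in presburger)
  qed
  ultimately have eA_P: "?e - \<kappa> * (A * bar A) \<in> P (?q + 1)"
    unfolding eA by (intro P_diff) simp_all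
  then show "?e - \<kappa> * ((h t v + bar \<tau> * ?e) * bar (h t v + bar \<tau> * ?e)) \<in> P (?q + 1)"
    by (simp only: A_def)
  have \<kappa>cross: "\<kappa> * Tr (a * bar b) \<in> P (?q + 1)" if "a \<in> P k" "b \<in> P (i1 + k)" for a b
    by (rule P_mult[OF \<kappa>P trace_P[OF P_mult[OF that(1), of "bar b" "i1 + k" "i1 + 2 * k"]],
          of "i1 + 2 * k + d - 1"])
      (use that i1 le_i in auto)
  \<comment> \<open>Orthogonality of \<open>f m\<close> and \<open>f v\<close> gives
    \<open>h n l = - (\<theta> * A)\<close>, and
    \<open>h m m = h n n + \<theta> * bar \<theta> * ?e\<close>, where the last term is close to
    \<open>\<kappa>\<close> times the norm of \<open>h n l\<close>. The sign in the twisted norm is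
    immaterial, as twice this term is negligible.\<close>
  have tw: "h n n - \<kappa> * (h n l * bar (h n l)) - h m m \<in> P (?q + 1)"
    if m: "m \<in> N0" and n: "n = f m - scale (coeff (f m)) t" for m n
  proof -
    define \<theta> where "\<theta> = coeff (f m)"
    define B where "B = h n l"
    have mV: "m \<in> V" "v \<in> V" using m v sub_N0 sub_N submodule_V by blast+
    have fm: "f m \<in> W" using f(2) N0_W[OF m] by blast
    have n0: "n \<in> N0" using coeff_decompose[OF fm] n by simp
    have \<theta>: "\<theta> \<in> P 0" using coeff_P fm W_N unfolding \<theta>_def by blast
    have z: "f m = scale \<theta> t + n" by (simp add: n \<theta>_def)
    have "h (f m) (f v) = 0" using U_h[OF f(1) mV] N0_perp(1)[OF m] by simp
    then have zero: "\<theta> * A + B = 0"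
      using N0_perp(1,2)[OF n0] N0_perp(4)[OF fv(2)]
      by (simp add: z fv(1) A_def B_def distrib_left mult_ac)
    have "h m m = h (f m) (f m)" using U_h[OF f(1) mV(1) mV(1)] by simp
    also have "\<dots> = \<theta> * bar \<theta> * ?e + h n n"
      using N0_perp(2,4)[OF n0] by (simp add: z mult_ac)
    finally have hm: "h m m = \<theta> * bar \<theta> * ?e + h n n" .
    have "B = - (\<theta> * A)" using zero by (simp add: eq_neg_iff_add_eq_0 add.commute)
    then have "h n n - \<kappa> * (B * bar B) - h m m = - (\<theta> * bar \<theta> * (?e - \<kappa> * (A * bar A))) - 2 * (\<kappa> * (B * bar B))"
      unfolding hm by (simp add: algebra_simps)
    moreover have "2 * (\<kappa> * (B * bar B)) \<in> P (?q + 1)"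
    proof -
      have "B \<in> P (i1 + k)" using l[OF n0] by (simp add: B_def)
      then have "\<kappa> * (B * bar B) \<in> P ?q"
        by (intro P_mult[OF \<kappa>P P_mult[of _ "i1 + k" _ "i1 + k" "2 * (i1 + k)"]]) auto
      then show ?thesis by (rule P_mult[of _ 1, rotated]) (use w_two in \<open>simp_all add: P_iff\<close>)
    qed
    moreover have "\<theta> * bar \<theta> * (?e - \<kappa> * (A * bar A)) \<in> P (?q + 1)"
      by (rule P_mult[OF P_mult[OF \<theta>, of "bar \<theta>" 0 0] eA_P]) (use \<theta> in auto)
    ultimately show ?thesis by (metis B_def P_diff P_minus)
  qed
  show "\<exists>n\<in>N0. exact ?q (h n n) \<and> h n n - \<kappa> * (h n l * bar (h n l)) \<notin> P (?q + 1)"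
  proof (cases "h n0 n0 - \<kappa> * (h n0 l * bar (h n0 l)) \<in> P (?q + 1)")
    case False
    then show ?thesis using n0 by blast
  next
    case n0_tw: True
    \<comment> \<open>By the preceding comparison, the \<open>N0\<close>-component of
      \<open>f n0\<close> has twisted norm close to \<open>h n0 n0\<close>.\<close>
    define n1 where "n1 = f n0 - scale (coeff (f n0)) t"
    have n1: "n1 \<in> N0" unfolding n1_def using coeff_decompose f(2) N0_W[OF n0(1)] by blast
    have n1_tw: "h n1 n1 - \<kappa> * (h n1 l * bar (h n1 l)) - h n0 n0 \<in> P (?q + 1)"
      by (rule tw[OF n0(1) n1_def])
    have n0_not: "h n0 n0 \<notin> P (?q + 1)" using n0(2) by (simp add: exact_iff)
    show ?thesis
    proof (cases "h n1 n1 \<in> P (?q + 1)")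
      case False
      then have "exact ?q (h n1 n1)" using nrm[OF n1] by (simp add: exact_iff)
      moreover have "h n1 n1 - \<kappa> * (h n1 l * bar (h n1 l)) \<notin> P (?q + 1)"
      proof
        assume "h n1 n1 - \<kappa> * (h n1 l * bar (h n1 l)) \<in> P (?q + 1)"
        from P_diff[OF this n1_tw] show False using n0_not by simp
      qed
      ultimately show ?thesis using n1 by blast
    next
      case True
      \<comment> \<open>Here \<open>n0\<close> contributes the ordinary norm and \<open>n1\<close>
        the twisted one; cross terms are negligible, so the sum has both.\<close>
      let ?n = "n0 + n1"
      have nN: "?n \<in> N0" using sub_N0 n0(1) n1 submodule_add by blast
      have "Tr (h n0 n1) \<in> P (?q + 1)" by (rule trace_P[OF sc[OF n0(1) n1]]) (use i1 in simp)
      then have s: "h n1 n1 + Tr (h n0 n1) \<in> P (?q + 1)" using True by (rule P_add[rotated])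
      have hn: "h ?n ?n = h n0 n0 + (h n1 n1 + Tr (h n0 n1))" by (simp add: trace_def add_ac)
      have ex: "exact ?q (h ?n ?n)" unfolding hn by (rule exact_add[OF n0(2) s]) simp
      have cross: "\<kappa> * Tr (h n0 l * bar (h n1 l)) \<in> P (?q + 1)"
        by (rule \<kappa>cross[OF P_mono[OF l[OF n0(1)]] l[OF n1]]) (use i1 in simp)
      have "h ?n l * bar (h ?n l) = h n0 l * bar (h n0 l) + h n1 l * bar (h n1 l)
          + Tr (h n0 l * bar (h n1 l))"
        by (simp only: h_add norm_add)
      then have eq: "h ?n ?n - \<kappa> * (h ?n l * bar (h ?n l)) = (h n0 n0 - \<kappa> * (h n0 l * bar (h n0 l)))
          + (h n1 n1 - \<kappa> * (h n1 l * bar (h n1 l)) - h n0 n0) + Tr (h n0 n1)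
          - \<kappa> * Tr (h n0 l * bar (h n1 l)) + h n0 n0"
        unfolding hn by (simp only: distrib_left) simp
      have "(h n0 n0 - \<kappa> * (h n0 l * bar (h n0 l)))
          + (h n1 n1 - \<kappa> * (h n1 l * bar (h n1 l)) - h n0 n0) + Tr (h n0 n1)
          - \<kappa> * Tr (h n0 l * bar (h n1 l)) \<in> P (?q + 1)"
        by (rule P_diff[OF P_add[OF P_add[OF n0_tw n1_tw] \<open>Tr (h n0 n1) \<in> _\<close>] cross])
      from exact_add'[OF this n0(2)]
      have "exact ?q (h ?n ?n - \<kappa> * (h ?n l * bar (h ?n l)))" unfolding eq by simp
      then show ?thesis using nN ex exact_iff by blast
    qed
  qed
qed

text \<open>The direct symmetry along \<open>v - f v\<close> is integral unless \<open>l\<close> has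
  products on \<open>N0\<close> of valuation below \<open>m + k\<close>. In that case a symmetry
  along \<open>r\<close>, a combination of \<open>t\<close> and a vector of \<open>N0\<close>, is
  applied beforehand. Its parameter has valuation \<open>i1 + k < m + k\<close>, where
  \<open>2 * i + 2 * i1\<close> is the least valuation of norms on \<open>N0\<close>.\<close>

lemma transitive_small:
  assumes f: "adapted f N" "\<And>z. z \<in> W \<Longrightarrow> f z \<in> W" "f v - v \<in> W"
    and m: "exact m (coeff (f v - v))" "m \<le> k + d - 1 - 2 * i"
  shows "\<exists>\<psi>\<in>fixing W. \<psi> (f v) = v"
proof -
  let ?e = "h t t"
  define \<tau> where "\<tau> = coeff (f v - v)"
  define l where "l = f v - v - scale \<tau> t"
  have fU: "f \<in> U" using f(1) adapted_U by blast
  have lN: "l \<in> N0" unfolding l_def \<tau>_def by (rule coeff_decompose[OF f(3)])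
  have \<tau>: "exact m \<tau>" using m(1) by (simp add: \<tau>_def)
  have \<tau>0: "\<tau> \<in> P 0" unfolding \<tau>_def using coeff_P f(3) W_N by blast
  have fv: "f v = v + scale \<tau> t + l" by (simp add: l_def)
  have vL: "v \<in> L" "v \<in> V" using v sub_N submodule_L submodule_V by blast+
  have fvL: "f v \<in> L" using U_L[OF fU vL(1)] .
  have hvv: "h v v = h (f v) (f v)" using U_h[OF fU vL(2) vL(2)] by simp
  have v_fv: "v - f v \<in> W" using submodule_minus[OF W f(3)] by simp
  have vt: "exact k (h v t)" using exact_tv exact_h_sym by blast
  have v_s: "h v (v - f v) = - (bar \<tau> * h v t)" using N0_perp(3)[OF lN] by (simp add: fv)
  have \<tau>vt: "exact (m + k) (bar \<tau> * h v t)" using \<tau> by (intro exact_mult[OF _ vt]) auto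
  have \<tau>t: "bar \<tau> * h z t \<in> P (m + k)" if "z \<in> L" for z
    using \<tau> exact_P[of m "bar \<tau>"] by (intro P_mult[OF _ P_t[OF that]]) auto
  show ?thesis
  proof (cases "\<forall>y\<in>N0. h y l \<in> P (m + k)")
    case True
    have "h z (v - f v) \<in> P (m + k)" if "z \<in> L" for z
    proof -
      have "h z (v - f v) = - (bar \<tau> * h z t) - h z l" by (simp add: fv)
      moreover have "- (bar \<tau> * h z t) \<in> P (m + k)" using \<tau>t[OF that] by simp
      ultimately show ?thesis using N0_lift[OF lN _ that, of "m + k"] True by (metis P_diff)
    qed
    moreover have "exact (m + k) (h v (v - f v))" unfolding v_s using \<tau>vt by simp
    ultimately show ?thesis using move[OF vL(1) fvL v_fv hvv] by metis
  next
    case False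
    obtain b where b: "\<forall>x\<in>L. \<forall>y\<in>L. h x y \<in> P b" using L_bounded by blast
    have N0L: "n \<in> L" if "n \<in> N0" for n using that sub_N0 submodule_L by blast
    obtain y0 where y0: "y0 \<in> N0" "h y0 l \<notin> P (m + k)" using False by blast
    then have y0_ne: "h y0 l \<noteq> 0" by auto
    have "(\<lambda>y. h y l) ` N0 \<subseteq> P b" using b N0L lN by blast
    then obtain j s where j: "(\<lambda>y. h y l) ` N0 \<subseteq> P j" "s \<in> (\<lambda>y. h y l) ` N0" "exact j s"
      using ex_min_valuation[of "h y0 l" "(\<lambda>y. h y l) ` N0" b] y0(1) y0_ne by blast
    have lj: "h y l \<in> P j" if "y \<in> N0" for y using j(1) that by blast
    have "\<not> m + k \<le> j" using lj[OF y0(1)] y0(2) P_mono by blast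
    then have j_less: "j < m + k" by simp
    obtain k1 m1 m2 where k1: "\<And>x y. x \<in> N0 \<Longrightarrow> y \<in> N0 \<Longrightarrow> h x y \<in> P k1"
      and m12: "m1 \<in> N0" "m2 \<in> N0" "exact k1 (h m1 m2)"
      using ex_scale[OF sub_N0 y0(1) lN y0_ne] by metis
    have k_k1: "k \<le> k1" using exact_not_P[OF m12(3)] N_P N0_N m12 by blast
    have k1_j: "k1 \<le> j" using j(2,3) k1 lN exact_not_P by blast
    have N0_P: "h z n \<in> P k1" if "n \<in> N0" "z \<in> L" for n z
      using N0_lift[OF that(1) _ that(2)] k1 that(1) by blast
    let ?r = "2 * i + 2 * (k1 - k) + 1"
    \<comment> \<open>With the help of \<open>t\<close>, two vectors of small norm realizing the
      scale of \<open>N0\<close> would produce a hyperbolic pair. This bounds \<open>i1\<close> by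
      \<open>k1 - k\<close>.\<close>
    have "\<not> (h m1 m1 \<in> P ?r \<and> h m2 m2 \<in> P ?r)"
    proof
      assume "h m1 m1 \<in> P ?r \<and> h m2 m2 \<in> P ?r"
      then have "\<exists>u\<in>N. \<exists>v\<in>N. hyperbolic u v k1"
        using ex_hyperbolic_with[OF sub_N N0_N[OF m12(1)] N0_N[OF m12(2)] t_N N0_perp(2)[OF m12(1)]
            N0_perp(2)[OF m12(2)] exact_tt P_t le_i k_k1 m12(3)] N0_P m12 by blast
      then show False using no_hyperbolic by blast
    qed
    then obtain n' where n': "n' \<in> N0" "h n' n' \<notin> P ?r" using m12 by blast
    have n'_ne: "h n' n' \<noteq> 0" using n'(2) by auto
    have "(\<lambda>y. h y y) ` N0 \<subseteq> P b" using b N0L by blast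
    then obtain q s where q: "(\<lambda>y. h y y) ` N0 \<subseteq> P q" "s \<in> (\<lambda>y. h y y) ` N0" "exact q s"
      using ex_min_valuation[of "h n' n'" "(\<lambda>y. h y y) ` N0" b] n'(1) n'_ne by blast
    then obtain n0 where n0: "n0 \<in> N0" "exact q (h n0 n0)" by blast
    have "even q" using exact_even[OF n0(2)] by simp
    then obtain i2 where "q = 2 * i2" by (elim evenE)
    then obtain i1 where i1: "q = 2 * i + 2 * i1" by (metis add_diff_cancel_left' diff_add_cancel distrib_left add.commute)
    have i1_nn: "0 \<le> i1" using exact_not_P[OF n0(2)] N_norm N0_N n0(1) i1 by fastforce
    have "\<not> ?r \<le> q" using n' q(1) P_mono by blast
    then have i1_k1: "i1 \<le> k1 - k" using i1 by simp
    have i1_m: "i1 < k + d - 1 - 2 * i" and i1_j: "i1 + k \<le> j" and mi: "i1 + 1 \<le> m"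
      using i1_k1 k1_j j_less m(2) by linarith+
    have nrm: "\<And>x. x \<in> N0 \<Longrightarrow> h x x \<in> P (2 * i + 2 * i1)" using q(1) i1 by blast
    have n0e: "exact (2 * i + 2 * i1) (h n0 n0)" using n0(2) i1 by simp
    have \<tau>1: "\<tau> \<in> P (i1 + 1)" using exact_P_mono[OF \<tau> mi] .
    have lP: "h y l \<in> P (i1 + k)" if "y \<in> N0" for y using lj[OF that] i1_j P_mono by blast
    have scP: "h x y \<in> P (i1 + k)" if "x \<in> N0" "y \<in> N0" for x y
      using P_mono[OF k1[OF that]] i1_k1 by simp
    define \<kappa> where "\<kappa> = ?e / (h t v * h v t)"
    define A where "A = h t v + bar \<tau> * ?e"
    note tw = ex_twisted_norm[OF fU f(2) fv lN \<tau>1 i1_nn i1_m lP scP nrm n0(1) n0e \<kappa>_def,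
        folded A_def]
    have eA: "?e - \<kappa> * (A * bar A) \<in> P (2 * i + 2 * i1 + 1)" using tw(1) .
    obtain n where n: "n \<in> N0" "exact (2 * i + 2 * i1) (h n n)"
      "i1 + k = j \<Longrightarrow> h n n - \<kappa> * (h n l * bar (h n l)) \<notin> P (2 * i + 2 * i1 + 1)"
      using tw(2) by blast
    have \<tau>e: "bar \<tau> * ?e \<in> P (i1 + 1 + 2 * i)"
      by (rule P_mult[OF _ exact_P[OF exact_tt]]) (use \<tau>1 in auto)
    have A: "exact k A" unfolding A_def
      by (rule exact_add[OF exact_tv \<tau>e]) (use i1_nn le_i in simp)
    \<comment> \<open>The value \<open>h r r\<close> shall have modulo
      \<open>P (i1 + k + d)\<close>: zero, unless parity asks for valuation exactly
      \<open>i1 + k + d - 1\<close>.\<close>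
    obtain g where g: "bar g = g" "g \<in> P (i1 + k + d - 1)" "odd (i1 + k - d) \<Longrightarrow> exact (i1 + k + d - 1) g"
    proof (cases "odd (i1 + k - d)")
      case True
      then have "2 * ((i1 + k + d - 1) div 2) = i1 + k + d - 1" by presburger
      then show thesis using ex_fixed_exact[of "(i1 + k + d - 1) div 2"] that exact_P by metis
    qed (use that[of 0] in auto)
    \<comment> \<open>The norm that \<open>\<theta>\<close> must approximate in order that
      \<open>h r r = \<theta> * bar \<theta> * ?e + h n n\<close> be close to
      \<open>g\<close>.\<close>
    define T where "T = (- h n n + g) / ?e"
    have T: "exact (2 * i1) T" unfolding T_def
      by (rule exact_divide[OF exact_add[OF _ g(2)] exact_tt, of "2 * i + 2 * i1"])
        (use n(2) i1_m in auto)
    have "bar T = T" using g(1) by (simp add: T_def)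
    from norm_approx[OF this T]
    obtain \<theta> where \<theta>: "exact i1 \<theta>" "\<theta> * bar \<theta> - T \<in> P (2 * i1 + 2 * (d - 1))" by blast
    define r where "r = scale \<theta> t + n"
    have \<theta>0: "\<theta> \<in> P 0" using exact_P_mono[OF \<theta>(1) i1_nn] .
    have rW: "r \<in> W" unfolding r_def using W t \<theta>0 N0_W[OF n(1)] by (intro submodule_add submodule_scale)
    then have rL: "r \<in> L" using W submodule_L by blast
    have hrr: "h r r = \<theta> * bar \<theta> * ?e + h n n"
      using N0_perp(2,4)[OF n(1)] by (simp add: r_def mult_ac)
    have "T * ?e = - h n n + g" using exact_nonzero[OF exact_tt] by (simp add: T_def)
    then have hrr': "h r r = (\<theta> * bar \<theta> - T) * ?e + g" by (simp add: hrr left_diff_distrib)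
    have err: "(\<theta> * bar \<theta> - T) * ?e \<in> P (i1 + k + d)"
      by (rule P_mult[OF \<theta>(2) exact_P[OF exact_tt]]) (use i1_nn le_i d_ge_2 in presburger)
    have hrr_P: "h r r \<in> P (i1 + k + d - 1)"
      unfolding hrr' by (rule P_add[OF P_mono[OF err] g(2)]) simp
    have hrr_exact: "exact (i1 + k + d - 1) (h r r)" if "odd (i1 + k - d)"
      unfolding hrr' by (rule exact_add'[OF err g(3)[OF that]]) simp
    obtain \<rho> where \<rho>: "exact (i1 + k) \<rho>" "h r r = Tr \<rho>"
      using ex_trace_exact[OF _ hrr_P hrr_exact] by auto
    have Pr: "h z r \<in> P (i1 + k)" if z: "z \<in> L" for z
    proof -
      have "bar \<theta> * h z t \<in> P (i1 + k)"
        using \<theta>(1) exact_P[of i1 "bar \<theta>"] by (intro P_mult[OF _ P_t[OF z]]) auto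
      moreover have "h z n \<in> P (i1 + k)" using N0_P[OF n(1) z] i1_k1 P_mono by fastforce
      ultimately show ?thesis by (simp add: r_def P_add)
    qed
    have rfv: "h r (f v) = \<theta> * A + h n l"
      using N0_perp[OF n(1)] N0_perp(4)[OF lN] by (simp add: r_def fv A_def distrib_left mult_ac)
    have \<theta>A: "exact (i1 + k) (\<theta> * A)" by (rule exact_mult[OF \<theta>(1) A]) simp
    \<comment> \<open>The two summands can cancel only if \<open>i1 + k = j\<close>. Then
      \<open>\<kappa>\<close> times the norm of \<open>h n l\<close> would be close to
      \<open>\<theta> * bar \<theta> * ?e\<close>, hence to \<open>- h n n\<close> and, 2 being
      small, to \<open>h n n\<close>, against the choice of \<open>n\<close>.\<close>
    have ex_rfv: "exact (i1 + k) (h r (f v))"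
    proof (cases "i1 + k = j")
      case False
      then show ?thesis unfolding rfv using exact_add[OF \<theta>A lj[OF n(1)]] i1_j by simp
    next
      case eqj: True
      have "\<theta> * A + h n l \<notin> P (i1 + k + 1)"
      proof
        assume y: "\<theta> * A + h n l \<in> P (i1 + k + 1)"
        define y where "y = \<theta> * A + h n l"
        have yP: "y \<in> P (i1 + k + 1)" using y by (simp add: y_def)
        have \<kappa>P: "\<kappa> \<in> P (2 * i - 2 * k)"
          unfolding \<kappa>_def using exact_tv vt
          by (intro P_divide[OF exact_P[OF exact_tt] exact_mult[of k _ k]]) auto
        have B: "h n l = y + - (\<theta> * A)" by (simp add: y_def)
        have NB: "h n l * bar (h n l) = y * bar y + \<theta> * bar \<theta> * (A * bar A) - Tr (y * bar (\<theta> * A))"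
          unfolding B norm_add by (simp add: trace_def mult_ac)
        have c1: "\<kappa> * (y * bar y) \<in> P (2 * i + 2 * i1 + 1)"
          by (rule P_mult[OF \<kappa>P P_mult[OF yP, of "bar y" "i1 + k + 1" "2 * (i1 + k + 1)"]])
            (use yP in auto)
        have c2: "\<kappa> * Tr (y * bar (\<theta> * A)) \<in> P (2 * i + 2 * i1 + 1)"
          by (rule P_mult[OF \<kappa>P trace_P[OF P_mult[OF yP, of "bar (\<theta> * A)" "i1 + k" "2 * (i1 + k) + 1"],
                of "2 * (i1 + k) + 1"]])
            (use exact_P[OF \<theta>A] d_ge_2 in \<open>simp_all only: P_bar\<close>, auto)
        have c3: "\<theta> * bar \<theta> * (?e - \<kappa> * (A * bar A)) \<in> P (2 * i + 2 * i1 + 1)"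
          by (rule P_mult[OF P_mult[OF \<theta>0, of "bar \<theta>" 0 0] eA]) (use \<theta>0 in auto)
        have c4: "h r r \<in> P (2 * i + 2 * i1 + 1)" by (rule P_mono[OF hrr_P]) (use i1_m in simp)
        have two: "2 \<in> P 1" using w_two by (simp add: P_iff)
        have c5: "2 * h n n \<in> P (2 * i + 2 * i1 + 1)"
          by (rule P_mult[OF two exact_P[OF n(2)]]) simp
        have "h n n - \<kappa> * (h n l * bar (h n l)) = 2 * h n n - h r r + \<theta> * bar \<theta> * (?e - \<kappa> * (A * bar A))
            - \<kappa> * (y * bar y) + \<kappa> * Tr (y * bar (\<theta> * A))"
          unfolding NB hrr by (simp add: algebra_simps)
        also have "\<dots> \<in> P (2 * i + 2 * i1 + 1)"
          by (rule P_add[OF P_diff[OF P_add[OF P_diff[OF c5 c4] c3] c1] c2])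
        finally show False using n(3)[OF eqj] by blast
      qed
      moreover have "\<theta> * A + h n l \<in> P (i1 + k)" by (rule P_add[OF exact_P[OF \<theta>A] lP[OF n(1)]])
      ultimately show ?thesis unfolding rfv by (simp add: exact_iff)
    qed
    obtain \<psi> where \<psi>: "\<psi> \<in> fixing W" "\<And>x. x \<in> V \<Longrightarrow> \<psi> x = x - scale (h x r / \<rho>) r"
      using symmetry_fixing[OF rL rW \<rho> Pr] by blast
    define c where "c = h (f v) r / \<rho>"
    have c: "exact 0 c" unfolding c_def
      by (rule exact_divide[OF _ \<rho>(1)]) (use ex_rfv exact_h_sym in auto)
    define v2 where "v2 = \<psi> (f v)"
    have v2: "v2 = f v - scale c r" unfolding v2_def c_def by (rule \<psi>(2)[OF L_V[OF fvL]])
    have v2L: "v2 \<in> L" unfolding v2_def by (rule U_L[OF fixing_U[OF \<psi>(1)] fvL])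
    have diff: "v - v2 = (v - f v) + scale c r" by (simp add: v2)
    have dW: "v - v2 \<in> W" unfolding diff
      using W v_fv rW exact_P[OF c] by (intro submodule_add submodule_scale)
    have norm2: "h v v = h v2 v2" unfolding v2_def hvv
      using U_h[OF fixing_U[OF \<psi>(1)]] L_V[OF fvL] by simp
    have "h r v = \<theta> * h t v" using N0_perp[OF n(1)] by (simp add: r_def)
    then have "exact (i1 + k) (h r v)" using exact_mult[OF \<theta>(1) exact_tv] by simp
    then have "exact (i1 + k) (h v r)" using exact_h_sym by blast
    then have e1: "exact (i1 + k) (bar c * h v r)" using c by (intro exact_mult[of 0]) auto
    have e2: "- (bar \<tau> * h v t) \<in> P (m + k)" using exact_P[OF \<tau>vt] by simp
    \<comment> \<open>The contribution of \<open>r\<close> has valuation \<open>i1 + k\<close> and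
      dominates the old product of valuation \<open>m + k\<close>.\<close>
    have ex2: "exact (i1 + k) (h v (v - v2))"
      unfolding diff h_add_right v_s h_scale_right
      by (rule exact_add'[OF e2 e1]) (use j_less i1_j in simp)
    have "h z (v - v2) \<in> P (i1 + k)" if z: "z \<in> L" for z
    proof -
      have "h z (v - v2) = bar c * h z r - bar \<tau> * h z t - h z l" by (simp add: diff fv)
      moreover have "bar c * h z r \<in> P (i1 + k)"
        using exact_P[of 0 "bar c"] c by (intro P_mult[OF _ Pr[OF z]]) auto
      moreover have "bar \<tau> * h z t \<in> P (i1 + k)"
        by (rule P_mono[OF \<tau>t[OF z]]) (use j_less i1_j in simp)
      moreover have "h z l \<in> P (i1 + k)" by (rule N0_lift[OF lN lP z])
      ultimately show ?thesis by (simp add: P_diff)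
    qed
    then obtain \<phi> where \<phi>: "\<phi> \<in> fixing W" "\<phi> v2 = v"
      using move[OF vL(1) v2L dW norm2 ex2] by blast
    then show ?thesis
      using fixing_compose[OF \<phi>(1) \<psi>(1)] L_V[OF fvL] v2_def
      by (intro bexI[of _ "compose V \<phi> \<psi>"]) (auto simp: compose_eq)
  qed
qed

text \<open>If the coordinate of \<open>f v - v\<close> along \<open>t\<close> has valuation above
  \<open>M\<close>, the symmetry along \<open>t\<close> with parameter
  \<open>h t t * \<omega>\<close> changes it by an element of valuation exactly \<open>M\<close>.
  The bound on \<open>2 * i\<close> makes that symmetry integral.\<close>

lemma transitive:
  assumes f: "adapted f N" "\<And>z. z \<in> W \<Longrightarrow> f z \<in> W" "f v - v \<in> W"
    and i: "2 * i \<le> k + d - 1"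
  shows "\<exists>\<psi>\<in>fixing W. \<psi> (f v) = v"
proof -
  define M where "M = k + d - 1 - 2 * i"
  define \<tau> where "\<tau> = coeff (f v - v)"
  show ?thesis
  proof (cases "\<tau> \<in> P (M + 1)")
    case False
    then have "exact (w \<tau>) \<tau>" "w \<tau> \<le> M" by (auto simp: P_iff exact_def)
    then show ?thesis using transitive_small[OF f, of "w \<tau>"] unfolding \<tau>_def M_def by blast
  next
    case True
    have fU: "f \<in> U" using f(1) adapted_U by blast
    have vV: "v \<in> V" using v sub_N submodule_V by blast
    define l where "l = f v - v - scale \<tau> t"
    have lN: "l \<in> N0" unfolding l_def \<tau>_def by (rule coeff_decompose[OF f(3)])
    have fv: "f v = v + scale \<tau> t + l" by (simp add: l_def)
    define \<rho> where "\<rho> = h t t * \<omega>"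
    have \<rho>: "exact (2 * i + 1 - d) \<rho>" unfolding \<rho>_def by (rule exact_mult[OF exact_tt exact_omega]) simp
    have tr: "h t t = Tr \<rho>" unfolding \<rho>_def by (simp add: trace_mult_fixed trace_omega)
    have tL: "t \<in> L" using t W submodule_L by blast
    have Pt: "h z t \<in> P (2 * i + 1 - d)" if "z \<in> L" for z
      by (rule P_mono[OF P_t[OF that]]) (use i in simp)
    obtain \<psi> where \<psi>: "\<psi> \<in> fixing W" "\<And>x. x \<in> V \<Longrightarrow> \<psi> x = x - scale (h x t / \<rho>) t"
      using symmetry_fixing[OF tL t \<rho> tr Pt] by blast
    let ?g = "compose V \<psi> f"
    have W_V: "x \<in> V" if "x \<in> W" for x using that W submodule_V by blast
    have \<psi>W: "\<psi> x \<in> W" if x: "x \<in> W" for x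
    proof -
      have "x \<in> L" using x W submodule_L by blast
      then have "h x t / \<rho> \<in> P 0" by (intro P_divide[OF Pt \<rho>]) auto
      then show ?thesis unfolding \<psi>(2)[OF W_V[OF x]]
        using x t W by (intro submodule_diff submodule_scale)
    qed
    have g1: "adapted ?g N" by (rule adapted_compose[OF fixing_mono[OF \<psi>(1) W_N] f(1)])
    have g2: "?g z \<in> W" if "z \<in> W" for z
      using that \<psi>W f(2) W_V by (simp add: compose_eq)
    have fvV: "f v \<in> V" using U_V[OF fU vV] .
    have fvL: "f v \<in> L" using U_L[OF fU] v sub_N submodule_L by blast
    define c where "c = h (f v) t / \<rho>"
    have gv: "?g v = f v - scale c t" using vV by (simp add: compose_eq \<psi>(2)[OF fvV] c_def)
    have c0: "c \<in> P 0" unfolding c_def by (rule P_divide[OF Pt[OF fvL] \<rho>]) simp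
    have "?g v - v = (f v - v) - scale c t" by (simp add: gv)
    then have g3: "?g v - v \<in> W"
      using f(3) t W c0 by (metis submodule_diff submodule_scale)
    have "h (f v) t = h v t + \<tau> * h t t" using N0_perp[OF lN] by (simp add: fv)
    moreover have "\<tau> * h t t \<in> P (k + 1)"
      by (rule P_mult[OF True exact_P[OF exact_tt]]) (use d_ge_2 M_def in simp)
    moreover have "exact k (h v t)" using exact_tv exact_h_sym by blast
    ultimately have "exact k (h (f v) t)" using exact_add by fastforce
    then have "exact M c" unfolding c_def by (rule exact_divide[OF _ \<rho>]) (simp add: M_def)
    then have "exact M (\<tau> - c)" by (intro exact_diff'[OF True]) auto
    moreover have "coeff (?g v - v) = \<tau> - c"
      using tv_nonzero by (simp add: gv coeff_def \<tau>_def diff_divide_distrib)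
    ultimately obtain \<phi> where "\<phi> \<in> fixing W" "\<phi> (?g v) = v"
      using transitive_small[OF g1 g2 g3] unfolding M_def by (metis order.refl)
    then show ?thesis
      using fixing_compose[OF _ \<psi>(1)] fvV vV
      by (intro bexI[of _ "compose V \<phi> \<psi>"]) (auto simp: compose_eq)
  qed
qed

end

section \<open>Splitting off a line or a plane\<close>

context hermitian
begin

text \<open>With \<open>x = v\<close> this describes a line, so one reduction step serves lines and
  planes alike.\<close>

definition complemented :: "'v \<Rightarrow> 'v \<Rightarrow> bool" where
  "complemented x v \<longleftrightarrow> (\<forall>z\<in>L. \<exists>a\<in>P 0. \<exists>b\<in>P 0.
     h (z - (scale a x + scale b v)) x = 0 \<and> h (z - (scale a x + scale b v)) v = 0)"

lemma hyperbolic_complemented: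
  assumes "hyperbolic u v k"
  shows "complemented u v"
  unfolding complemented_def
proof
  fix z assume z: "z \<in> L"
  have u: "h u u = 0" "h v v = 0" and c: "exact k (h u v)" "exact k (h v u)"
    and zP: "h z u \<in> P k" "h z v \<in> P k"
    using assms z exact_h_sym by (auto simp: hyperbolic_def)
  have ne: "h u v \<noteq> 0" "h v u \<noteq> 0" using c exact_nonzero by blast+
  have "h z v / h u v \<in> P 0" by (rule P_divide[OF zP(2) c(1)]) simp
  moreover have "h z u / h v u \<in> P 0" by (rule P_divide[OF zP(1) c(2)]) simp
  ultimately show "\<exists>a\<in>P 0. \<exists>b\<in>P 0.
     h (z - (scale a u + scale b v)) u = 0 \<and> h (z - (scale a u + scale b v)) v = 0"
    using u ne by (intro bexI[of _ "h z v / h u v"] bexI[of _ "h z u / h v u"]) auto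
qed

lemma anisotropic_complemented:
  assumes "exact k (h x x)" "\<And>z. z \<in> L \<Longrightarrow> h z x \<in> P k"
  shows "complemented x x"
  unfolding complemented_def
proof
  fix z assume z: "z \<in> L"
  have "h z x / h x x \<in> P 0" by (rule P_divide[OF assms(2)[OF z] assms(1)]) simp
  then show "\<exists>a\<in>P 0. \<exists>b\<in>P 0.
     h (z - (scale a x + scale b x)) x = 0 \<and> h (z - (scale a x + scale b x)) x = 0"
    using exact_nonzero[OF assms(1)]
    by (intro bexI[of _ "h z x / h x x"] bexI[of _ 0]) auto
qed

text \<open>Cramer's rule: the diagonal product lies in \<open>P (2 * k + 2)\<close>, so the Gram
  determinant has valuation exactly \<open>2 * k\<close>.\<close>

lemma plane_complemented:
  assumes xv: "exact k (h x v)" and xx: "h x x \<in> P (k + 1)" and vv: "h v v \<in> P (k + 1)"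
    and Px: "\<And>z. z \<in> L \<Longrightarrow> h z x \<in> P k" and Pv: "\<And>z. z \<in> L \<Longrightarrow> h z v \<in> P k"
  shows "complemented x v"
  unfolding complemented_def
proof
  fix z assume z: "z \<in> L"
  have vx: "exact k (h v x)" using xv exact_h_sym by blast
  define D where "D = h x x * h v v - h x v * h v x"
  have D: "exact (2 * k) D" unfolding D_def
    by (rule exact_diff'[OF P_mult[OF xx vv, of "2 * k + 2"] exact_mult[OF xv vx]]) auto
  have Dne: "D \<noteq> 0" using D exact_nonzero by blast
  define a where "a = (h z x * h v v - h z v * h v x) / D"
  define b where "b = (h x x * h z v - h x v * h z x) / D"
  have "h z x * h v v - h z v * h v x \<in> P (2 * k)"
    by (rule P_diff[OF P_mult[OF Px[OF z] vv] P_mult[OF Pv[OF z] exact_P[OF vx]]]) auto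
  then have a: "a \<in> P 0" unfolding a_def by (rule P_divide[OF _ D]) simp
  have "h x x * h z v - h x v * h z x \<in> P (2 * k)"
    by (rule P_diff[OF P_mult[OF xx Pv[OF z]] P_mult[OF exact_P[OF xv] Px[OF z]]]) auto
  then have b: "b \<in> P 0" unfolding b_def by (rule P_divide[OF _ D]) simp
  have aD: "a * D = h z x * h v v - h z v * h v x" "b * D = h x x * h z v - h x v * h z x"
    using Dne by (simp_all add: a_def b_def)
  have "(a * h x x + b * h v x) * D = (a * D) * h x x + (b * D) * h v x" by (simp add: algebra_simps)
  also have "\<dots> = h z x * D" unfolding aD by (simp add: D_def algebra_simps)
  finally have 1: "a * h x x + b * h v x = h z x" using Dne by simp
  have "(a * h x v + b * h v v) * D = (a * D) * h x v + (b * D) * h v v" by (simp add: algebra_simps)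
  also have "\<dots> = h z v * D" unfolding aD by (simp add: D_def algebra_simps)
  finally have 2: "a * h x v + b * h v v = h z v" using Dne by simp
  show "\<exists>a\<in>P 0. \<exists>b\<in>P 0.
     h (z - (scale a x + scale b v)) x = 0 \<and> h (z - (scale a x + scale b v)) v = 0"
    by (rule bexI[OF _ a], rule bexI[OF _ b]) (simp add: 1 2)
qed

definition reducible :: "('v \<Rightarrow> 'v) \<Rightarrow> 'v set \<Rightarrow> bool" where
  "reducible f N \<longleftrightarrow> (\<exists>\<psi>\<in>fixing N. \<exists>x\<in>N. \<exists>v\<in>N. x \<noteq> 0 \<and> complemented x v \<and>
     \<psi> (f x) = x \<and> \<psi> (f v) = v)"

lemma reducible_hyperbolic:
  assumes N: "splits N" and f: "adapted f N" and uv: "hyperbolic u v k" "u \<in> N" "v \<in> N"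
  shows "reducible f N"
proof -
  have sub: "submodule N" using N splits_submodule by blast
  obtain \<psi>1 where 1: "\<psi>1 \<in> fixing N" "\<psi>1 (f u) = u"
    using hyperbolic_fix_first[OF N f uv] by blast
  have V: "u \<in> V" "v \<in> V" "f u \<in> V" "f v \<in> V"
    using uv sub submodule_V U_V[OF adapted_U[OF f]] by blast+
  have "compose V \<psi>1 f u = u" using 1 V by (simp add: compose_eq)
  then obtain \<psi>2 where 2: "\<psi>2 \<in> fixing N" "\<psi>2 u = u" "\<psi>2 (compose V \<psi>1 f v) = v"
    using hyperbolic_fix_second[OF N adapted_compose[OF 1(1) f] uv] by blast
  have "u \<noteq> 0" using uv(1) by (auto simp: hyperbolic_def exact_def)
  then show ?thesis unfolding reducible_def
    using 1 2 V uv hyperbolic_complemented[OF uv(1)] fixing_compose[OF 2(1) 1(1)]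
    by (intro bexI[of _ "compose V \<psi>2 \<psi>1"] bexI[of _ u] bexI[of _ v]) (auto simp: compose_eq)
qed

text \<open>The step applies with \<open>W = N\<close>, \<open>t = v = x\<close> and
  \<open>k = 2 * i\<close>.\<close>

lemma reducible_anisotropic:
  assumes N: "splits N" and f: "adapted f N"
    and no_hyperbolic: "\<And>u v l. u \<in> N \<Longrightarrow> v \<in> N \<Longrightarrow> \<not> hyperbolic u v l"
    and P: "\<And>x y. x \<in> N \<Longrightarrow> y \<in> N \<Longrightarrow> h x y \<in> P k" and x: "x \<in> N" "exact k (h x x)"
  shows "reducible f N"
proof -
  have sub: "submodule N" using N splits_submodule by blast
  have Px: "h z x \<in> P k" if "z \<in> L" for z using splits_P[OF N x(1) P[OF _ x(1)] that] .
  have "even k" using exact_even[OF x(2)] by simp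
  then obtain i where i: "k = 2 * i" by (elim evenE)
  interpret transitive_step w bar p scale h V L N N x x k i
  proof unfold_locales
    fix z assume z: "z \<in> N"
    define c where "c = h z x / h x x"
    have "h z x / h x x \<in> P 0" by (rule P_divide[OF P[OF z x(1)] x(2)]) simp
    then have "z - scale c x \<in> N" unfolding c_def
      using sub z x by (intro submodule_diff submodule_scale)
    moreover have "h (z - scale c x) x = 0" using exact_nonzero[OF x(2)] by (simp add: c_def)
    moreover have "h z n = h (z - scale c x) n" if "h n x = 0" for n
      using that h_zero_sym[of n x] by simp
    ultimately show "\<exists>z'\<in>N. h z' x = 0 \<and> (\<forall>n\<in>N. h n x = 0 \<longrightarrow> h z n = h z' n)" by blast
  qed (use N sub x i P no_hyperbolic in auto)
  have "f x - x \<in> N" by (rule submodule_diff[OF sub adapted_in[OF N f x(1)] x(1)])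
  then obtain \<psi> where "\<psi> \<in> fixing N" "\<psi> (f x) = x"
    using transitive[OF f adapted_in[OF N f]] d_ge_2 i by auto
  then show ?thesis unfolding reducible_def
    using x exact_nonzero[OF x(2)] anisotropic_complemented[OF x(2) Px]
    by (intro bexI[of _ \<psi>] bexI[of _ x]) auto
qed

lemma reducible_even:
  assumes N: "splits N" and f: "adapted f N"
    and no_hyperbolic: "\<And>u v l. u \<in> N \<Longrightarrow> v \<in> N \<Longrightarrow> \<not> hyperbolic u v l"
    and P: "\<And>x y. x \<in> N \<Longrightarrow> y \<in> N \<Longrightarrow> h x y \<in> P k"
    and even: "\<And>x. x \<in> N \<Longrightarrow> h x x \<in> P (k + 1)"
    and ab: "a0 \<in> N" "b0 \<in> N" "exact k (h a0 b0)"
  shows "reducible f N"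
proof -
  have sub: "submodule N" using N splits_submodule by blast
  have PL: "h z x \<in> P k" if "x \<in> N" "z \<in> L" for x z using splits_P[OF N that(1) P[OF _ that(1)] that(2)] .
  have no_pair: False if "x \<in> N" "y \<in> N" "exact k (h x y)" "h x x \<in> P (k + d)" "h y y \<in> P (k + d - 1)" for x y
    using ex_hyperbolic[OF sub that(1,2,3)] PL that no_hyperbolic by blast
  have "\<exists>c\<in>N. h c c \<notin> P (k + d)"
  proof (rule ccontr)
    assume "\<not> ?thesis"
    then have "h a0 a0 \<in> P (k + d)" "h b0 b0 \<in> P (k + d - 1)"
      using ab P_mono[of "h b0 b0" "k + d" "k + d - 1"] by auto
    then show False using no_pair[OF ab] by blast
  qed
  then obtain c0 where c0: "c0 \<in> N" "h c0 c0 \<notin> P (k + d)" by blast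
  then have c0_ne: "h c0 c0 \<noteq> 0" by auto
  have "(\<lambda>x. h x x) ` N \<subseteq> P (k + 1)" using even by blast
  then obtain q s where q: "(\<lambda>x. h x x) ` N \<subseteq> P q" "s \<in> (\<lambda>x. h x x) ` N" "exact q s"
    using ex_min_valuation[of "h c0 c0" "(\<lambda>x. h x x) ` N" "k + 1"] c0(1) c0_ne by blast
  then obtain x0 where x0: "x0 \<in> N" "exact q (h x0 x0)" by blast
  have "even q" using exact_even[OF x0(2)] by simp
  then obtain i where i: "q = 2 * i" by (elim evenE)
  have nrm: "h x x \<in> P (2 * i)" if "x \<in> N" for x using q(1) that i by blast
  have ki: "k + 1 \<le> 2 * i" using exact_not_P[OF x0(2) even[OF x0(1)]] i by simp
  have "\<not> k + d \<le> q" using c0 nrm[OF c0(1)] i P_mono by blast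
  then have ik: "2 * i \<le> k + d - 1" using i by simp
  \<comment> \<open>If \<open>x0\<close> does not realize the scale and \<open>a0\<close> does not
    realize the norm, their sum does both; the cross trace is negligible.\<close>
  have "\<exists>x\<in>N. \<exists>y\<in>N. exact (2 * i) (h x x) \<and> exact k (h x y)"
  proof (cases "(\<exists>y\<in>N. exact k (h x0 y)) \<or> exact (2 * i) (h a0 a0)")
    case True
    then show ?thesis using x0 ab i by blast
  next
    case False
    have x0P: "h x0 y \<in> P (k + 1)" if "y \<in> N" for y
      using False P[OF x0(1) that] that by (auto simp: exact_iff)
    have "h a0 a0 \<in> P (2 * i + 1)" using False nrm[OF ab(1)] by (auto simp: exact_iff)
    moreover have "Tr (h x0 a0) \<in> P (2 * i + 1)" by (rule trace_P[OF x0P[OF ab(1)]]) (use ik in simp)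
    ultimately have s: "h a0 a0 + Tr (h x0 a0) \<in> P (2 * i + 1)" by (rule P_add)
    have hn: "h (x0 + a0) (x0 + a0) = h x0 x0 + (h a0 a0 + Tr (h x0 a0))"
      by (simp add: trace_def add_ac)
    have "exact (2 * i) (h (x0 + a0) (x0 + a0))"
      unfolding hn by (rule exact_add[OF _ s]) (use x0(2) i in auto)
    moreover have "exact k (h (x0 + a0) b0)"
      unfolding h_add by (rule exact_add'[OF x0P[OF ab(2)] ab(3)]) simp
    ultimately show ?thesis using submodule_add[OF sub x0(1) ab(1)] ab(2) by blast
  qed
  then obtain x v where x: "x \<in> N" "exact (2 * i) (h x x)" and v: "v \<in> N" "exact k (h x v)" by blast
  have xL: "x \<in> L" "x \<in> V" "v \<in> L" "v \<in> V" using x v sub submodule_L submodule_V by blast+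
  have vx: "exact k (h v x)" using v exact_h_sym by blast
  have fU: "f \<in> U" using f adapted_U by blast
  define y where "y = f x"
  have y: "y \<in> N" unfolding y_def by (rule adapted_in[OF N f x(1)])
  have yL: "y \<in> L" "y \<in> V" using y sub submodule_L submodule_V by blast+
  have hyy: "h x x = h y y" unfolding y_def using U_h[OF fU xL(2,2)] by simp
  have move_x: "\<exists>\<psi>\<in>fixing N. \<psi> z = x" if z: "z \<in> N" "h x x = h z z" "exact k (h x z)" for z
  proof -
    have "exact k (h x (x - z))"
      unfolding h_diff_right by (rule exact_diff'[OF exact_P[OF x(2)] z(3)]) (use ki in simp)
    moreover have "x - z \<in> N" by (rule submodule_diff[OF sub x(1) z(1)])
    ultimately show ?thesis
      using move[OF xL(1) submodule_L[OF sub z(1)] _ z(2)] PL by blast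
  qed
  have fix_x: "\<exists>\<psi>\<in>fixing N. \<psi> y = x"
  proof (cases "exact k (h x y)")
    case True
    then show ?thesis using move_x[OF y hyy] by blast
  next
    case False
    then have xy: "h x y \<in> P (k + 1)" using P[OF x(1) y] by (simp add: exact_iff)
    \<comment> \<open>The symmetry along a good \<open>r\<close> with parameter of valuation
      \<open>k\<close> sends \<open>y\<close> to a vector whose product with \<open>x\<close> has
      valuation \<open>k\<close>. As \<open>x\<close> pairs with \<open>x\<close> and
      \<open>y\<close> into \<open>P (k + 1)\<close>, adding multiples of \<open>x\<close> keeps
      \<open>r\<close> good and allows its norm to be adjusted.\<close>
    define good where "good r \<longleftrightarrow> r \<in> N \<and> exact k (h r x) \<and> exact k (h r y)" for r
    have good_add: "good (r + scale c x)" if "good r" "c \<in> P 0" for r c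
    proof -
      have "c * h x x \<in> P (k + 1)" by (rule P_mult[OF that(2) exact_P[OF x(2)]]) (use ki in simp)
      moreover have "c * h x y \<in> P (k + 1)" by (rule P_mult[OF that(2) xy]) simp
      moreover have "r + scale c x \<in> N"
        using that x sub unfolding good_def by (intro submodule_add submodule_scale) auto
      ultimately show ?thesis using that(1) exact_add unfolding good_def by auto
    qed
    have good_norm: "h (r + scale c x) (r + scale c x) = h r r + c * bar c * h x x + Tr (bar c * h r x)" for r c
      by (simp add: trace_def algebra_simps)
    have fv: "f v \<in> N" "exact k (h (f v) y)"
      using adapted_in[OF N f v(1)] U_h[OF fU xL(4,2)] vx by (simp_all add: y_def)
    \<comment> \<open>\<open>v\<close> has the right product with \<open>x\<close>, and
      \<open>f v\<close> with \<open>y\<close>; if neither serves both, the sum does.\<close>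
    have "\<exists>r. good r"
    proof (cases "exact k (h v y) \<or> exact k (h (f v) x)")
      case True
      then show ?thesis using v vx fv unfolding good_def by blast
    next
      case False
      then have "h v y \<in> P (k + 1)" "h (f v) x \<in> P (k + 1)"
        using P[OF v(1) y] P[OF fv(1) x(1)] by (auto simp: exact_iff)
      then have "good (v + f v)"
        using exact_add[OF vx] exact_add'[OF _ fv(2)] submodule_add[OF sub v(1) fv(1)]
        unfolding good_def by auto
      then show ?thesis by blast
    qed
    then obtain r0 where r0: "good r0" by blast
    \<comment> \<open>The norm must be a trace from valuation \<open>k\<close>. If
      \<open>2 * i = k + d - 1\<close> it is, since a smaller norm would give a hyperbolic pair with
      \<open>x\<close>. Otherwise a multiple of \<open>x\<close> makes the norm small and, if parity
      demands, a second one sets its valuation to \<open>k + d - 1\<close>.\<close>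
    have "\<exists>r. good r \<and> h r r \<in> P (k + d - 1) \<and> (odd (k - d) \<longrightarrow> exact (k + d - 1) (h r r))"
    proof (cases "2 * i = k + d - 1")
      case True
      have r0N: "r0 \<in> N" "exact k (h r0 x)" using r0 by (auto simp: good_def)
      have n: "h r0 r0 \<in> P (k + d - 1)" using nrm[OF r0N(1)] True by simp
      have "h r0 r0 \<notin> P (k + d)"
        using no_pair[OF r0N(1) x(1) r0N(2)] exact_P[OF x(2)] True by auto
      then have "exact (k + d - 1) (h r0 r0)" using n by (simp add: exact_iff)
      then show ?thesis using r0 n by blast
    next
      case False
      have r0N: "r0 \<in> N" "exact k (h r0 x)" using r0 by (auto simp: good_def)
      define T where "T = - h r0 r0 / h x x"
      have "- h r0 r0 \<in> P (2 * i)" using nrm[OF r0N(1)] by simp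
      then have T: "T \<in> P (2 * 0)" unfolding T_def by (rule P_divide[OF _ x(2)]) simp
      have "bar T = T" by (simp add: T_def)
      from norm_approx_P[OF this T]
      obtain c where c: "c \<in> P 0" "c * bar c - T \<in> P (2 * 0 + 2 * (d - 1))" by blast
      define r1 where "r1 = r0 + scale c x"
      have r1: "good r1" unfolding r1_def by (rule good_add[OF r0 c(1)])
      have Txx: "T * h x x = - h r0 r0" using exact_nonzero[OF x(2)] by (simp add: T_def)
      have "h r1 r1 = (c * bar c - T) * h x x + Tr (bar c * h r0 x)"
        unfolding r1_def good_norm left_diff_distrib Txx by simp
      moreover have "(c * bar c - T) * h x x \<in> P (k + d - 1)"
        by (rule P_mult[OF c(2) exact_P[OF x(2)]]) (use ki d_ge_2 in simp)
      moreover have "Tr (bar c * h r0 x) \<in> P (k + d - 1)"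
        by (rule trace_P[OF P_mult[of _ 0, OF _ exact_P[OF r0N(2)], of _ k]]) (use c(1) in auto)
      ultimately have n1: "h r1 r1 \<in> P (k + d - 1)" by (simp add: P_add)
      show ?thesis
      proof (cases "odd (k - d) \<and> \<not> exact (k + d - 1) (h r1 r1)")
        case False
        then show ?thesis using r1 n1 by blast
      next
        case True
        then have n1': "h r1 r1 \<in> P (k + d)" using n1 by (simp add: exact_iff)
        have "odd (k - d)" using True by blast
        then have "even (k + d - 1 - 2 * i)" by presburger
        then obtain j where j: "k + d - 1 - 2 * i = 2 * j" by (elim evenE)
        have j1: "j \<ge> 1" using j ik \<open>2 * i \<noteq> k + d - 1\<close> by presburger
        obtain c2 where c2: "exact j c2" using ex_exact by blast
        define r2 where "r2 = r1 + scale c2 x"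
        have "c2 \<in> P 0" using exact_P_mono[OF c2] j1 by simp
        then have r2: "good r2" unfolding r2_def by (rule good_add[OF r1])
        have r1x: "exact k (h r1 x)" using r1 by (simp add: good_def)
        have e1: "exact (k + d - 1) (c2 * bar c2 * h x x)"
          by (rule exact_mult[OF exact_norm[OF c2] x(2)]) (use j in simp)
        have "bar c2 * h r1 x \<in> P (j + k)"
          using exact_P[of j "bar c2"] c2 by (intro P_mult[OF _ exact_P[OF r1x]]) auto
        then have "Tr (bar c2 * h r1 x) \<in> P (k + d)" by (rule trace_P) (use j1 in simp)
        then have "exact (k + d - 1) (h r2 r2)"
          unfolding r2_def good_norm by (intro exact_add[OF exact_add'[OF n1' e1]]) auto
        then show ?thesis using r2 exact_P by blast
      qed
    qed
    then obtain r where r: "r \<in> N" "exact k (h r x)" "exact k (h r y)"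
      and rr: "h r r \<in> P (k + d - 1)" "odd (k - d) \<Longrightarrow> exact (k + d - 1) (h r r)"
      unfolding good_def by blast
    obtain \<rho> where \<rho>: "exact k \<rho>" "h r r = Tr \<rho>" using ex_trace_exact[OF _ rr] by auto
    have rL: "r \<in> L" using r sub submodule_L by blast
    obtain \<psi> where \<psi>: "\<psi> \<in> fixing N" "\<And>z. z \<in> V \<Longrightarrow> \<psi> z = z - scale (h z r / \<rho>) r"
      using symmetry_fixing[OF rL r(1) \<rho> PL[OF r(1)]] by blast
    define y2 where "y2 = \<psi> y"
    have y2: "y2 = y - scale (h y r / \<rho>) r" unfolding y2_def by (rule \<psi>(2)[OF yL(2)])
    have c: "exact 0 (h y r / \<rho>)" by (rule exact_divide[OF _ \<rho>(1)]) (use r(3) exact_h_sym in auto)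
    have cb: "exact 0 (bar (h y r / \<rho>))" using c by (simp only: exact_bar)
    have xr: "exact k (h x r)" using r(2) exact_h_sym by blast
    have "exact k (bar (h y r / \<rho>) * h x r)" by (rule exact_mult[OF cb xr]) simp
    then have "exact k (h x y2)"
      unfolding y2 h_diff_right h_scale_right by (intro exact_diff'[OF xy]) auto
    moreover have "h x x = h y2 y2"
      unfolding y2_def hyy using U_h[OF fixing_U[OF \<psi>(1)] yL(2,2)] by simp
    moreover have "y2 \<in> N"
      unfolding y2 using sub y r(1) exact_P[OF c] by (intro submodule_diff submodule_scale)
    ultimately obtain \<phi> where "\<phi> \<in> fixing N" "\<phi> y2 = x" using move_x by blast
    then show ?thesis
      using fixing_compose[OF _ \<psi>(1)] yL y2_def
      by (intro bexI[of _ "compose V \<phi> \<psi>"]) (auto simp: compose_eq)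
  qed
  then obtain \<psi>1 where \<psi>1: "\<psi>1 \<in> fixing N" "\<psi>1 y = x" by blast
  define g where "g = compose V \<psi>1 f"
  have g: "adapted g N" unfolding g_def by (rule adapted_compose[OF \<psi>1(1) f])
  have gU: "g \<in> U" using g adapted_U by blast
  have gx: "g x = x" using \<psi>1 xL by (simp add: g_def compose_eq y_def)
  have compl: "complemented x v"
    by (rule plane_complemented[OF v(2) even[OF x(1)] even[OF v(1)] PL[OF x(1)] PL[OF v(1)]])
  \<comment> \<open>Chosen to make \<open>t\<close> orthogonal to \<open>x\<close>; as
    \<open>h t t\<close> still has valuation \<open>2 * i\<close>, \<open>t\<close> replaces
    \<open>x\<close> inside the complement \<open>W\<close>.\<close>
  define c where "c = - h x x / h v x"
  define t where "t = x + scale c v"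
  define W where "W = {z \<in> N. h z x = 0}"
  have c: "exact (2 * i - k) c" unfolding c_def by (rule exact_divide[OF _ vx]) (use x(2) in auto)
  have c0: "c \<in> P 0" by (rule exact_P_mono[OF c]) (use ki in simp)
  have vx_ne: "h v x \<noteq> 0" using vx exact_nonzero by blast
  have tx: "h t x = 0" using vx_ne by (simp add: t_def c_def)
  then have xt: "h x t = 0" using h_zero_sym by blast
  have tN: "t \<in> N" unfolding t_def using sub x v c0 by (intro submodule_add submodule_scale)
  have "c * h v v \<in> P (k + 1)" by (rule P_mult[OF c0 even[OF v(1)]]) simp
  then have tv: "exact k (h t v)" using exact_add[OF v(2)] by (simp add: t_def)
  have "h t t = h t x + bar c * h t v" by (subst (2) t_def) simp
  then have tt: "exact (2 * i) (h t t)"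
    using exact_mult[of "2 * i - k" "bar c" k "h t v"] c tv tx by simp
  interpret transitive_step w bar p scale h V L N W t v k i
  proof unfold_locales
    show "submodule W" using sub by (auto simp: W_def submodule_def)
    show "h z t = 0" if "z \<in> W" "h z v = 0" for z using that by (simp add: W_def t_def)
    fix z assume z: "z \<in> N"
    then obtain a b where ab: "a \<in> P 0" "b \<in> P 0" "h (z - (scale a x + scale b v)) x = 0"
      "h (z - (scale a x + scale b v)) v = 0"
      using compl submodule_L[OF sub] unfolding complemented_def by blast
    have "z - (scale a x + scale b v) \<in> N"
      using sub z x v ab by (intro submodule_diff submodule_add submodule_scale)
    moreover have "h z n = h (z - (scale a x + scale b v)) n" if "n \<in> W" "h n v = 0" for n
      using that h_zero_sym[of n x] h_zero_sym[of n v] by (simp add: W_def)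
    ultimately show "\<exists>z'\<in>W. h z' v = 0 \<and> (\<forall>n\<in>W. h n v = 0 \<longrightarrow> h z n = h z' n)"
      using ab by (intro bexI[of _ "z - (scale a x + scale b v)"]) (auto simp: W_def)
  qed (use N tN tx v tv tt ki P nrm no_hyperbolic in \<open>auto simp: W_def\<close>)
  have gW: "g z \<in> W" if z: "z \<in> W" for z
  proof -
    have "g z \<in> N" "z \<in> V" using z adapted_in[OF N g] sub submodule_V by (auto simp: W_def)
    moreover have "h (g z) x = h z x" using U_h[OF gU \<open>z \<in> V\<close> xL(2)] gx by simp
    ultimately show ?thesis using z by (simp add: W_def)
  qed
  have "h (g v) x = h v x" using U_h[OF gU xL(4,2)] gx by simp
  then have gv: "g v - v \<in> W"
    using adapted_in[OF N g v(1)] v(1) submodule_diff[OF sub] by (simp add: W_def)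
  obtain \<psi>2 where \<psi>2: "\<psi>2 \<in> fixing W" "\<psi>2 (g v) = v" using transitive[OF g gW gv ik] by blast
  have "h x s = 0" if "s \<in> W" for s using that h_zero_sym[of s x] by (simp add: W_def)
  then have \<psi>2x: "\<psi>2 x = x" by (rule fixing_fixed[OF \<psi>2(1) xL(2)])
  have "\<psi>2 \<in> fixing N" by (rule fixing_mono[OF \<psi>2(1) W_N])
  from fixing_compose[OF this \<psi>1(1)] have "compose V \<psi>2 \<psi>1 \<in> fixing N" .
  moreover have "compose V \<psi>2 \<psi>1 (f x) = x" using \<psi>1 \<psi>2x yL by (simp add: compose_eq y_def)
  moreover have "compose V \<psi>2 \<psi>1 (f v) = v"
    using \<psi>2 xL U_V[OF fU xL(4)] by (simp add: g_def compose_eq)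
  moreover have "x \<noteq> 0" using exact_nonzero[OF x(2)] by auto
  ultimately show ?thesis unfolding reducible_def using compl x(1) v(1) by blast
qed

lemma reducible:
  assumes N: "splits N" and f: "adapted f N" and z: "z \<in> N" "z \<noteq> 0"
  shows "reducible f N"
proof (cases "\<exists>u\<in>N. \<exists>v\<in>N. \<exists>k. hyperbolic u v k")
  case True
  then show ?thesis using reducible_hyperbolic[OF N f] by blast
next
  case False
  obtain y where y: "y \<in> N" "h z y \<noteq> 0" using splits_nondegenerate[OF N z(1)] z(2) by blast
  obtain k a b where k: "\<And>x y. x \<in> N \<Longrightarrow> y \<in> N \<Longrightarrow> h x y \<in> P k"
    and ab: "a \<in> N" "b \<in> N" "exact k (h a b)"
    using ex_scale[OF splits_submodule[OF N] z(1) y] by metis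
  show ?thesis
  proof (cases "\<exists>x\<in>N. exact k (h x x)")
    case True
    then show ?thesis using reducible_anisotropic[OF N f _ k] False by blast
  next
    case no_exact: False
    then have "h x x \<in> P (k + 1)" if "x \<in> N" for x using k[OF that that] that by (auto simp: exact_iff)
    then show ?thesis using reducible_even[OF N f _ k _ ab] False by blast
  qed
qed

subsection \<open>Generation\<close>

lemma subspace_orthogonal: "subspace {z. \<forall>y\<in>N. h z y = 0}"
  by (rule subspaceI) auto

text \<open>Progress is measured by an independent set \<open>S\<close> orthogonal to
  \<open>N\<close> rather than by a rank of \<open>N\<close>. A vector of \<open>N\<close> in the
  span of \<open>S\<close> is orthogonal to \<open>N\<close>, hence zero; so each nonzero
  \<open>x\<close> split off enlarges \<open>S\<close>, whose size is bounded by that of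
  \<open>B\<close>.\<close>

lemma ex_fixing_lattice:
  assumes "splits N" "adapted f N" "finite B" "V = span B"
    and "independent S" "S \<subseteq> {z \<in> L. \<forall>y\<in>N. h z y = 0}"
  shows "\<exists>\<psi>\<in>X. \<forall>z\<in>L. \<psi> (f z) = z"
  using assms
proof (induction "card B - card S" arbitrary: N f S rule: less_induct)
  case less
  note N = less.prems(1) and f = less.prems(2)
  have sub: "submodule N" using N splits_submodule by blast
  show ?case
  proof (cases "\<exists>z\<in>N. z \<noteq> 0")
    case False
    then have "f z = z" if "z \<in> L" for z using f that by (force simp: adapted_def)
    then show ?thesis using X_identity L_V by (intro bexI[of _ "\<lambda>x\<in>V. x"]) auto
  next
    case True
    then obtain \<psi> x v where \<psi>: "\<psi> \<in> fixing N" and xv: "x \<in> N" "v \<in> N" "x \<noteq> 0" "complemented x v"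
      "\<psi> (f x) = x" "\<psi> (f v) = v"
      using reducible[OF N f] unfolding reducible_def by blast
    have xV: "x \<in> V" "v \<in> V" using xv sub submodule_V by blast+
    let ?g = "compose V \<psi> f" and ?N = "{z \<in> N. h z x = 0 \<and> h z v = 0}"
    have g: "adapted ?g N" by (rule adapted_compose[OF \<psi> f])
    have gxv: "?g x = x" "?g v = v" using xv xV by (simp_all add: compose_eq)
    have N1: "splits ?N" "adapted ?g ?N"
      using splits_reduce[OF N xv(1,2) _ g gxv] xv(4) unfolding complemented_def by blast+
    have "x \<notin> span S"
    proof
      assume "x \<in> span S"
      moreover have "span S \<subseteq> {z. \<forall>y\<in>N. h z y = 0}"
        by (rule span_minimal[OF _ subspace_orthogonal]) (use less.prems(6) in auto)
      ultimately have "x = 0" using splits_nondegenerate[OF N xv(1)] by blast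
      then show False using xv(3) by simp
    qed
    then have ind: "independent (insert x S)" and new: "x \<notin> S"
      using independent_insertI less.prems(5) span_base by blast+
    have S1: "insert x S \<subseteq> {z \<in> L. \<forall>y\<in>?N. h z y = 0}"
      using less.prems(6) submodule_L[OF sub xv(1)] by (auto simp: h_zero_sym[of x])
    then have in_span: "insert x S \<subseteq> span B" using L_V less.prems(4) by blast
    have fin: "finite (insert x S)" "card (insert x S) \<le> card B"
      using independent_span_bound[OF less.prems(3) ind in_span] by simp_all
    then have "card B - card (insert x S) < card B - card S" using new by simp
    then obtain \<phi> where \<phi>: "\<phi> \<in> X" "\<forall>z\<in>L. \<phi> (?g z) = z"
      using less.hyps[OF _ N1 less.prems(3,4) ind S1] by blast
    have "compose V \<phi> \<psi> (f z) = z" if "z \<in> L" for z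
      using bspec[OF \<phi>(2) that] L_V[OF that] U_V[OF adapted_U[OF f]] by (simp add: compose_eq)
    then show ?thesis using X_compose[OF \<phi>(1) fixing_X[OF \<psi>]] by blast
  qed
qed

text \<open>Polarization with the vectors \<open>scale c x + y\<close> gives
  \<open>c * h x (y - f y) + bar c * h y (x - f x) = 0\<close>. Taking \<open>c\<close> to be 1 and
  \<open>p\<close> separates the terms, as \<open>p\<close> is not fixed.\<close>

lemma isometry_trivial:
  assumes f: "f \<in> U" and zero: "\<And>x. x \<in> V \<Longrightarrow> h x (x - f x) = 0" and y: "y \<in> V"
  shows "f y = y"
proof -
  have "h x (y - f y) = 0" if x: "x \<in> V" for x
  proof -
    have eq: "c * h x (y - f y) + bar c * h y (x - f x) = 0" for c
    proof -
      define a where "a = x - f x"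
      define b where "b = y - f y"
      have "f (scale c x + y) = scale c (f x) + f y" using x y by (simp add: U_add[OF f] U_scale[OF f])
      then have "scale c x + y - f (scale c x + y) = scale c a + b"
        by (simp add: a_def b_def scale_right_diff_distrib)
      then have "h (scale c x + y) (scale c a + b) = 0" using zero[of "scale c x + y"] x y by simp
      moreover have "h x a = 0" "h y b = 0" unfolding a_def b_def by (rule zero[OF x], rule zero[OF y])
      ultimately have "c * h x b + bar c * h y a = 0" by (simp add: algebra_simps)
      then show ?thesis by (simp only: a_def b_def)
    qed
    have "(p - bar p) * h x (y - f y) = (p * h x (y - f y) + bar p * h y (x - f x))
        - bar p * (1 * h x (y - f y) + bar 1 * h y (x - f x))"
      by (simp only: bar_one) (simp add: algebra_simps)
    also have "\<dots> = 0" by (simp only: eq)  simp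
    finally show ?thesis using exact_nonzero[OF exact_d] by simp
  qed
  then have "h (y - f y) x = 0" if "x \<in> V" for x using that h_zero_sym by blast
  then have "y - f y = 0" by (rule V_nondegenerate[rotated]) (use y U_V[OF f y] in simp_all)
  then show ?thesis by simp
qed

text \<open>The vector \<open>s = x - f x\<close> is orthogonal to all vectors fixed by
  \<open>f\<close>, in particular to \<open>L\<close>. So the symmetry returning \<open>f x\<close>
  to \<open>x\<close> is trivial on \<open>L\<close>, hence integral, and it adds \<open>x\<close>
  to the fixed vectors.\<close>

lemma fixing_L_in_X:
  assumes "f \<in> U" "\<And>z. z \<in> L \<Longrightarrow> f z = z" "finite B" "V = span B"
    and "independent S" "S \<subseteq> {z \<in> V. f z = z}"
  shows "f \<in> X"
  using assms
proof (induction "card B - card S" arbitrary: f S rule: less_induct)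
  case less
  note f = less.prems(1)
  show ?case
  proof (cases "\<forall>x\<in>V. h x (x - f x) = 0")
    case True
    then have "f x = x" if "x \<in> V" for x using isometry_trivial[OF f _ that] by blast
    moreover have "f x = undefined" if "x \<notin> V" for x
      using U_carrier[OF f] extensional_arb[of f V x] that by (simp add: carrier_BijGroup)
    ultimately have "f = (\<lambda>x\<in>V. x)" by (auto simp: fun_eq_iff)
    then show ?thesis using X_identity by simp
  next
    case False
    then obtain x where x: "x \<in> V" "h x (x - f x) \<noteq> 0" by blast
    define s where "s = x - f x"
    define \<sigma> where "\<sigma> = bar (h x s)"
    have fxV: "f x \<in> V" by (rule U_V[OF f x(1)])
    have sV: "s \<in> V" using x fxV by (simp add: s_def)
    have hxx: "h (f x) (f x) = h x x" by (rule U_h[OF f x(1,1)])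
    have \<sigma>: "\<sigma> \<noteq> 0" using x(2) by (simp only: \<sigma>_def s_def bar_eq_zero) simp
    have tr: "h s s = Tr \<sigma>" using hxx by (simp add: \<sigma>_def s_def trace_def)
    have perp: "h z s = 0" if "z \<in> V" "f z = z" for z
      using U_h[OF f that(1) x(1)] that(2) by (simp add: s_def)
    have "scale (h z s / c) s \<in> L" if "z \<in> L" for z c
      using perp[OF L_V[OF that] less.prems(2)[OF that]] L_zero by simp
    then have S: "hermitian_symmetry scale h V s \<sigma> \<in> X"
      by (intro symmetry_in_X[OF sV \<sigma> tr]) auto
    define \<psi> where "\<psi> = hermitian_symmetry scale h V s \<sigma>"
    have \<psi>: "\<psi> z = z - scale (h z s / \<sigma>) s" if "z \<in> V" for z
      using that by (simp add: \<psi>_def hermitian_symmetry_def divide_inverse)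
    have "h (f x) s = - \<sigma>" using hxx by (simp add: s_def \<sigma>_def)
    then have "h (f x) s / \<sigma> = - 1" using \<sigma> by simp
    then have \<psi>fx: "\<psi> (f x) = x" using \<psi>[OF fxV] by (simp add: s_def)
    let ?g = "compose V \<psi> f"
    have gU: "?g \<in> U" using U_compose X_U S f by (simp add: \<psi>_def)
    have gfix: "?g z = z" if "z \<in> V" "f z = z" for z
      using that \<psi> perp[OF that] by (simp add: compose_eq)
    have gL: "?g z = z" if "z \<in> L" for z using gfix L_V that less.prems(2) by blast
    have "subspace {z \<in> V. f z = z}"
      by (rule subspaceI) (auto simp: U_add[OF f] U_scale[OF f] intro: less.prems(2)[OF L_zero])
    then have "span S \<subseteq> {z \<in> V. f z = z}" using less.prems(6) span_minimal by blast
    moreover have "f x \<noteq> x" using x(2) by auto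
    ultimately have "x \<notin> span S" by blast
    then have ind: "independent (insert x S)" and new: "x \<notin> S"
      using independent_insertI less.prems(5) span_base by blast+
    have S1: "insert x S \<subseteq> {z \<in> V. ?g z = z}"
      using less.prems(6) gfix x \<psi>fx by (auto simp: compose_eq)
    then have in_span: "insert x S \<subseteq> span B" using less.prems(4) by blast
    have fin: "finite (insert x S)" "card (insert x S) \<le> card B"
      using independent_span_bound[OF less.prems(3) ind in_span] by simp_all
    then have "card B - card (insert x S) < card B - card S" using new by simp
    then have "?g \<in> X" using less.hyps[OF _ gU gL less.prems(3,4) ind S1] by blast
    then show ?thesis using X_cancel[OF f S] by (simp add: \<psi>_def)
  qed
qed

lemma U_eq_X: "U = X"
proof
  show "X \<subseteq> U" by (rule X_subset_U)
  show "U \<subseteq> X"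
  proof
    fix f assume f: "f \<in> U"
    obtain B where B: "finite B" "V = span B" using V_finite by blast
    have "f z = z" if "z \<in> L" "\<forall>y\<in>L. h z y = 0" for z
      using L_nondegenerate that U_scale[OF f V_zero, of 0] by auto
    then have "adapted f L" using f by (simp add: adapted_def)
    then obtain \<psi> where \<psi>: "\<psi> \<in> X" "\<forall>z\<in>L. \<psi> (f z) = z"
      using ex_fixing_lattice[OF splits_L _ B independent_empty] by blast
    have "compose V \<psi> f \<in> U" using U_compose X_U[OF \<psi>(1)] f by blast
    moreover have "compose V \<psi> f z = z" if "z \<in> L" for z
      using \<psi>(2) that L_V[OF that] by (simp add: compose_eq)
    ultimately have "compose V \<psi> f \<in> X"
      using fixing_L_in_X[OF _ _ B independent_empty] by blast
    then show "f \<in> X" by (rule X_cancel[OF f \<psi>(1)])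
  qed
qed

end

section \<open>The generation theorem\<close>

text \<open>Composed with this projection, a form constrained only on \<open>V\<close> becomes
  sesquilinear on the whole type.\<close>

lemma (in vector_space) ex_projection_onto_span:
  "\<exists>g. (\<forall>x y. g (x + y) = g x + g y) \<and> (\<forall>c x. g (scale c x) = scale c (g x)) \<and>
    (\<forall>x. g x \<in> span S) \<and> (\<forall>x\<in>span S. g x = x)"
proof -
  interpret vector_space_pair scale scale ..
  obtain B where B: "B \<subseteq> S" "independent B" "S \<subseteq> span B"
    using maximal_independent_subset[of S] by blast
  have span: "span B = span S"
    by (rule subset_antisym[OF span_mono[OF B(1)] span_minimal[OF B(3) subspace_span]])
  obtain g where g: "Vector_Spaces.linear scale scale g" "\<forall>x\<in>B. g x = x" "range g = span B"
    using linear_independent_extend_subspace[OF B(2), of "\<lambda>x. x"] by auto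
  have "Vector_Spaces.linear scale scale (\<lambda>x. x)" by (rule linear_ident)
  then have id: "g x = x" if "x \<in> span S" for x
    using linear_eq_on[OF g(1) _ _ , of "\<lambda>x. x" x B] g(2) that span by blast
  show ?thesis
    using id g(3) span linear_add[OF g(1)] linear_scale[OF g(1)] by blast
qed

section \<open>Independence of the values of the form outside \<open>V\<close>\<close>

lemma lattice_unitary_group_cong:
  assumes "\<And>x y. x \<in> V \<Longrightarrow> y \<in> V \<Longrightarrow> h x y = h' x y"
  shows "lattice_unitary_group scale h V L = lattice_unitary_group scale h' V L"
proof -
  have "f x \<in> V" if "f \<in> carrier (BijGroup V)" "x \<in> V" for f x
    using that by (auto simp: BijGroup_def Bij_def bij_betw_def)
  then show ?thesis
    using assms by (auto simp: lattice_unitary_group_def unitary_group_def)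
qed

lemma symmetries_cong:
  assumes "\<And>x y. x \<in> V \<Longrightarrow> y \<in> V \<Longrightarrow> h x y = h' x y"
  shows "symmetries bar scale h V = symmetries bar scale h' V"
proof -
  have "hermitian_symmetry scale h V s \<sigma> = hermitian_symmetry scale h' V s \<sigma>" if "s \<in> V" for s \<sigma>
    using assms that by (auto simp: hermitian_symmetry_def intro!: restrict_ext)
  then show ?thesis using assms unfolding symmetries_def by (metis (no_types, lifting))
qed

lemma eichler_cong:
  assumes "\<And>x y. x \<in> V \<Longrightarrow> y \<in> V \<Longrightarrow> h x y = h' x y" "u \<in> V" "v \<in> V" "y \<in> V"
  shows "eichler scale h V u v y \<mu> = eichler scale h' V u v y \<mu>"
  using assms by (auto simp: eichler_def intro!: restrict_ext)

lemma (in vector_space) X_group_cong: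
  assumes eq: "\<And>x y. x \<in> V \<Longrightarrow> y \<in> V \<Longrightarrow> h x y = h' x y"
    and V: "subspace V" and L: "L \<subseteq> V"
  shows "X_group R bar scale h V L = X_group R bar scale h' V L"
proof -
  have plane: "plane R scale u v \<subseteq> V" if "u \<in> V" "v \<in> V" for u v
    using that V by (auto simp: plane_def subspace_add subspace_scale)
  have perp: "perp_in h L (plane R scale u v) = perp_in h' L (plane R scale u v)" if "u \<in> V" "v \<in> V" for u v
    using plane[OF that] eq L unfolding perp_in_def by (metis (no_types, lifting) subset_iff)
  have split: "splitting_hyperbolic_pair R scale h L u v \<longleftrightarrow> splitting_hyperbolic_pair R scale h' L u v" for u v
  proof (cases "u \<in> L \<and> v \<in> L")
    case True
    then have "u \<in> V" "v \<in> V" using L by auto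
    then show ?thesis unfolding splitting_hyperbolic_pair_def by (simp add: perp eq)
  qed (auto simp: splitting_hyperbolic_pair_def)
  have "eichler_isometries R bar scale h V L = eichler_isometries R bar scale h' V L"
  proof -
    have "splitting_hyperbolic_pair R scale h L u v \<and> y \<in> perp_in h L (plane R scale u v) \<and>
        (\<forall>x\<in>L. h x y \<in> {h u v * a | a. a \<in> R}) \<and> \<mu> \<in> R \<and> trace bar (\<mu> * h u v) = - h y y
        \<and> f = eichler scale h V u v y \<mu>
      \<longleftrightarrow> splitting_hyperbolic_pair R scale h' L u v \<and> y \<in> perp_in h' L (plane R scale u v) \<and>
        (\<forall>x\<in>L. h' x y \<in> {h' u v * a | a. a \<in> R}) \<and> \<mu> \<in> R \<and> trace bar (\<mu> * h' u v) = - h' y y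
        \<and> f = eichler scale h' V u v y \<mu>" for u v y \<mu> f
    proof (cases "u \<in> L \<and> v \<in> L \<and> y \<in> L")
      case True
      then have uvy: "u \<in> V" "v \<in> V" "y \<in> V" using L by auto
      have "h x y = h' x y" if "x \<in> L" for x using that L uvy eq by blast
      then show ?thesis
        using eichler_cong[OF eq uvy] by (simp add: split perp eq uvy)
    qed (auto simp: splitting_hyperbolic_pair_def perp_in_def)
    then show ?thesis unfolding eichler_isometries_def by blast
  qed
  moreover have "symmetry_group bar scale h V L = symmetry_group bar scale h' V L"
    unfolding symmetry_group_def
    using symmetries_cong[of V h h'] lattice_unitary_group_cong[of V h h'] eq by metis
  ultimately show ?thesis by (simp add: X_group_def)
qed

theorem theorem5p22:
  fixes val :: "'k::field_char_0 \<Rightarrow> int"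
    and emb :: "'k \<Rightarrow> 'e::field_char_0"
    and bar :: "'e \<Rightarrow> 'e"
    and scale :: "'e \<Rightarrow> 'v \<Rightarrow> 'v::ab_group_add"
    and h :: "'v \<Rightarrow> 'v \<Rightarrow> 'e"
    and V L :: "'v set"
  assumes "nonarch_local_field val" and "dyadic val"
    and "quadratic_extension emb" and "ramified val emb"
    and "nontrivial_automorphism emb bar"
    and "hermitian_space bar scale h V" and "nondegenerate h V"
    and "hermitian_lattice (integers val emb) scale V L" and "nondegenerate h L"
  shows "lattice_unitary_group scale h V L = X_group (integers val emb) bar scale h V L"
proof -
  interpret D: dyadic_ramified_extension val emb bar
    using assms(1-5) by unfold_locales
  obtain p where p: "ramified_dyadic D.w bar p" using D.ex_ramified_dyadic by blast
  interpret F: ramified_dyadic D.w bar p by (rule p)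
  interpret vector_space scale using assms(6) by (simp add: hermitian_space_def)
  obtain B where B: "finite B" "V = span B" using assms(6) by (auto simp: hermitian_space_def)
  have V: "subspace V" unfolding B(2) by (rule subspace_span)
  obtain g where g: "\<And>x y. g (x + y) = g x + g y" "\<And>c x. g (scale c x) = scale c (g x)"
    "\<And>x. g x \<in> V" "\<And>x. x \<in> V \<Longrightarrow> g x = x"
    using ex_projection_onto_span[of B] B(2) by metis
  define h' where "h' x y = h (g x) (g y)" for x y
  have h'_eq: "h x y = h' x y" if "x \<in> V" "y \<in> V" for x y
    using g(4) that by (simp add: h'_def)
  have h'_add: "h' (x + y) z = h' x z + h' y z" and h'_scale: "h' (scale c x) y = c * h' x y"
    and h'_herm: "h' x y = bar (h' y x)" for x y z c
    using assms(6) g unfolding h'_def hermitian_space_def by metis+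
  have R: "integers val emb = val_ring D.w" by (rule D.integers_eq)
  obtain S where S: "finite S" "S \<subseteq> V" and L: "L = span_over (val_ring D.w) scale S"
    using assms(8) unfolding R hermitian_lattice_def by blast
  \<comment> \<open>Padding coefficients with zeros gives all elements of \<open>L\<close> the same
    index set, so sums add termwise.\<close>
  have L_iff: "x \<in> L \<longleftrightarrow> (\<exists>c. c ` S \<subseteq> val_ring D.w \<and> x = (\<Sum>s\<in>S. scale (c s) s))" for x
  proof
    assume "x \<in> L"
    then obtain F c where Fc: "finite F" "F \<subseteq> S" "c ` F \<subseteq> val_ring D.w" "x = (\<Sum>s\<in>F. scale (c s) s)"
      unfolding L span_over_def by blast
    define c' where "c' s = (if s \<in> F then c s else 0)" for s
    have "x = (\<Sum>s\<in>S. scale (c' s) s)"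
      unfolding Fc(4) by (rule sum.mono_neutral_cong_left) (use S Fc c'_def in auto)
    moreover have "c' ` S \<subseteq> val_ring D.w" using Fc by (auto simp: c'_def)
    ultimately show "\<exists>c. c ` S \<subseteq> val_ring D.w \<and> x = (\<Sum>s\<in>S. scale (c s) s)" by blast
  next
    assume "\<exists>c. c ` S \<subseteq> val_ring D.w \<and> x = (\<Sum>s\<in>S. scale (c s) s)"
    then show "x \<in> L" unfolding L span_over_def using S(1) by blast
  qed
  have L_V: "L \<subseteq> V"
    unfolding L_iff subset_iff using S(2) V by (auto intro!: subspace_sum subspace_scale)
  obtain n where n: "(\<lambda>(s, s'). h' s s') ` (S \<times> S) \<subseteq> val_ge D.w n"
    using D.E.finite_subset_P[of "(\<lambda>(s, s'). h' s s') ` (S \<times> S)"] S(1) by blast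
  have sum_P: "h' (\<Sum>s\<in>F. scale (c s) s) z \<in> val_ge D.w n"
    if "F \<subseteq> S" "c ` F \<subseteq> val_ring D.w" "\<And>s. s \<in> S \<Longrightarrow> h' s z \<in> val_ge D.w n" for F c z
  proof -
    have "finite F" using that(1) S(1) finite_subset by blast
    then show ?thesis using that
    proof induction
      case empty
      have "h' 0 z = 0" using h'_add[of 0 0 z] by simp
      then show ?case by simp
    next
      case (insert s F)
      have "c s * h' s z \<in> val_ge D.w n"
        by (rule D.E.P_mult[of _ 0]) (use insert.prems in auto)
      then show ?case using insert by (auto simp: h'_add h'_scale intro!: D.E.P_add)
    qed
  qed
  have "hermitian D.w bar p scale h' V L"
  proof (intro hermitian.intro p hermitian_axioms.intro vector_space_axioms)
    show "\<exists>B. finite B \<and> V = span B" using B by blast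
    show "L \<subseteq> V" by (rule L_V)
    show "0 \<in> L" unfolding L_iff by (rule exI[of _ "\<lambda>_. 0"]) auto
    show "x + y \<in> L" if xy: "x \<in> L" "y \<in> L" for x y
    proof -
      obtain a b where "a ` S \<subseteq> val_ring D.w" "b ` S \<subseteq> val_ring D.w"
        "x = (\<Sum>s\<in>S. scale (a s) s)" "y = (\<Sum>s\<in>S. scale (b s) s)" using xy unfolding L_iff by blast
      then show ?thesis unfolding L_iff
        by (intro exI[of _ "\<lambda>s. a s + b s"]) (auto simp: scale_left_distrib sum.distrib intro: D.E.P_add)
    qed
    show "scale c x \<in> L" if cx: "c \<in> val_ring D.w" "x \<in> L" for c x
    proof -
      obtain a where "a ` S \<subseteq> val_ring D.w" "x = (\<Sum>s\<in>S. scale (a s) s)"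
        using cx unfolding L_iff by blast
      moreover from this have "c * a s \<in> val_ring D.w" if "s \<in> S" for s
        by (intro D.E.P_mult[OF cx(1)]) (use that in auto)
      ultimately show ?thesis unfolding L_iff
        by (intro exI[of _ "\<lambda>s. c * a s"]) (auto simp: scale_sum_right)
    qed
    show "\<exists>n. \<forall>x\<in>L. \<forall>y\<in>L. h' x y \<in> val_ge D.w n"
    proof (intro exI[of _ n] ballI)
      fix x y assume "x \<in> L" "y \<in> L"
      then obtain a b where ab: "a ` S \<subseteq> val_ring D.w" "b ` S \<subseteq> val_ring D.w"
        "x = (\<Sum>s\<in>S. scale (a s) s)" "y = (\<Sum>s\<in>S. scale (b s) s)" unfolding L_iff by blast
      have "h' y s \<in> val_ge D.w n" if "s \<in> S" for s
        unfolding ab(4) by (rule sum_P[OF subset_refl ab(2)]) (use n that in auto)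
      then have "h' s y \<in> val_ge D.w n" if "s \<in> S" for s using that h'_herm F.P_bar by metis
      then show "h' x y \<in> val_ge D.w n" unfolding ab(3) by (rule sum_P[OF subset_refl ab(1)])
    qed
    show "x = 0" if "x \<in> V" "\<And>y. y \<in> V \<Longrightarrow> h' x y = 0" for x
      using assms(7) that h'_eq unfolding nondegenerate_def by metis
    show "x = 0" if "x \<in> L" "\<And>y. y \<in> L \<Longrightarrow> h' x y = 0" for x
      using assms(9) that h'_eq L_V unfolding nondegenerate_def by (metis subsetD)
  qed (rule h'_add h'_scale h'_herm)+
  then interpret H: hermitian D.w bar p scale h' V L .
  have "lattice_unitary_group scale h V L = lattice_unitary_group scale h' V L"
    by (rule lattice_unitary_group_cong[OF h'_eq])
  also have "\<dots> = X_group (val_ring D.w) bar scale h' V L"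
    using H.U_eq_X by (simp only: H.U_def H.X_def)
  also have "\<dots> = X_group (val_ring D.w) bar scale h V L"
    by (rule X_group_cong[OF h'_eq V L_V, symmetric])
  finally show ?thesis by (simp only: R)
qed

end
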